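(* Suppose that the kernel $K$ satisfies condition (A) (see context) and let $b\in C^{\chi_b}(\mathbb{R})$, $\sigma\in C^{\chi_\sigma}(\mathbb{R})$ for some $\chi_b,\chi_\sigma\in(0,1]$. Let $g=\Xi S(\cdot)\xi_g$ with $\xi_g\in\mathcal{H}_{\eta_g}$ for some $\eta_g>\eta_*$, and put $\chi_g:=(\eta_g-\eta_* )/2$. Let $\mathcal{X}$ be any continuous weak solution on $\mathcal{H}_{\eta_{\mathcal{X}}}$, where $\eta_{\mathcal{X}}\in(\eta_*,1-\eta_* )$, of $$\mathcal{X}_t=S(t)\xi_g+\int_0^tS(t-s)\xi_K\,b(\Xi\mathcal{X}_s)\,\mathrm{d}s+\int_0^tS(t-s)\xi_K\,\sigma(\Xi\mathcal{X}_s)\,\mathrm{d}B_s,\qquad t\in\mathbb{R}_+.$$ Fix $N\ge1$, and let $y_1,\dots,y_N\in\mathcal{H}_\eta\setminus\{0\}$ with $\eta\le\eta_{\mathcal{X}}$ and $0<t_1\le\dots\le t_N$ satisfy: (i) There exist $C,\gamma_*>0$ such that $$\lambda_i(n):=\Big(\int_0^{1/n}\langle S(r)\xi_K,y_i\rangle_\eta^2\,\mathrm{d}r\Big)^{-1}$$ satisfies $\sqrt{\lambda_i(n)}\le Cn^{\gamma_*}$ for all $i\in\{1,\dots,N\}$ (and $n\in\mathbb{N}$), and $$\gamma_*<\frac{\min\{1,1-\eta-\eta_*\}}{2}+\min\Big\{\Big(\frac12-\eta_*^+\Big),\chi_g\Big\}\chi_\sigma.$$ (ii) There exists a symmetric,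 positive semi-definite $N\times N$-matrix $\Sigma$ such that for all $i,j\in\{1,\dots,N\}$ with $i\le j$ $$\lim_{n\to\infty}\sqrt{\lambda_i(n)\lambda_j(n)}\int_0^{t_i/n}\langle S((t_j-t_i)/n+r)\xi_K,y_j\rangle_\eta\,\langle S(r)\xi_K,y_i\rangle_\eta\,\mathrm{d}r=\Sigma_{ij}.$$ Then, as $n\to\infty$, $$\Big(\sqrt{\lambda_i(n)}\,\langle\mathcal{X}_{t_i/n}-S(t_i/n)\xi_g,y_i\rangle_\eta\Big)_{i=1,\dots,N}\ \xrightarrow{\ d\ }\ \mathcal{N}\big(0,\sigma(\Xi\xi_g)^2\,\Sigma\big).$$
   Context: $\mathbb{R}_+=[0,\infty)$; $a^+=\max\{a,0\}$ (with $(-\infty)^+=0$ and the obvious conventions if $\eta_*=-\infty$, e.g. $\chi_g=\infty$). Condition (A): $K:\mathbb{R}_+\to\mathbb{R}_+$ (possibly singular at $0$) is completely monotone with representation $K(t)=K(\infty)+\int_{\mathbb{R}_+}e^{-xt}\,\mu(\mathrm{d}x)$, where $K(\infty)=\lim_{t\to\infty}K(t)\ge0$ and $\mu$ is a Borel measure on $\mathbb{R}_+$ with $\mu(\{0\})=0$ and $$\eta_*=\inf\Big\{\eta\in\mathbb{R}:\int_{\mathbb{R}_+}(1+x)^{-\eta}\,\mu(\mathrm{d}x)<\infty\Big\}\in[-\infty,1/2).$$ For $\eta\in\mathbb{R}$, $\mathcal{H}_\eta$ is the weighted Hilbert space of equivalence classes of functions $y:\mathbb{R}_+\to\mathbb{R}$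 with inner product $\langle y,\tilde y\rangle_\eta=y(0)\tilde y(0)+\int_{\mathbb{R}_+}y(x)\tilde y(x)(1+x)^\eta\,\mu(\mathrm{d}x)$. The projection operator is $\Xi y=y(0)+\int_{\mathbb{R}_+}y(x)\,\mu(\mathrm{d}x)$, a continuous linear functional on $\mathcal{H}_\eta$ for $\eta>\eta_*$. The semigroup is $S(t)y(x)=e^{-tx}y(x)$. Set $\xi_K(x)=\mathbf{1}_{(0,\infty)}(x)+K(\infty)\mathbf{1}_{\{0\}}(x)$, so $K(t)=\Xi S(t)\xi_K$. For $\chi\in(0,1]$, $f\in C^\chi(\mathbb{R})$ means that there is a constant $C$ with $|f(x)-f(y)|\le C|x-y|^\chi$ for all $x,y\in\mathbb{R}$. A continuous weak solution on $\mathcal{H}_{\eta_{\mathcal{X}}}$ is an adapted process with continuous paths in $\mathcal{H}_{\eta_{\mathcal{X}}}$, on some filtered probability space carrying a real Brownian motion $B$, satisfying the equation. *)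

theory Defs
  imports "HOL-Probability.Probability"
begin

section \<open>The kernel\<close>

(* On (0,oo); nothing is required at 0, where K may be singular. *)
definition completely_monotone :: "(real \<Rightarrow> real) \<Rightarrow> bool" where
  "completely_monotone K \<longleftrightarrow>
     (\<exists>D :: nat \<Rightarrow> real \<Rightarrow> real. (\<forall>t>0. D 0 t = K t) \<and>
        (\<forall>n. \<forall>t>0. (D n has_real_derivative D (Suc n) t) (at t) \<and> 0 \<le> (-1) ^ n * D n t))"

(* Valued in ereal, with Inf {} = oo. *)
definition eta_star :: "real measure \<Rightarrow> ereal" where
  "eta_star \<mu> = Inf {ereal \<eta> |\<eta>. (\<integral>\<^sup>+x. ennreal ((1 + x) powr (- \<eta>)) \<partial>\<mu>) < \<infinity>}"

(* A Borel measure on [0,oo) without atom at 0 is encoded as a Borel measure on the real line that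
   does not charge (-oo,0].  Kinf stands for K(oo). *)
definition condition_A :: "(real \<Rightarrow> real) \<Rightarrow> real \<Rightarrow> real measure \<Rightarrow> bool" where
  "condition_A K Kinf \<mu> \<longleftrightarrow>
     (\<forall>t>0. 0 \<le> K t) \<and> completely_monotone K \<and>
     (K \<longlongrightarrow> Kinf) at_top \<and> 0 \<le> Kinf \<and>
     sets \<mu> = sets borel \<and> emeasure \<mu> {..0} = 0 \<and>
     (\<forall>t>0. integrable \<mu> (\<lambda>x. exp (- x * t)) \<and> K t = Kinf + (\<integral>x. exp (- x * t) \<partial>\<mu>)) \<and>
     eta_star \<mu> < 1 / 2"

definition holder :: "real \<Rightarrow> (real \<Rightarrow> real) \<Rightarrow> bool" where
  "holder a f \<longleftrightarrow> (\<exists>C. \<forall>x y. \<bar>f x - f y\<bar> \<le> C * \<bar>x - y\<bar> powr a)"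


section \<open>The weighted Hilbert spaces\<close>

(* The elements of H_eta are handled through representatives y :: real => real.  Their values on
   (-oo,0) are irrelevant, and two representatives are identified by Heq, i.e. when they agree at 0
   and mu-almost everywhere; Heq does not depend on eta. *)

definition Hsp :: "real measure \<Rightarrow> real \<Rightarrow> (real \<Rightarrow> real) set" where
  "Hsp \<mu> \<eta> = {y \<in> borel_measurable borel. integrable \<mu> (\<lambda>x. (y x)\<^sup>2 * (1 + x) powr \<eta>)}"

definition Heq :: "real measure \<Rightarrow> (real \<Rightarrow> real) \<Rightarrow> (real \<Rightarrow> real) \<Rightarrow> bool" where
  "Heq \<mu> y z \<longleftrightarrow> y 0 = z 0 \<and> (AE x in \<mu>. y x = z x)"

definition Hinner :: "real measure \<Rightarrow> real \<Rightarrow> (real \<Rightarrow> real) \<Rightarrow> (real \<Rightarrow> real) \<Rightarrow> real" where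
  "Hinner \<mu> \<eta> y z = y 0 * z 0 + (\<integral>x. y x * z x * (1 + x) powr \<eta> \<partial>\<mu>)"

definition Hnorm :: "real measure \<Rightarrow> real \<Rightarrow> (real \<Rightarrow> real) \<Rightarrow> real" where
  "Hnorm \<mu> \<eta> y = sqrt (Hinner \<mu> \<eta> y y)"

definition Hdist :: "real measure \<Rightarrow> real \<Rightarrow> (real \<Rightarrow> real) \<Rightarrow> (real \<Rightarrow> real) \<Rightarrow> real" where
  "Hdist \<mu> \<eta> y z = Hnorm \<mu> \<eta> (\<lambda>x. y x - z x)"

(* Borel sigma-algebra: the generators are the norm-open sets, which are saturated under Heq. *)
definition Hborel :: "real measure \<Rightarrow> real \<Rightarrow> (real \<Rightarrow> real) measure" where
  "Hborel \<mu> \<eta> = sigma (Hsp \<mu> \<eta>)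
     {U. U \<subseteq> Hsp \<mu> \<eta> \<and> (\<forall>y\<in>U. \<exists>e>0. \<forall>z\<in>Hsp \<mu> \<eta>. Hdist \<mu> \<eta> z y < e \<longrightarrow> z \<in> U)}"

definition Xi :: "real measure \<Rightarrow> (real \<Rightarrow> real) \<Rightarrow> real" where
  "Xi \<mu> y = y 0 + (\<integral>x. y x \<partial>\<mu>)"

definition Sg :: "real \<Rightarrow> (real \<Rightarrow> real) \<Rightarrow> real \<Rightarrow> real" where
  "Sg t y = (\<lambda>x. exp (- t * x) * y x)"

definition xiK :: "real \<Rightarrow> real \<Rightarrow> real" where
  "xiK Kinf = (\<lambda>x. indicator {0<..} x + Kinf * indicator {0} x)"


section \<open>Integration in the weighted Hilbert spaces\<close>

(* The Bochner integral, as in \<open>has_bochner_integral\<close> of HOL-Analysis, whose type-class based version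
   does not apply to the parametrised spaces Hsp; I is determined up to Heq. *)
definition has_H_integral ::
    "real measure \<Rightarrow> real \<Rightarrow> 'b measure \<Rightarrow> ('b \<Rightarrow> real \<Rightarrow> real) \<Rightarrow> (real \<Rightarrow> real) \<Rightarrow> bool" where
  "has_H_integral \<mu> \<eta> N f I \<longleftrightarrow>
     f \<in> measurable N (Hborel \<mu> \<eta>) \<and> I \<in> Hsp \<mu> \<eta> \<and>
     (\<exists>(m :: nat \<Rightarrow> nat) (A :: nat \<Rightarrow> nat \<Rightarrow> 'b set) (\<phi> :: nat \<Rightarrow> nat \<Rightarrow> real \<Rightarrow> real).
        (\<forall>n. \<forall>k<m n. A n k \<in> sets N \<and> emeasure N (A n k) < \<infinity> \<and> \<phi> n k \<in> Hsp \<mu> \<eta>) \<and>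
        (\<lambda>n. \<integral>\<^sup>+r. ennreal (Hdist \<mu> \<eta> (f r) (\<lambda>x. \<Sum>k<m n. indicator (A n k) r * \<phi> n k x)) \<partial>N)
           \<longlonglongrightarrow> 0 \<and>
        (\<lambda>n. Hdist \<mu> \<eta> I (\<lambda>x. \<Sum>k<m n. measure N (A n k) * \<phi> n k x)) \<longlonglongrightarrow> 0)"

definition filtered_prob_space :: "'a measure \<Rightarrow> (real \<Rightarrow> 'a measure) \<Rightarrow> bool" where
  "filtered_prob_space M F \<longleftrightarrow>
     prob_space M \<and> filtration (space M) F \<and> (\<forall>t. subalgebra M (F t))"

(* Brownian motion relative to the filtration F, indexed by t \<ge> 0. *)
definition brownian_motion ::
    "'a measure \<Rightarrow> (real \<Rightarrow> 'a measure) \<Rightarrow> (real \<Rightarrow> 'a \<Rightarrow> real) \<Rightarrow> bool" where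
  "brownian_motion M F B \<longleftrightarrow>
     (AE \<omega> in M. B 0 \<omega> = 0) \<and>
     (\<forall>t\<ge>0. B t \<in> borel_measurable (F t)) \<and>
     (\<forall>\<omega>\<in>space M. continuous_on {0..} (\<lambda>t. B t \<omega>)) \<and>
     (\<forall>s\<ge>0. \<forall>t>s.
        distributed M lborel (\<lambda>\<omega>. B t \<omega> - B s \<omega>) (normal_density 0 (sqrt (t - s))) \<and>
        prob_space.indep_set M (sets (F s))
          (sets (vimage_algebra (space M) (\<lambda>\<omega>. B t \<omega> - B s \<omega>) borel)))"

(* The simple process with value \<phi> k on (s k, s (k+1)], for k < m. *)
definition simple_process ::
    "'a measure \<Rightarrow> (real \<Rightarrow> 'a measure) \<Rightarrow> real measure \<Rightarrow> real \<Rightarrow> real \<Rightarrow>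
     nat \<Rightarrow> (nat \<Rightarrow> real) \<Rightarrow> (nat \<Rightarrow> 'a \<Rightarrow> real \<Rightarrow> real) \<Rightarrow> bool" where
  "simple_process M F \<mu> \<eta> t m s \<phi> \<longleftrightarrow>
     (\<forall>k\<le>m. 0 \<le> s k \<and> s k \<le> t) \<and> (\<forall>k<m. s k \<le> s (Suc k)) \<and>
     (\<forall>k<m. \<phi> k \<in> measurable (F (s k)) (Hborel \<mu> \<eta>)) \<and>
     (\<exists>c. \<forall>k<m. \<forall>\<omega>\<in>space M. Hnorm \<mu> \<eta> (\<phi> k \<omega>) \<le> c)"

definition simple_value ::
    "nat \<Rightarrow> (nat \<Rightarrow> real) \<Rightarrow> (nat \<Rightarrow> 'a \<Rightarrow> real \<Rightarrow> real) \<Rightarrow> real \<Rightarrow> 'a \<Rightarrow> real \<Rightarrow> real" where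
  "simple_value m s \<phi> r \<omega> = (\<lambda>x. \<Sum>k<m. indicator {s k<..s (Suc k)} r * \<phi> k \<omega> x)"

definition simple_ito ::
    "(real \<Rightarrow> 'a \<Rightarrow> real) \<Rightarrow> nat \<Rightarrow> (nat \<Rightarrow> real) \<Rightarrow> (nat \<Rightarrow> 'a \<Rightarrow> real \<Rightarrow> real) \<Rightarrow>
     'a \<Rightarrow> real \<Rightarrow> real" where
  "simple_ito B m s \<phi> \<omega> = (\<lambda>x. \<Sum>k<m. (B (s (Suc k)) \<omega> - B (s k) \<omega>) * \<phi> k \<omega> x)"

definition tends_to_0_in_prob :: "'a measure \<Rightarrow> (nat \<Rightarrow> 'a \<Rightarrow> ennreal) \<Rightarrow> bool" where
  "tends_to_0_in_prob M Z \<longleftrightarrow>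
     (\<forall>n. Z n \<in> borel_measurable M) \<and>
     (\<forall>e::real>0. (\<lambda>n. measure M {\<omega> \<in> space M. ennreal e \<le> Z n \<omega>}) \<longlonglongrightarrow> 0)"

(* J is the H_eta-valued Ito integral of \<Phi> over [0,t]: the limit in probability of the integrals of
   simple processes \<Phi>\<^sub>n for which the time integral of |\<Phi> - \<Phi>\<^sub>n|^2 tends to 0 in probability.
   J is determined up to Heq and null sets.  The value of \<Phi> at time t is immaterial; it is left out
   because in the equation below it need not belong to H_eta. *)
definition has_ito_integral ::
    "'a measure \<Rightarrow> (real \<Rightarrow> 'a measure) \<Rightarrow> (real \<Rightarrow> 'a \<Rightarrow> real) \<Rightarrow> real measure \<Rightarrow> real \<Rightarrow> real \<Rightarrow>
     (real \<Rightarrow> 'a \<Rightarrow> real \<Rightarrow> real) \<Rightarrow> ('a \<Rightarrow> real \<Rightarrow> real) \<Rightarrow> bool" where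
  "has_ito_integral M F B \<mu> \<eta> t \<Phi> J \<longleftrightarrow>
     (\<forall>r. 0 \<le> r \<and> r < t \<longrightarrow> \<Phi> r \<in> measurable (F r) (Hborel \<mu> \<eta>)) \<and>
     (\<lambda>(r, \<omega>). \<Phi> r \<omega>) \<in> measurable (restrict_space borel {0..<t} \<Otimes>\<^sub>M M) (Hborel \<mu> \<eta>) \<and>
     J \<in> measurable M (Hborel \<mu> \<eta>) \<and>
     (\<exists>(m :: nat \<Rightarrow> nat) (s :: nat \<Rightarrow> nat \<Rightarrow> real) (\<phi> :: nat \<Rightarrow> nat \<Rightarrow> 'a \<Rightarrow> real \<Rightarrow> real).
        (\<forall>n. simple_process M F \<mu> \<eta> t (m n) (s n) (\<phi> n)) \<and>
        tends_to_0_in_prob M (\<lambda>n \<omega>. \<integral>\<^sup>+r\<in>{0..<t}.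
           ennreal ((Hdist \<mu> \<eta> (\<Phi> r \<omega>) (simple_value (m n) (s n) (\<phi> n) r \<omega>))\<^sup>2) \<partial>lborel) \<and>
        tends_to_0_in_prob M
          (\<lambda>n \<omega>. ennreal (Hdist \<mu> \<eta> (J \<omega>) (simple_ito B (m n) (s n) (\<phi> n) \<omega>))))"


section \<open>The stochastic evolution equation\<close>

(* (M, F, B, X) is a continuous weak solution on H_\<eta>. *)
definition weak_solution ::
    "real measure \<Rightarrow> real \<Rightarrow> (real \<Rightarrow> real) \<Rightarrow> (real \<Rightarrow> real) \<Rightarrow> (real \<Rightarrow> real) \<Rightarrow> real \<Rightarrow>
     'a measure \<Rightarrow> (real \<Rightarrow> 'a measure) \<Rightarrow> (real \<Rightarrow> 'a \<Rightarrow> real) \<Rightarrow>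
     (real \<Rightarrow> 'a \<Rightarrow> real \<Rightarrow> real) \<Rightarrow> bool" where
  "weak_solution \<mu> Kinf b \<sigma> \<xi>\<^sub>g \<eta> M F B X \<longleftrightarrow>
     filtered_prob_space M F \<and> brownian_motion M F B \<and>
     (\<forall>t\<ge>0. X t \<in> measurable (F t) (Hborel \<mu> \<eta>)) \<and>
     (\<forall>\<omega>\<in>space M. \<forall>t\<ge>0. ((\<lambda>s. Hdist \<mu> \<eta> (X s \<omega>) (X t \<omega>)) \<longlongrightarrow> 0) (at t within {0..})) \<and>
     (\<forall>t\<ge>0. \<exists>D J :: 'a \<Rightarrow> real \<Rightarrow> real.
        (AE \<omega> in M. has_H_integral \<mu> \<eta> (restrict_space lborel {0..<t})
           (\<lambda>s x. Sg (t - s) (xiK Kinf) x * b (Xi \<mu> (X s \<omega>))) (D \<omega>)) \<and>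
        has_ito_integral M F B \<mu> \<eta> t
          (\<lambda>s \<omega> x. Sg (t - s) (xiK Kinf) x * \<sigma> (Xi \<mu> (X s \<omega>))) J \<and>
        (AE \<omega> in M. Heq \<mu> (X t \<omega>) (\<lambda>x. Sg t \<xi>\<^sub>g x + D \<omega> x + J \<omega> x)))"


section \<open>Convergence in distribution and normal laws\<close>

definition converges_in_distribution ::
    "'a measure \<Rightarrow> (nat \<Rightarrow> 'a \<Rightarrow> 'b::topological_space) \<Rightarrow> 'b measure \<Rightarrow> bool" where
  "converges_in_distribution M Y \<nu> \<longleftrightarrow>
     (\<forall>n. Y n \<in> borel_measurable M) \<and>
     (\<forall>f :: 'b \<Rightarrow> real. continuous_on UNIV f \<and> bounded (range f) \<longrightarrow>
        (\<lambda>n. \<integral>\<omega>. f (Y n \<omega>) \<partial>M) \<longlonglongrightarrow> (\<integral>x. f x \<partial>\<nu>))"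

definition psd_matrix :: "real ^ 'n ^ 'n \<Rightarrow> bool" where
  "psd_matrix A \<longleftrightarrow> transpose A = A \<and> (\<forall>v. 0 \<le> v \<bullet> (A *v v))"

(* The law of m + A Z for Z standard normal and A A^T = C, which does not depend on the choice of A;
   such an A exists exactly if C is symmetric positive semi-definite, C may be singular. *)
definition multivariate_normal :: "real ^ 'n \<Rightarrow> real ^ 'n ^ 'n \<Rightarrow> (real ^ 'n) measure" where
  "multivariate_normal m C =
     distr (\<Pi>\<^sub>M i\<in>UNIV. density lborel std_normal_density) borel
       (\<lambda>z. m + (SOME A :: real ^ 'n ^ 'n. A ** transpose A = C) *v (\<chi> i. z i))"


(* The integral whose reciprocal is \<lambda>(n).  Since 1 / 0 = 0 in HOL, finiteness of \<lambda>(n) has to be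
   expressed as positivity of lam_int. *)
definition lam_int :: "real measure \<Rightarrow> real \<Rightarrow> real \<Rightarrow> (real \<Rightarrow> real) \<Rightarrow> nat \<Rightarrow> real" where
  "lam_int \<mu> Kinf \<eta> y n =
     (LINT r:{0..1 / real n}|lborel. (Hinner \<mu> \<eta> (Sg r (xiK Kinf)) y)\<^sup>2)"

definition lam :: "real measure \<Rightarrow> real \<Rightarrow> real \<Rightarrow> (real \<Rightarrow> real) \<Rightarrow> nat \<Rightarrow> real" where
  "lam \<mu> Kinf \<eta> y n = 1 / lam_int \<mu> Kinf \<eta> y n"

end

theory Submission
  imports Defs
begin

text \<open>
  Write \<open>u i r\<close> for the pairing of \<open>S(r) xi_K\<close> with \<open>y i\<close> in the space of weight \<open>\<eta>\<close>, and let \<open>k i n s\<close>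
  be \<open>sqrt (\<lambda> i n) * u i (t i / n - s)\<close> for \<open>0 \<le> s < t i / n\<close> and \<open>0\<close> elsewhere.  Pairing with \<open>y i\<close> is a
  bounded functional on the state space, since \<open>\<eta> \<le> \<eta>\<^sub>X\<close>.  Applied to the equation it shows that the \<open>i\<close>-th
  normalised increment is the integral of \<open>k i n s * b (\<Xi> X s)\<close> against \<open>ds\<close> plus that of
  \<open>k i n s * \<sigma> (\<Xi> X s)\<close> against \<open>dB\<close>.

  Under the substitution \<open>r = t i / n - s\<close> the expression in the covariance hypothesis becomes the scalar
  product of \<open>k i n\<close> and \<open>k j n\<close> in \<open>L\<^sup>2\<close>.  So these scalar products converge to \<open>\<Sigma> i j\<close>, and the
  diagonal case \<open>i = j\<close> says in particular that the functions \<open>k i n\<close> stay bounded in \<open>L\<^sup>2\<close>.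
  They live on intervals \<open>[0, t i / n)\<close> that shrink to \<open>{0}\<close>, and \<open>\<Xi> X\<close> is continuous at time \<open>0\<close> with
  value \<open>\<Xi> \<xi>\<^sub>g\<close>.  Hence, almost surely, the diffusion integrand differs from
  \<open>\<sigma> (\<Xi> \<xi>\<^sub>g) * k i n\<close> by a function that vanishes in \<open>L\<^sup>2\<close>.  The drift is dominated by a constant times the
  \<open>L\<^sup>1\<close> norm of \<open>k i n\<close>, which vanishes because \<open>k i n\<close> is bounded in \<open>L\<^sup>2\<close> and its support shrinks.
  This is \<open>small_time_approximation\<close>.

  Fix a vector \<open>v\<close>.  The linear combination of the increments with coefficients \<open>v i\<close> is, up to a vanishing
  error, a stochastic integral \<open>I\<close> whose integrand has a squared \<open>L\<^sup>2\<close> norm \<open>Q\<close> tending almost surely to the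
  constant \<open>q = (\<sigma> (\<Xi> \<xi>\<^sub>g))\<^sup>2 * (v \<bullet> \<Sigma> v)\<close>.  The exponential martingale gives
  \<open>E exp (\<i> I + Q / 2) = 1\<close>, whence \<open>E exp (\<i> I)\<close> tends to \<open>exp (- q / 2)\<close>
  (\<open>elementary_char_estimate\<close>, \<open>elementary_char_limit\<close>).  The Ito integral being a limit in
  probability of integrals of simple processes, the argument is carried out for approximating simple
  processes, chosen so that the error probabilities are summable in \<open>n\<close> (\<open>ito_integral_approx\<close>); by the
  Borel-Cantelli lemma all errors then vanish almost surely.

  The limit \<open>exp (- q / 2)\<close> is the characteristic function of the normal law at \<open>v\<close>
  (\<open>char_multivariate_normal\<close>), and \<open>levy_continuity_euclidean\<close> turns the convergence for every \<open>v\<close>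
  into convergence in distribution.
\<close>

section \<open>Convergence of characteristic functions in a Euclidean space\<close>

text \<open>Real trigonometric polynomials with arbitrary real frequencies.  The phase \<open>b\<close> makes the class contain
  the sines and, by the product formula for cosines, closed under multiplication.\<close>
inductive trig_sum :: "('a::euclidean_space \<Rightarrow> real) \<Rightarrow> bool" where
  cosine: "trig_sum (\<lambda>x. a * cos (v \<bullet> x + b))"
| add: "trig_sum f \<Longrightarrow> trig_sum g \<Longrightarrow> trig_sum (\<lambda>x. f x + g x)"

lemma trig_sum_const: "trig_sum (\<lambda>x::'a::euclidean_space. c)"
  using trig_sum.cosine[of c "0::'a" 0] by simp

lemma trig_sum_sum:
  "finite I \<Longrightarrow> (\<And>i. i \<in> I \<Longrightarrow> trig_sum (f i)) \<Longrightarrow> trig_sum (\<lambda>x. \<Sum>i\<in>I. f i x)"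
  by (induction I rule: finite_induct) (auto intro: trig_sum_const trig_sum.add)

lemma trig_sum_mult:
  assumes "trig_sum f" "trig_sum g"
  shows "trig_sum (\<lambda>x. f x * g x)"
  using assms(1)
proof induction
  case (cosine a v b)
  show ?case using assms(2)
  proof induction
    case (cosine a' v' b')
    have "a * cos (v \<bullet> x + b) * (a' * cos (v' \<bullet> x + b')) =
       a * a' / 2 * cos ((v - v') \<bullet> x + (b - b')) + a * a' / 2 * cos ((v + v') \<bullet> x + (b + b'))" for x
    proof -
      have 1: "(v - v') \<bullet> x + (b - b') = (v \<bullet> x + b) - (v' \<bullet> x + b')"
        and 2: "(v + v') \<bullet> x + (b + b') = (v \<bullet> x + b) + (v' \<bullet> x + b')"
        by (auto simp: inner_diff_left inner_add_left)
      show ?thesis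
        unfolding 1 2 cos_diff[of "v \<bullet> x + b"] cos_add[of "v \<bullet> x + b"] by (simp add: field_simps)
    qed
    then show ?case by (simp only:) (intro trig_sum.intros)
  next
    case (add f g)
    then show ?case by (simp add: distrib_left trig_sum.add)
  qed
next
  case (add f g)
  then show ?case by (simp add: distrib_right trig_sum.add)
qed

lemma trig_sum_polynomial_of_sines:
  fixes p :: "'a::euclidean_space \<Rightarrow> real"
  assumes "real_polynomial_function p"
  shows "trig_sum (\<lambda>x. p (\<Sum>e\<in>Basis. sin (c * (x \<bullet> e)) *\<^sub>R e))"
  using assms
proof induction
  case (linear f)
  interpret bounded_linear f by fact
  have *: "f (\<Sum>e\<in>Basis. sin (c * (x \<bullet> e)) *\<^sub>R e)
      = (\<Sum>e\<in>Basis. f e * cos ((c *\<^sub>R e) \<bullet> x + (- pi / 2)))" for x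
  proof -
    have "cos ((c *\<^sub>R e) \<bullet> x + (- pi / 2)) = sin (c * (x \<bullet> e))" for e
      by (simp add: cos_diff inner_commute)
    then show ?thesis by (simp add: sum scaleR mult.commute)
  qed
  show ?case unfolding * by (intro trig_sum_sum trig_sum.cosine) auto
qed (auto intro: trig_sum_const trig_sum.add trig_sum_mult)

lemma trig_sum_continuous: "trig_sum f \<Longrightarrow> continuous_on UNIV f"
  by (induction rule: trig_sum.induct) (auto intro!: continuous_intros)

lemma trig_sum_bounded: "trig_sum f \<Longrightarrow> \<exists>K. \<forall>x. \<bar>f x\<bar> \<le> K"
proof (induction rule: trig_sum.induct)
  case (cosine a v b)
  have "\<bar>a * cos (v \<bullet> x + b)\<bar> \<le> \<bar>a\<bar>" for x
    using mult_left_mono[OF abs_cos_le_one, of "\<bar>a\<bar>"] by (simp add: abs_mult)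
  then show ?case by blast
next
  case (add f g)
  then obtain K K' where "\<And>x. \<bar>f x\<bar> \<le> K" "\<And>x. \<bar>g x\<bar> \<le> K'" by blast
  then have "\<bar>f x + g x\<bar> \<le> K + K'" for x
    by (meson abs_triangle_ineq add_mono order_trans)
  then show ?case by blast
qed

text \<open>A trigonometric approximation on a cube that is also bounded outside of it.  The triangle wave
  \<open>arcsin \<circ> sin\<close>, suitably scaled and applied to every coordinate, is the identity on the cube, so \<open>f\<close> may
  be replaced by its composition with this wave.  That composition is a continuous function of the vector of
  sines of the coordinates, which ranges over a compact cube; there it is approximated by a polynomial
  (Stone-Weierstrass), and a polynomial in sines is a trigonometric sum.  As the vector of sines never leaves
  its cube, the approximation of the composition is uniform on the whole space.\<close>
lemma approx_by_trig_sum: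
  fixes f :: "'a::euclidean_space \<Rightarrow> real"
  assumes f: "continuous_on UNIV f" "\<And>x. \<bar>f x\<bar> \<le> K" and L: "L > 0" and e: "\<epsilon> > 0"
  obtains q where "trig_sum q" "\<And>x. (\<And>e. e \<in> Basis \<Longrightarrow> \<bar>x \<bullet> e\<bar> \<le> L) \<Longrightarrow> \<bar>f x - q x\<bar> \<le> \<epsilon>"
    "\<And>x. \<bar>f x - q x\<bar> \<le> 2 * K + \<epsilon>"
proof -
  define c where "c = pi / (2 * L)"
  have c: "c > 0" using L by (simp add: c_def)
  define S :: "'a set" where "S = cbox (- (\<Sum>e\<in>Basis. e)) (\<Sum>e\<in>Basis. e)"
  define h :: "'a \<Rightarrow> 'a" where "h z = (\<Sum>e\<in>Basis. (arcsin (z \<bullet> e) / c) *\<^sub>R e)" for z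
  define s :: "'a \<Rightarrow> 'a" where "s x = (\<Sum>e\<in>Basis. sin (c * (x \<bullet> e)) *\<^sub>R e)" for x
  have S: "z \<in> S \<longleftrightarrow> (\<forall>e\<in>Basis. -1 \<le> z \<bullet> e \<and> z \<bullet> e \<le> 1)" for z
    by (simp add: S_def mem_box inner_sum_left_Basis)
  have s: "s x \<in> S" for x
    by (simp add: S s_def inner_sum_left_Basis)
  have "continuous_on S (\<lambda>z. f (h z))"
    unfolding h_def using c S
    by (intro continuous_on_compose2[OF f(1)] continuous_intros continuous_on_sum) auto
  moreover have "compact S" by (simp add: S_def)
  ultimately obtain p where p: "real_polynomial_function p" "\<And>z. z \<in> S \<Longrightarrow> \<bar>f (h z) - p z\<bar> < \<epsilon>"
    using Stone_Weierstrass_real_polynomial_function e by blast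
  define q where "q x = p (s x)" for x
  have q: "trig_sum q"
    using trig_sum_polynomial_of_sines[OF p(1)] unfolding q_def s_def .
  have 1: "\<bar>f (h (s x)) - q x\<bar> \<le> \<epsilon>" for x
    unfolding q_def using p(2)[OF s] by (simp add: less_imp_le)
  show thesis
  proof
    fix x :: 'a assume x: "\<And>e. e \<in> Basis \<Longrightarrow> \<bar>x \<bullet> e\<bar> \<le> L"
    have "arcsin (sin (c * (x \<bullet> e))) / c = x \<bullet> e" if "e \<in> Basis" for e
    proof -
      have "\<bar>c * (x \<bullet> e)\<bar> \<le> pi / 2"
        using mult_left_mono[OF x[OF that], of c] c L by (simp add: abs_mult c_def)
      then show ?thesis using c by (subst arcsin_sin) (auto simp: abs_le_iff)
    qed
    then have "h (s x) = x"
      unfolding h_def s_def by (simp add: inner_sum_left_Basis euclidean_representation)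
    then show "\<bar>f x - q x\<bar> \<le> \<epsilon>" using 1[of x] by simp
  next
    fix x show "\<bar>f x - q x\<bar> \<le> 2 * K + \<epsilon>"
      using 1[of x] f(2)[of x] f(2)[of "h (s x)"] by linarith
  qed fact
qed

text \<open>Convergence of characteristic functions gives convergence of the expectations of trigonometric sums,
  and these approximate a bounded continuous function well except on the event of being far out.  That event is
  controlled through the coordinates: by the one-dimensional continuity theorem the marginals converge weakly,
  so the expectations of the cut-off \<open>G R\<close> converge to those under \<open>\<nu>\<close>, which are small for large \<open>R\<close>.\<close>
lemma levy_continuity_euclidean:
  fixes Y :: "nat \<Rightarrow> 'b \<Rightarrow> 'a::euclidean_space" and \<nu> :: "'a measure"
  assumes M: "prob_space M" and \<nu>: "prob_space \<nu>" "sets \<nu> = sets borel"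
    and Y: "\<And>n. Y n \<in> borel_measurable M"
    and char: "\<And>v. (\<lambda>n. CLINT \<omega>|M. iexp (v \<bullet> Y n \<omega>)) \<longlonglongrightarrow> (CLINT x|\<nu>. iexp (v \<bullet> x))"
  shows "converges_in_distribution M Y \<nu>"
  unfolding converges_in_distribution_def
proof (intro conjI allI impI Y)
  interpret M: prob_space M by fact
  interpret N: prob_space \<nu> by fact
  note [measurable] = Y
  have [measurable_cong]: "sets \<nu> = sets borel" by fact
  have sp: "space \<nu> = UNIV" using sets_eq_imp_space_eq[OF \<nu>(2)] by simp
  have bM: "integrable M (\<lambda>\<omega>. g (Y n \<omega>))" if "continuous_on UNIV g" "\<And>x. \<bar>g x\<bar> \<le> K"
    for g :: "'a \<Rightarrow> real" and K n
    using that by (intro M.integrable_const_bound[where B=K])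
      (auto intro!: measurable_compose[OF Y] borel_measurable_continuous_onI)
  have bN: "integrable \<nu> g" if "continuous_on UNIV g" "\<And>x. \<bar>g x\<bar> \<le> K"
    for g :: "'a \<Rightarrow> real" and K
    using that by (intro N.integrable_const_bound[where B=K])
      (auto simp: measurable_cong_sets[OF \<nu>(2) refl] intro!: borel_measurable_continuous_onI)
  have trig: "(\<lambda>n. \<integral>\<omega>. q (Y n \<omega>) \<partial>M) \<longlonglongrightarrow> (\<integral>x. q x \<partial>\<nu>)" if "trig_sum q" for q
    using that
  proof induction
    case (cosine a v b)
    have *: "a * cos (t + b) = Re (a * iexp b * iexp t)" for t
      by (simp add: exp_Euler cos_add sin_of_real cos_of_real algebra_simps)
    have i1: "integrable M (\<lambda>\<omega>. a * iexp b * iexp (v \<bullet> Y n \<omega>))" for n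
      by (intro M.integrable_const_bound[where B="\<bar>a\<bar>"]) (auto simp: norm_mult)
    have i2: "integrable \<nu> (\<lambda>x. a * iexp b * iexp (v \<bullet> x))"
      by (intro N.integrable_const_bound[where B="\<bar>a\<bar>"]) (auto simp: norm_mult)
    show ?case unfolding *
      using i1 i2 by (subst (1 2) integral_Re) (auto simp del: times_complex.sel intro!: tendsto_Re tendsto_mult_left char)
  next
    case (add f g)
    from trig_sum_bounded[OF add.hyps(1)] trig_sum_bounded[OF add.hyps(2)]
    obtain K K' where K: "\<And>x. \<bar>f x\<bar> \<le> K" "\<And>x. \<bar>g x\<bar> \<le> K'" by auto
    note c = trig_sum_continuous[OF add.hyps(1)] trig_sum_continuous[OF add.hyps(2)]
    have "(\<integral>\<omega>. f (Y n \<omega>) + g (Y n \<omega>) \<partial>M) = (\<integral>\<omega>. f (Y n \<omega>) \<partial>M) + (\<integral>\<omega>. g (Y n \<omega>) \<partial>M)" for n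
      by (rule Bochner_Integration.integral_add[OF bM[OF c(1) K(1)] bM[OF c(2) K(2)]])
    moreover have "(\<integral>x. f x + g x \<partial>\<nu>) = (\<integral>x. f x \<partial>\<nu>) + (\<integral>x. g x \<partial>\<nu>)"
      by (rule Bochner_Integration.integral_add[OF bN[OF c(1) K(1)] bN[OF c(2) K(2)]])
    ultimately show ?case using tendsto_add[OF add.IH] by simp
  qed
  have marginal: "(\<lambda>n. \<integral>\<omega>. g (Y n \<omega> \<bullet> e) \<partial>M) \<longlonglongrightarrow> (\<integral>x. g (x \<bullet> e) \<partial>\<nu>)"
    if g: "continuous_on UNIV g" "\<And>x. \<bar>g x\<bar> \<le> K" for g :: "real \<Rightarrow> real" and K and e :: 'a
  proof -
    have [measurable]: "g \<in> borel_measurable borel" using g by (intro borel_measurable_continuous_onI)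
    let ?D = "\<lambda>n. distr M borel (\<lambda>\<omega>. Y n \<omega> \<bullet> e)" and ?E = "distr \<nu> borel (\<lambda>x. x \<bullet> e)"
    have D: "real_distribution (?D n)" for n
      by (rule M.real_distribution_distr) measurable
    have E: "real_distribution ?E"
      by (rule N.real_distribution_distr) measurable
    have "weak_conv_m ?D ?E"
    proof (rule levy_continuity[OF D E])
      fix t
      have "char (?D n) t = (CLINT \<omega>|M. iexp ((t *\<^sub>R e) \<bullet> Y n \<omega>))" for n
        by (simp add: char_def integral_distr inner_commute)
      moreover have "char ?E t = (CLINT x|\<nu>. iexp ((t *\<^sub>R e) \<bullet> x))"
        by (simp add: char_def integral_distr inner_commute)
      ultimately show "(\<lambda>n. char (?D n) t) \<longlonglongrightarrow> char ?E t"
        using char[of "t *\<^sub>R e"] by (simp only:)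
    qed
    then have "(\<lambda>n. integral\<^sup>L (?D n) g) \<longlonglongrightarrow> integral\<^sup>L ?E g"
      using g(2) g(1)
      by (intro weak_conv_imp_integral_bdd_continuous_conv[OF D E, where B=K])
         (auto simp: continuous_on_eq_continuous_at)
    then show ?thesis by (simp add: integral_distr)
  qed
  fix f :: "'a \<Rightarrow> real" assume f: "continuous_on UNIV f \<and> bounded (range f)"
  then obtain K where K: "\<And>x. \<bar>f x\<bar> \<le> K" by (auto simp: bounded_iff)
  have fc: "continuous_on UNIV f" using f by simp
  have K0: "K \<ge> 0" using K[of 0] by linarith
  define g :: "real \<Rightarrow> real \<Rightarrow> real" where "g R x = min 1 (max 0 (\<bar>x\<bar> - R))" for R x
  define G :: "real \<Rightarrow> 'a \<Rightarrow> real" where "G R x = (\<Sum>e\<in>Basis. g R (x \<bullet> e))" for R x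
  have g01: "0 \<le> g R x" "g R x \<le> 1" for R x by (auto simp: g_def)
  have gb: "\<bar>g R x\<bar> \<le> 1" for R x by (auto simp: g_def)
  have gc: "continuous_on UNIV (g R)" for R unfolding g_def by (intro continuous_intros)
  have Gc: "continuous_on UNIV (G R)" for R unfolding G_def g_def by (intro continuous_intros)
  have Gn: "0 \<le> G R x" for R x by (auto simp: G_def g01 sum_nonneg)
  have Gb: "\<bar>G R x\<bar> \<le> DIM('a)" for R x
    using sum_mono[of Basis "\<lambda>e. g R (x \<bullet> e)" "\<lambda>_. 1"] g01 Gn[of R x] by (simp add: G_def)
  have gm: "(\<lambda>x. g R (x \<bullet> e)) \<in> borel_measurable borel" for R and e :: 'a
    unfolding g_def by measurable
  have tail: "(\<lambda>k. \<integral>x. G (real k) x \<partial>\<nu>) \<longlonglongrightarrow> (\<integral>x. 0 \<partial>\<nu>)"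
  proof (rule integral_dominated_convergence[where w="\<lambda>_. real DIM('a)"])
    show "AE x in \<nu>. (\<lambda>k. G (real k) x) \<longlonglongrightarrow> 0"
    proof (rule AE_I2)
      fix x :: 'a
      have "(\<lambda>k. g (real k) (x \<bullet> e)) \<longlonglongrightarrow> 0" for e
      proof (rule tendsto_eventually)
        obtain k0 :: nat where "\<bar>x \<bullet> e\<bar> \<le> real k0" using real_arch_simple by blast
        then show "\<forall>\<^sub>F k in sequentially. g (real k) (x \<bullet> e) = 0"
          unfolding eventually_sequentially by (intro exI[of _ k0]) (auto simp: g_def)
      qed
      then have "(\<lambda>k. \<Sum>e\<in>Basis. g (real k) (x \<bullet> e)) \<longlonglongrightarrow> (\<Sum>e\<in>(Basis::'a set). 0)"
        by (intro tendsto_sum)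
      then show "(\<lambda>k. G (real k) x) \<longlonglongrightarrow> 0" by (simp add: G_def)
    qed
  qed (use Gb in \<open>auto simp: G_def intro!: borel_measurable_sum measurable_compose[OF _ gm] 
        simp: measurable_cong_sets[OF \<nu>(2) refl] gm\<close>)
  show "(\<lambda>n. \<integral>\<omega>. f (Y n \<omega>) \<partial>M) \<longlonglongrightarrow> (\<integral>x. f x \<partial>\<nu>)"
  proof (rule LIMSEQ_I)
    fix r :: real assume r: "r > 0"
    define \<epsilon> where "\<epsilon> = r / (4 + 8 * K)"
    have e: "\<epsilon> > 0" "(3 + 6 * K) * \<epsilon> < r" using r K0 by (auto simp: \<epsilon>_def field_simps intro!: add_pos_nonneg)
    from tail e(1) obtain k0 :: nat where "\<bar>\<integral>x. G (real k0) x \<partial>\<nu>\<bar> < \<epsilon>"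
      by (auto dest!: LIMSEQ_D[of _ _ \<epsilon>])
    then obtain R where R: "R \<ge> 0" "(\<integral>x. G R x \<partial>\<nu>) < \<epsilon>" by (meson abs_less_iff of_nat_0_le_iff)
    obtain q where q: "trig_sum q"
      "\<And>x. (\<And>e. e \<in> Basis \<Longrightarrow> \<bar>x \<bullet> e\<bar> \<le> R + 1) \<Longrightarrow> \<bar>f x - q x\<bar> \<le> \<epsilon>"
      "\<And>x. \<bar>f x - q x\<bar> \<le> 2 * K + \<epsilon>"
      using approx_by_trig_sum[of f K "R + 1" \<epsilon>] f K R e by auto
    have fq: "\<bar>f x - q x\<bar> \<le> \<epsilon> + 2 * K * G R x" for x
    proof (cases "\<forall>e\<in>Basis. \<bar>x \<bullet> e\<bar> \<le> R + 1")
      case True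
      then show ?thesis using q(2)[of x] K0 Gn[of R x] by (smt (verit) mult_nonneg_nonneg)
    next
      case False
      then obtain e where e: "e \<in> Basis" "\<bar>x \<bullet> e\<bar> > R + 1" by auto
      have "1 = g R (x \<bullet> e)" using e by (simp add: g_def)
      also have "\<dots> \<le> G R x" unfolding G_def by (rule member_le_sum) (use e g01 in auto)
      finally have "2 * K * 1 \<le> 2 * K * G R x" using K0 by (intro mult_left_mono) auto
      then show ?thesis using q(3)[of x] by simp
    qed
    obtain Kq where Kq: "\<And>x. \<bar>q x\<bar> \<le> Kq" using trig_sum_bounded[OF q(1)] by blast
    note qc = trig_sum_continuous[OF q(1)]
    have d1: "\<bar>(\<integral>\<omega>. f (Y n \<omega>) \<partial>M) - (\<integral>\<omega>. q (Y n \<omega>) \<partial>M)\<bar> \<le> \<epsilon> + 2 * K * (\<integral>\<omega>. G R (Y n \<omega>) \<partial>M)" for n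
    proof -
      have "\<bar>(\<integral>\<omega>. f (Y n \<omega>) \<partial>M) - (\<integral>\<omega>. q (Y n \<omega>) \<partial>M)\<bar> = \<bar>\<integral>\<omega>. f (Y n \<omega>) - q (Y n \<omega>) \<partial>M\<bar>"
        by (simp add: Bochner_Integration.integral_diff[OF bM[OF fc K] bM[OF qc Kq]])
      also have "\<dots> \<le> (\<integral>\<omega>. \<bar>f (Y n \<omega>) - q (Y n \<omega>)\<bar> \<partial>M)" by (rule integral_abs_bound)
      also have "\<dots> \<le> (\<integral>\<omega>. \<epsilon> + 2 * K * G R (Y n \<omega>) \<partial>M)"
        by (intro integral_mono fq integrable_abs Bochner_Integration.integrable_diff
            Bochner_Integration.integrable_add integrable_mult_right bM[OF fc K] bM[OF qc Kq] bM[OF Gc Gb]) simp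
      finally show ?thesis using bM[OF Gc Gb, of R n] by (simp add: M.prob_space)
    qed
    have d2: "\<bar>(\<integral>x. f x \<partial>\<nu>) - (\<integral>x. q x \<partial>\<nu>)\<bar> \<le> \<epsilon> + 2 * K * (\<integral>x. G R x \<partial>\<nu>)"
    proof -
      have "\<bar>(\<integral>x. f x \<partial>\<nu>) - (\<integral>x. q x \<partial>\<nu>)\<bar> = \<bar>\<integral>x. f x - q x \<partial>\<nu>\<bar>"
        by (simp add: Bochner_Integration.integral_diff[OF bN[OF fc K] bN[OF qc Kq]])
      also have "\<dots> \<le> (\<integral>x. \<bar>f x - q x\<bar> \<partial>\<nu>)" by (rule integral_abs_bound)
      also have "\<dots> \<le> (\<integral>x. \<epsilon> + 2 * K * G R x \<partial>\<nu>)"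
        by (intro integral_mono fq integrable_abs Bochner_Integration.integrable_diff
            Bochner_Integration.integrable_add integrable_mult_right bN[OF fc K] bN[OF qc Kq] bN[OF Gc Gb]) simp
      finally show ?thesis using bN[OF Gc Gb, of R] by (simp add: N.prob_space)
    qed
    have "(\<lambda>n. \<integral>\<omega>. G R (Y n \<omega>) \<partial>M) \<longlonglongrightarrow> (\<integral>x. G R x \<partial>\<nu>)"
    proof -
      have "(\<lambda>n. \<Sum>e\<in>Basis. \<integral>\<omega>. g R (Y n \<omega> \<bullet> e) \<partial>M) \<longlonglongrightarrow> (\<Sum>e\<in>Basis. \<integral>x. g R (x \<bullet> e) \<partial>\<nu>)"
        by (intro tendsto_sum marginal[OF gc gb])
      moreover have "(\<integral>\<omega>. G R (Y n \<omega>) \<partial>M) = (\<Sum>e\<in>Basis. \<integral>\<omega>. g R (Y n \<omega> \<bullet> e) \<partial>M)" for n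
        unfolding G_def
        by (intro Bochner_Integration.integral_sum bM[OF _ gb] continuous_on_compose2[OF gc])
           (auto intro!: continuous_intros)
      moreover have "(\<integral>x. G R x \<partial>\<nu>) = (\<Sum>e\<in>Basis. \<integral>x. g R (x \<bullet> e) \<partial>\<nu>)"
        unfolding G_def
        by (intro Bochner_Integration.integral_sum bN[OF _ gb] continuous_on_compose2[OF gc])
           (auto intro!: continuous_intros)
      ultimately show ?thesis by simp
    qed
    from LIMSEQ_D[OF this e(1)] obtain n1 where
      n1: "\<And>n. n \<ge> n1 \<Longrightarrow> \<bar>(\<integral>\<omega>. G R (Y n \<omega>) \<partial>M) - (\<integral>x. G R x \<partial>\<nu>)\<bar> < \<epsilon>" by auto
    from LIMSEQ_D[OF trig[OF q(1)] e(1)] obtain n2 where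
      n2: "\<And>n. n \<ge> n2 \<Longrightarrow> \<bar>(\<integral>\<omega>. q (Y n \<omega>) \<partial>M) - (\<integral>x. q x \<partial>\<nu>)\<bar> < \<epsilon>" by auto
    show "\<exists>no. \<forall>n\<ge>no. norm ((\<integral>\<omega>. f (Y n \<omega>) \<partial>M) - (\<integral>x. f x \<partial>\<nu>)) < r"
    proof (intro exI[of _ "max n1 n2"] allI impI)
      fix n assume n: "max n1 n2 \<le> n"
      have a: "2 * K * (\<integral>x. G R x \<partial>\<nu>) \<le> 2 * K * \<epsilon>" using R K0 by (intro mult_left_mono) auto
      have b: "2 * K * (\<integral>\<omega>. G R (Y n \<omega>) \<partial>M) \<le> 2 * K * (2 * \<epsilon>)"
        using R n1[of n] n K0 by (intro mult_left_mono) auto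
      have "\<bar>(\<integral>\<omega>. f (Y n \<omega>) \<partial>M) - (\<integral>x. f x \<partial>\<nu>)\<bar> \<le> \<epsilon> + 2 * K * (2 * \<epsilon>) + \<epsilon> + (\<epsilon> + 2 * K * \<epsilon>)"
        using d1[of n] d2 n2[of n] n a b by linarith
      then show "norm ((\<integral>\<omega>. f (Y n \<omega>) \<partial>M) - (\<integral>x. f x \<partial>\<nu>)) < r"
        using e(2) by (simp add: algebra_simps)
    qed
  qed
qed

section \<open>The characteristic function of a multivariate normal law\<close>

text \<open>One step of the Cholesky decomposition: subtracting the rank-one matrix \<open>a a\<^sup>T\<close> clears row \<open>k\<close> and leaves
  a Schur complement, which is positive semi-definite because its quadratic form at \<open>w\<close> is the form of \<open>C\<close>
  minimised along the line through \<open>w\<close> in direction \<open>k\<close>.  If \<open>C $ k $ k = 0\<close>, then \<open>a = 0\<close> since division by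
  zero yields zero, and row \<open>k\<close> of \<open>C\<close> vanishes already by semi-definiteness.\<close>
lemma psd_schur_complement:
  fixes C :: "real^'n^'n" and k :: 'n
  assumes "psd_matrix C"
  defines "a \<equiv> \<lambda>i. C $ i $ k / sqrt (C $ k $ k)"
  shows "psd_matrix (\<chi> i j. C $ i $ j - a i * a j)"
    and "C $ k $ j = a k * a j"
proof -
  have T: "transpose C = C" and pos: "\<And>v. 0 \<le> v \<bullet> (C *v v)" using assms by (auto simp: psd_matrix_def)
  have sym: "C $ i $ j = C $ j $ i" for i j
    using arg_cong[OF T, of "\<lambda>D. D $ i $ j"] by (simp add: transpose_def)
  define e where "e = axis k (1::real)"
  have Ce: "w \<bullet> (C *v e) = (C *v w) $ k" for w
    using dot_lmul_matrix[of w C e] transpose_matrix_vector[of C w] T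
    by (simp add: e_def inner_axis)
  have Cek: "(C *v e) $ i = C $ i $ k" for i
    unfolding e_def by (simp add: matrix_vector_mult_basis column_def)
  have quad: "(w + s *\<^sub>R e) \<bullet> (C *v (w + s *\<^sub>R e)) = w \<bullet> (C *v w) + 2 * s * (C *v w) $ k + s\<^sup>2 * C $ k $ k"
    for w s
  proof -
    have "e \<bullet> (C *v w) = (C *v w) $ k" by (simp add: e_def inner_axis')
    then show ?thesis
      by (simp add: matrix_vector_right_distrib matrix_vector_mult_scaleR inner_add_left inner_add_right
          Ce Cek algebra_simps power2_eq_square)
  qed
  have kk: "0 \<le> C $ k $ k" using pos[of e] Ce[of e] Cek[of k] by simp
  have zero: "(C *v w) $ k = 0" if "C $ k $ k = 0" for w
  proof (rule ccontr)
    assume n: "(C *v w) $ k \<noteq> 0"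
    define s where "s = - (w \<bullet> (C *v w) + 1) / (2 * (C *v w) $ k)"
    have "0 \<le> w \<bullet> (C *v w) + 2 * s * (C *v w) $ k"
      using pos[of "w + s *\<^sub>R e"] quad[of w s] that by simp
    also have "2 * s * (C *v w) $ k = - (w \<bullet> (C *v w) + 1)" using n by (simp add: s_def)
    finally show False by simp
  qed
  have row0: "C $ k $ j = 0" if "C $ k $ k = 0" for j
    using zero[OF that, of "axis j 1"] by (simp add: matrix_vector_mult_basis column_def)
  have aa: "a i * a j = C $ k $ i * C $ k $ j / C $ k $ k" for i j
    using kk sym by (simp add: a_def)
  show "C $ k $ j = a k * a j"
    using row0 by (simp add: aa)
  have "0 \<le> w \<bullet> ((\<chi> i j. C $ i $ j - a i * a j) *v w)" for w
  proof -
    have 1: "((\<chi> i j. C $ i $ j - a i * a j) *v w) = C *v w - ((C *v w) $ k / C $ k $ k) *\<^sub>R (\<chi> i. C $ k $ i)"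
      by (simp add: vec_eq_iff matrix_vector_mult_def aa sum_subtractf
          sum_divide_distrib sum_distrib_right sum_distrib_left algebra_simps)
    have 2: "w \<bullet> (C $ k) = (C *v w) $ k"
      by (simp add: inner_vec_def matrix_vector_mult_def mult.commute)
    have 3: "w \<bullet> ((\<chi> i j. C $ i $ j - a i * a j) *v w) = w \<bullet> (C *v w) - ((C *v w) $ k)\<^sup>2 / C $ k $ k"
      unfolding 1 by (simp add: inner_diff_right 2 power2_eq_square)
    show ?thesis
    proof (cases "C $ k $ k = 0")
      case True then show ?thesis unfolding 3 using pos by simp
    next
      case False
      define s where "s = - ((C *v w) $ k / C $ k $ k)"
      have "2 * s * (C *v w) $ k + s\<^sup>2 * C $ k $ k = - (((C *v w) $ k)\<^sup>2 / C $ k $ k)"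
        using False by (simp add: s_def field_simps power2_eq_square)
      then show ?thesis unfolding 3 using pos[of "w + s *\<^sub>R e"] quad[of w s] by simp
    qed
  qed
  moreover have "transpose (\<chi> i j. C $ i $ j - a i * a j) = (\<chi> i j. C $ i $ j - a i * a j)"
    by (simp add: transpose_def vec_eq_iff sym mult.commute)
  ultimately show "psd_matrix (\<chi> i j. C $ i $ j - a i * a j)" by (simp add: psd_matrix_def)
qed

text \<open>Peeling off the indices one after the other; a row that has been cleared stays so, because the vector
  \<open>a\<close> of a later step vanishes at its index.\<close>
lemma psd_matrix_factorization:
  fixes C :: "real^'n^'n"
  assumes "psd_matrix C"
  shows "\<exists>A :: real^'n^'n. A ** transpose A = C"
proof -
  have "\<exists>f. psd_matrix (\<chi> i j. C $ i $ j - (\<Sum>s\<in>S. f s i * f s j)) \<and>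
      (\<forall>l\<in>S. \<forall>j. C $ l $ j = (\<Sum>s\<in>S. f s l * f s j))" if "finite S" for S :: "'n set"
    using that
  proof induction
    case empty
    have "(\<chi> i j. C $ i $ j) = C" by (simp add: vec_eq_iff)
    then show ?case using assms by simp
  next
    case (insert k S)
    then obtain f where f: "psd_matrix (\<chi> i j. C $ i $ j - (\<Sum>s\<in>S. f s i * f s j))" (is "psd_matrix ?D")
      "\<And>l j. l \<in> S \<Longrightarrow> C $ l $ j = (\<Sum>s\<in>S. f s l * f s j)" by blast
    define a where "a = (\<lambda>i. ?D $ i $ k / sqrt (?D $ k $ k))"
    define g where "g = f(k := a)"
    have g: "(\<Sum>s\<in>insert k S. g s i * g s j) = (\<Sum>s\<in>S. f s i * f s j) + a i * a j" for i j
    proof -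
      have "(\<Sum>s\<in>S. g s i * g s j) = (\<Sum>s\<in>S. f s i * f s j)"
        using insert.hyps by (intro sum.cong) (auto simp: g_def)
      then show ?thesis using insert.hyps by (simp add: g_def)
    qed
    note peel = psd_schur_complement[OF f(1), of k, folded a_def]
    have "psd_matrix (\<chi> i j. C $ i $ j - (\<Sum>s\<in>insert k S. g s i * g s j))"
      unfolding g using peel(1) by (simp add: a_def diff_diff_eq)
    moreover have "C $ l $ j = (\<Sum>s\<in>insert k S. g s l * g s j)" if "l \<in> insert k S" for l j
    proof (cases "l = k")
      case True
      then show ?thesis unfolding g using peel(2)[of j] by (simp add: a_def)
    next
      case False
      with that have l: "l \<in> S" by simp
      have "a l = 0" using f(2)[OF l, of k] by (simp add: a_def)
      then show ?thesis unfolding g using f(2)[OF l, of j] by simp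
    qed
    ultimately show ?case by blast
  qed
  from this[OF finite[of "UNIV :: 'n set"]]
  obtain f :: "'n \<Rightarrow> 'n \<Rightarrow> real" where "\<forall>l\<in>UNIV. \<forall>j. C $ l $ j = (\<Sum>s\<in>UNIV. f s l * f s j)"
    by (elim exE conjE) (rule that)
  then have f: "C $ l $ j = (\<Sum>s\<in>UNIV. f s l * f s j)" for l j by simp
  have "(\<chi> i s. f s i) ** transpose (\<chi> i s. f s i) = C"
    by (simp add: vec_eq_iff matrix_matrix_mult_def transpose_def f)
  then show ?thesis by blast
qed

lemma iexp_std_normal:
  "(CLINT x|density lborel std_normal_density. iexp (c * x)) = exp (- c\<^sup>2 / 2)"
  using fun_cong[OF char_std_normal_distribution, of c] by (simp add: char_def)

text \<open>At \<open>v\<close> the characteristic function of \<open>A Z\<close> is that of \<open>Z\<close> at \<open>A\<^sup>T v\<close>, so it depends on \<open>A\<close> only through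
  \<open>A A\<^sup>T = C\<close>.\<close>
lemma
  fixes m :: "real^'n" and C :: "real^'n^'n"
  assumes C: "psd_matrix C"
  shows prob_space_multivariate_normal: "prob_space (multivariate_normal m C)"
    and sets_multivariate_normal: "sets (multivariate_normal m C) = sets borel"
    and char_multivariate_normal:
      "(CLINT x|multivariate_normal m C. iexp (v \<bullet> x)) = iexp (v \<bullet> m) * exp (- (v \<bullet> (C *v v)) / 2)"
proof -
  define A :: "real^'n^'n" where "A = (SOME A. A ** transpose A = C)"
  have A: "A ** transpose A = C"
    unfolding A_def by (rule someI_ex) (rule psd_matrix_factorization[OF C])
  let ?N = "\<lambda>_::'n. density lborel std_normal_density"
  let ?P = "\<Pi>\<^sub>M i\<in>UNIV. ?N i"
  interpret N: prob_space "density lborel std_normal_density"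
    using prob_space_normal_density[of 1 0] by simp
  interpret P: product_prob_space ?N UNIV ..
  have [measurable]: "(\<lambda>z. A *v (\<chi> i. z i)) \<in> borel_measurable ?P"
  proof -
    have *: "A *v (\<chi> i. z i) = (\<Sum>i\<in>UNIV. z i *\<^sub>R column i A)" for z
      by (simp add: matrix_mult_sum scalar_mult_eq_scaleR)
    have [measurable]: "(\<lambda>z. z i) \<in> borel_measurable ?P" for i
      using measurable_component_singleton[of i UNIV ?N] by simp
    show ?thesis unfolding * by measurable
  qed
  have mn: "multivariate_normal m C = distr ?P borel (\<lambda>z. m + A *v (\<chi> i. z i))"
    by (simp add: multivariate_normal_def A_def)
  show "prob_space (multivariate_normal m C)" unfolding mn by (rule P.P.prob_space_distr) measurable
  show "sets (multivariate_normal m C) = sets borel" by (simp add: mn)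
  define w where "w = transpose A *v v"
  have w: "v \<bullet> (A *v z) = w \<bullet> z" for z
    using dot_lmul_matrix[of v A z] by (simp add: w_def transpose_matrix_vector)
  have ww: "v \<bullet> (C *v v) = w \<bullet> w"
    using w[of w] by (simp only: A[symmetric] w_def matrix_vector_mul_assoc)
  have "(CLINT x|multivariate_normal m C. iexp (v \<bullet> x))
      = (CLINT z|?P. iexp (v \<bullet> (m + A *v (\<chi> i. z i))))"
    unfolding mn by (subst integral_distr) auto
  also have "\<dots> = (CLINT z|?P. iexp (v \<bullet> m) * (\<Prod>i\<in>UNIV. iexp (w $ i * z i)))"
  proof -
    have "iexp (v \<bullet> (m + A *v (\<chi> i. z i))) = iexp (v \<bullet> m) * (\<Prod>i\<in>UNIV. iexp (w $ i * z i))" for z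
    proof -
      have "v \<bullet> (m + A *v (\<chi> i. z i)) = v \<bullet> m + (\<Sum>i\<in>UNIV. w $ i * z i)"
        by (simp add: inner_add_right w inner_vec_def[of w])
      then show ?thesis by (simp add: exp_add[symmetric] exp_sum[symmetric] sum_distrib_left distrib_left)
    qed
    then show ?thesis by simp
  qed
  also have "\<dots> = iexp (v \<bullet> m) * (CLINT z|?P. (\<Prod>i\<in>UNIV. iexp (w $ i * z i)))"
    by simp
  also have "(CLINT z|?P. (\<Prod>i\<in>UNIV. iexp (w $ i * z i))) = (\<Prod>i\<in>UNIV. (CLINT x|?N i. iexp (w $ i * x)))"
    by (rule P.product_integral_prod) (auto intro!: N.integrable_const_bound[where B=1])
  also have "\<dots> = (\<Prod>i\<in>UNIV. complex_of_real (exp (- (w $ i)\<^sup>2 / 2)))"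
    by (simp only: iexp_std_normal)
  also have "\<dots> = exp (- (w \<bullet> w) / 2)"
    unfolding inner_vec_def of_real_prod[symmetric]
    by (simp add: exp_sum[symmetric] sum_negf sum_divide_distrib power2_eq_square)
  finally show "(CLINT x|multivariate_normal m C. iexp (v \<bullet> x)) = iexp (v \<bullet> m) * exp (- (v \<bullet> (C *v v)) / 2)"
    by (simp add: ww)
qed

section \<open>Elementary stochastic integrals and their characteristic functions\<close>

lemma iexp_normal_distributed:
  assumes "prob_space M" "distributed M lborel W (normal_density 0 (sqrt d))" "0 < d"
  shows "(CLINT \<omega>|M. iexp (c * W \<omega>)) = exp (- (c\<^sup>2 * d) / 2)"
proof -
  interpret prob_space M by fact
  have s: "sqrt d > 0" using assms by simp
  have [measurable]: "W \<in> borel_measurable M" using distributed_measurable[OF assms(2)] by simp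
  have "distributed M lborel (\<lambda>\<omega>. (W \<omega> - 0) / sqrt d) std_normal_density"
    using normal_standard_normal_convert[of "sqrt d" W 0] s assms(2) by simp
  then have D: "distr M lborel (\<lambda>\<omega>. W \<omega> / sqrt d) = density lborel std_normal_density"
    by (simp add: distributed_def)
  have "(CLINT \<omega>|M. iexp (c * W \<omega>)) = (CLINT \<omega>|M. iexp (c * sqrt d * (W \<omega> / sqrt d)))"
    using s by simp
  also have "\<dots> = (CLINT x|distr M lborel (\<lambda>\<omega>. W \<omega> / sqrt d). iexp (c * sqrt d * x))"
    by (subst integral_distr) auto
  also have "\<dots> = exp (- (c * sqrt d)\<^sup>2 / 2)"
    unfolding D using fun_cong[OF char_std_normal_distribution, of "c * sqrt d"] by (simp add: char_def)
  finally show ?thesis using assms by (simp add: power_mult_distrib)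
qed

locale brownian = prob_space M for M :: "'a measure" +
  fixes F :: "real \<Rightarrow> 'a measure" and B :: "real \<Rightarrow> 'a \<Rightarrow> real"
  assumes filt: "filtration (space M) F" and sub: "\<And>t. subalgebra M (F t)"
    and bm: "brownian_motion M F B"
begin

lemma measurable_later: "f \<in> measurable (F s) N \<Longrightarrow> s \<le> t \<Longrightarrow> f \<in> measurable (F t) N"
  using filtration.sets_F_mono[OF filt, of s t] filtration.space_F[OF filt]
  by (auto simp: measurable_def)

lemma measurable_ambient: "f \<in> measurable (F s) N \<Longrightarrow> f \<in> measurable M N"
  by (rule measurable_from_subalg[OF sub])

lemma B_measurable: "0 \<le> s \<Longrightarrow> s \<le> t \<Longrightarrow> B s \<in> borel_measurable (F t)"
  using bm measurable_later unfolding brownian_motion_def by blast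

text \<open>The conditional characteristic function of an increment: \<open>Z\<close> and \<open>c\<close> are known at time \<open>s\<close> and the
  increment is independent of that information, so they can be frozen while integrating over the increment.\<close>
lemma integral_iexp_increment:
  fixes Z :: "'a \<Rightarrow> complex"
  assumes s: "0 \<le> s" "s \<le> t" and Z: "Z \<in> borel_measurable (F s)" "\<And>\<omega>. norm (Z \<omega>) \<le> K"
    and c: "c \<in> borel_measurable (F s)"
  shows "(CLINT \<omega>|M. Z \<omega> * iexp (c \<omega> * (B t \<omega> - B s \<omega>))) = (CLINT \<omega>|M. Z \<omega> * exp (- ((c \<omega>)\<^sup>2 * (t - s)) / 2))"
proof (cases "s = t")
  case True then show ?thesis by simp
next
  case False
  with s have st: "s < t" by simp
  define W where "W \<omega> = B t \<omega> - B s \<omega>" for \<omega>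
  have W: "distributed M lborel W (normal_density 0 (sqrt (t - s)))"
    and ind: "indep_set (sets (F s)) (sets (vimage_algebra (space M) W borel))"
    using bm s st unfolding brownian_motion_def W_def by auto
  have [measurable]: "W \<in> borel_measurable M" using distributed_measurable[OF W] by simp
  have [measurable]: "Z \<in> borel_measurable M" "c \<in> borel_measurable M"
    using Z c measurable_ambient by auto
  define V where "V \<omega> = (Z \<omega>, c \<omega>)" for \<omega>
  have V[measurable]: "V \<in> borel_measurable M" unfolding V_def by measurable
  have VF: "V \<in> borel_measurable (F s)" unfolding V_def using Z c by measurable
  \<comment> \<open>\<open>indep_var\<close> compares variables of one type, so the increment is padded to the type of \<open>V\<close>.\<close>
  define U where "U \<omega> = (0 :: complex, W \<omega>)" for \<omega>
  have U[measurable]: "U \<in> borel_measurable M" unfolding U_def by measurable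
  have iv: "indep_var borel V borel U"
    unfolding indep_var_eq
  proof (intro conjI V U indep_setI)
    interpret sub: sigma_algebra "space M" "sets (F s)"
      using sets.sigma_algebra_axioms[of "F s"] filtration.space_F[OF filt] by metis
    have 1: "sigma_sets (space M) {V -` A \<inter> space M |A. A \<in> sets borel} \<subseteq> sets (F s)"
      using measurable_sets[OF VF] filtration.space_F[OF filt]
      by (intro sub.sigma_sets_subset) auto
    interpret va: sigma_algebra "space M" "sets (vimage_algebra (space M) W borel)"
      using sets.sigma_algebra_axioms[of "vimage_algebra (space M) W borel"] by simp
    have "U \<in> borel_measurable (vimage_algebra (space M) W borel)"
      unfolding U_def by (intro borel_measurable_Pair borel_measurable_const measurable_vimage_algebra1) simp
    from measurable_sets[OF this]
    have 2: "sigma_sets (space M) {U -` A \<inter> space M |A. A \<in> sets borel} \<subseteq> sets (vimage_algebra (space M) W borel)"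
      by (intro va.sigma_sets_subset) auto
    note sb = indep_setD_ev1[OF ind] indep_setD_ev2[OF ind]
    show "sigma_sets (space M) {V -` A \<inter> space M |A. A \<in> sets borel} \<subseteq> events" using 1 sb by blast
    show "sigma_sets (space M) {U -` A \<inter> space M |A. A \<in> sets borel} \<subseteq> events" using 2 sb by blast
    fix a b assume "a \<in> sigma_sets (space M) {V -` A \<inter> space M |A. A \<in> sets borel}"
      "b \<in> sigma_sets (space M) {U -` A \<inter> space M |A. A \<in> sets borel}"
    with 1 2 show "prob (a \<inter> b) = prob a * prob b" by (intro indep_setD[OF ind]) auto
  qed
  then have D: "distr M (borel \<Otimes>\<^sub>M borel) (\<lambda>\<omega>. (V \<omega>, U \<omega>)) = distr M borel V \<Otimes>\<^sub>M distr M borel U"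
    unfolding indep_var_distribution_eq by simp
  interpret V: prob_space "distr M borel V" by (rule prob_space_distr) simp
  interpret U: prob_space "distr M borel U" by (rule prob_space_distr) simp
  interpret VU: pair_prob_space "distr M borel V" "distr M borel U" ..
  \<comment> \<open>Cutting \<open>z\<close> off at norm \<open>K\<close> makes the integrand bounded everywhere, and does not affect the values of \<open>Z\<close>.\<close>
  define h :: "(complex \<times> real) \<times> (complex \<times> real) \<Rightarrow> complex"
    where "h x = (if norm (fst (fst x)) \<le> K then fst (fst x) else 0) * iexp (snd (fst x) * snd (snd x))" for x
  have h[measurable]: "h \<in> borel_measurable ((borel \<Otimes>\<^sub>M borel) \<Otimes>\<^sub>M (borel \<Otimes>\<^sub>M borel))" unfolding h_def by measurable
  have h'[measurable]: "h \<in> borel_measurable (borel \<Otimes>\<^sub>M borel)" using h by (simp add: borel_prod)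
  have hb: "norm (h x) \<le> \<bar>K\<bar>" for x by (auto simp: h_def norm_mult split: prod.split)
  have "(CLINT \<omega>|M. Z \<omega> * iexp (c \<omega> * W \<omega>)) = (CLINT \<omega>|M. h (V \<omega>, U \<omega>))"
    using Z by (simp add: h_def V_def U_def)
  also have "\<dots> = (CLINT x|distr M (borel \<Otimes>\<^sub>M borel) (\<lambda>\<omega>. (V \<omega>, U \<omega>)). h x)"
    by (subst integral_distr) auto
  also have "\<dots> = (CLINT v|distr M borel V. (CLINT w|distr M borel U. h (v, w)))"
    unfolding D
  proof (rule VU.integral_fst'[symmetric])
    show "complex_integrable (distr M borel V \<Otimes>\<^sub>M distr M borel U) h"
      using hb by (intro VU.integrable_const_bound[where B="\<bar>K\<bar>"]) auto
  qed
  also have "\<dots> = (CLINT v|distr M borel V. (if norm (fst v) \<le> K then fst v else 0) * exp (- ((snd v)\<^sup>2 * (t - s)) / 2))"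
  proof (rule Bochner_Integration.integral_cong[OF refl])
    fix v
    have [measurable]: "(\<lambda>w. h (v, w)) \<in> borel_measurable borel" by (rule measurable_compose[OF _ h']) measurable
    have "(CLINT w|distr M borel U. h (v, w)) = (CLINT \<omega>|M. (if norm (fst v) \<le> K then fst v else 0) * iexp (snd v * W \<omega>))"
      by (subst integral_distr) (simp_all, simp add: h_def U_def)
    also have "\<dots> = (if norm (fst v) \<le> K then fst v else 0) * (CLINT \<omega>|M. iexp (snd v * W \<omega>))"
      by simp
    also have "(CLINT \<omega>|M. iexp (snd v * W \<omega>)) = exp (- ((snd v)\<^sup>2 * (t - s)) / 2)"
      using iexp_normal_distributed[OF prob_space_axioms W] st by simp
    finally show "(CLINT w|distr M borel U. h (v, w)) = (if norm (fst v) \<le> K then fst v else 0) * exp (- ((snd v)\<^sup>2 * (t - s)) / 2)" .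
  qed
  also have "\<dots> = (CLINT \<omega>|M. Z \<omega> * exp (- ((c \<omega>)\<^sup>2 * (t - s)) / 2))"
  proof (subst integral_distr)
    have "(\<lambda>v. (if norm (fst v) \<le> K then fst v else 0) * complex_of_real (exp (- ((snd v)\<^sup>2 * (t - s)) / 2)))
        \<in> borel_measurable (borel \<Otimes>\<^sub>M borel)" by measurable
    then show "(\<lambda>v. (if norm (fst v) \<le> K then fst v else 0) * complex_of_real (exp (- ((snd v)\<^sup>2 * (t - s)) / 2)))
        \<in> borel_measurable borel" by (simp add: borel_prod)
  qed (use Z in \<open>simp_all add: V_def\<close>)
  finally show ?thesis by (simp add: W_def)
qed

text \<open>Pairs of an adapted step process and its stochastic integral.  Closing single steps under sums, instead of
  fixing a partition, lets processes with different partitions be added; a common partition is constructed only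
  where independence of successive increments is needed.\<close>
inductive elementary :: "(real \<Rightarrow> 'a \<Rightarrow> real) \<Rightarrow> ('a \<Rightarrow> real) \<Rightarrow> bool" where
  zero: "elementary (\<lambda>_ _. 0) (\<lambda>_. 0)"
| piece: "0 \<le> a \<Longrightarrow> a \<le> b \<Longrightarrow> c \<in> borel_measurable (F a) \<Longrightarrow>
    elementary (\<lambda>r \<omega>. indicator {a<..b} r * c \<omega>) (\<lambda>\<omega>. c \<omega> * (B b \<omega> - B a \<omega>))"
| add: "elementary \<psi> I \<Longrightarrow> elementary \<psi>' I' \<Longrightarrow>
    elementary (\<lambda>r \<omega>. \<psi> r \<omega> + \<psi>' r \<omega>) (\<lambda>\<omega>. I \<omega> + I' \<omega>)"

lemma elementary_scale: "elementary \<psi> I \<Longrightarrow> elementary (\<lambda>r \<omega>. \<alpha> * \<psi> r \<omega>) (\<lambda>\<omega>. \<alpha> * I \<omega>)"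
proof (induction rule: elementary.induct)
  case zero then show ?case using elementary.zero by simp
next
  case (piece a b c)
  then have "(\<lambda>\<omega>. \<alpha> * c \<omega>) \<in> borel_measurable (F a)" by measurable
  from elementary.piece[OF piece(1,2) this] show ?case by (simp add: mult_ac)
next
  case (add \<psi> I \<psi>' I')
  from elementary.add[OF add.IH] show ?case by (simp add: distrib_left)
qed

lemma elementary_sum:
  "finite S \<Longrightarrow> (\<And>i. i \<in> S \<Longrightarrow> elementary (\<psi> i) (I i)) \<Longrightarrow>
    elementary (\<lambda>r \<omega>. \<Sum>i\<in>S. \<psi> i r \<omega>) (\<lambda>\<omega>. \<Sum>i\<in>S. I i \<omega>)"
  by (induction S rule: finite_induct) (auto intro: elementary.zero elementary.add)

end

definition grid :: "(nat \<Rightarrow> real) \<Rightarrow> nat \<Rightarrow> bool" where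
  "grid p L \<longleftrightarrow> (\<forall>k\<le>L. 0 \<le> p k) \<and> (\<forall>j\<le>L. \<forall>i<j. p i < p j)"

lemma grid_less_iff: "grid p L \<Longrightarrow> i \<le> L \<Longrightarrow> j \<le> L \<Longrightarrow> p i < p j \<longleftrightarrow> i < j"
  unfolding grid_def by (metis less_asym less_irrefl linorder_neqE_nat)

lemma grid_le_iff: "grid p L \<Longrightarrow> i \<le> L \<Longrightarrow> j \<le> L \<Longrightarrow> p i \<le> p j \<longleftrightarrow> i \<le> j"
  using grid_less_iff[of p L j i] by (auto simp: not_less[symmetric])

lemma grid_exists:
  assumes "finite P" "P \<subseteq> {0..}"
  obtains p L where "grid p L" "P \<subseteq> p ` {..L}"
proof
  define xs where "xs = sorted_list_of_set (insert 0 P)"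
  have xs: "set xs = insert 0 P" "sorted_wrt (<) xs"
    using assms by (auto simp: xs_def sorted_list_of_set.strict_sorted_key_list_of_set
        simp del: sorted_list_of_set_insert_remove)
  then have xs: "set xs = insert 0 P" "sorted_wrt (<) xs" "length xs > 0"
    by (auto simp: length_greater_0_conv[symmetric] simp del: length_greater_0_conv)
  show "grid (\<lambda>k. xs ! k) (length xs - 1)"
    unfolding grid_def
  proof (intro conjI allI impI)
    fix k assume "k \<le> length xs - 1"
    then have "k < length xs" using xs(3) by linarith
    then have "xs ! k \<in> set xs" by (rule nth_mem)
    then show "0 \<le> xs ! k" using xs(1) assms by auto
  next
    fix i j assume "j \<le> length xs - 1" "i < j"
    then show "xs ! i < xs ! j" using sorted_wrt_nth_less[OF xs(2), of i j] xs(3) by linarith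
  qed
  show "P \<subseteq> (\<lambda>k. xs ! k) ` {..length xs - 1}"
  proof
    fix x assume "x \<in> P"
    then have "x \<in> set xs" using xs by auto
    then show "x \<in> (\<lambda>k. xs ! k) ` {..length xs - 1}"
      using xs(3) by (auto simp: in_set_conv_nth)
  qed
qed

text \<open>With \<open>G\<close> a Brownian path this splits an increment over the cells of the grid; with \<open>G\<close> the indicator function
  of a half-line it splits the indicator function of an interval.\<close>
lemma grid_telescope:
  fixes G :: "real \<Rightarrow> real"
  assumes g: "grid p L" and ij: "i \<le> j" "j \<le> L"
  shows "G (p j) - G (p i) = (\<Sum>k<L. indicator {p i<..p j} (p (Suc k)) * (G (p (Suc k)) - G (p k)))"
proof -
  have "(\<Sum>k<L. indicator {p i<..p j} (p (Suc k)) * (G (p (Suc k)) - G (p k)))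
      = (\<Sum>k\<in>{i..<j}. G (p (Suc k)) - G (p k))"
    using ij grid_less_iff[OF g] grid_le_iff[OF g]
    by (intro sum.mono_neutral_cong_right) (auto simp: indicator_def)
  also have "\<dots> = G (p j) - G (p i)"
    using ij by (intro sum_Suc_diff') auto
  finally show ?thesis by simp
qed

context brownian begin

text \<open>The cells of the grid are left-open, so the value on a cell is read off at its right end point; being
  adapted means that it is known at the left one.\<close>
definition steps_on :: "(nat \<Rightarrow> real) \<Rightarrow> nat \<Rightarrow> (real \<Rightarrow> 'a \<Rightarrow> real) \<Rightarrow> ('a \<Rightarrow> real) \<Rightarrow> bool" where
  "steps_on p L \<psi> I \<longleftrightarrow> (\<forall>k<L. \<psi> (p (Suc k)) \<in> borel_measurable (F (p k))) \<and>
     (\<forall>r \<omega>. \<psi> r \<omega> = (\<Sum>k<L. indicator {p k<..p (Suc k)} r * \<psi> (p (Suc k)) \<omega>)) \<and>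
     (\<forall>\<omega>. I \<omega> = (\<Sum>k<L. \<psi> (p (Suc k)) \<omega> * (B (p (Suc k)) \<omega> - B (p k) \<omega>)))"

text \<open>All grids through a suitable finite set are allowed, so that the finitely many steps of a sum can be
  accommodated by one grid.\<close>
lemma elementary_steps_on_fine_grid:
  assumes "elementary \<psi> I"
  shows "\<exists>P. finite P \<and> P \<subseteq> {0..} \<and> (\<forall>p L. grid p L \<longrightarrow> P \<subseteq> p ` {..L} \<longrightarrow> steps_on p L \<psi> I)"
  using assms
proof (induction rule: elementary.induct)
  case zero
  show ?case by (rule exI[of _ "{}"]) (simp add: steps_on_def)
next
  case (piece a b c)
  show ?case
  proof (intro exI[of _ "{a, b}"] conjI allI impI)
    show "{a, b} \<subseteq> {0..}" using piece by auto
    fix p L assume g: "grid p L" and "{a, b} \<subseteq> p ` {..L}"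
    then obtain i j where iL: "i \<le> L" "j \<le> L" and ij: "a = p i" "b = p j" by auto
    with iL grid_le_iff[OF g] piece(2) have "i \<le> j" by auto
    note tel = grid_telescope[OF g this \<open>j \<le> L\<close>, folded ij]
    show "steps_on p L (\<lambda>r \<omega>. indicator {a<..b} r * c \<omega>) (\<lambda>\<omega>. c \<omega> * (B b \<omega> - B a \<omega>))"
      unfolding steps_on_def
    proof (intro conjI allI impI)
      show "(\<lambda>\<omega>. indicator {a<..b} (p (Suc k)) * c \<omega>) \<in> borel_measurable (F (p k))" if k: "k < L" for k
      proof (cases "a < p (Suc k)")
        case True
        then have "a \<le> p k" using k iL ij grid_less_iff[OF g] grid_le_iff[OF g] by auto
        from measurable_later[OF piece(3) this] show ?thesis by measurable
      qed simp
      show "indicator {a<..b} r * c \<omega> =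
          (\<Sum>k<L. indicator {p k<..p (Suc k)} r * (indicator {a<..b} (p (Suc k)) * c \<omega>))" for r \<omega>
      proof -
        have ind: "indicator {u<..v} r = indicator {r..} v - (indicator {r..} u :: real)" if "u \<le> v" for u v
          using that by (auto simp: indicator_def)
        have "indicator {p k<..p (Suc k)} r = indicator {r..} (p (Suc k)) - (indicator {r..} (p k) :: real)"
          if "k < L" for k using that grid_le_iff[OF g, of k "Suc k"] by (intro ind) auto
        then have *: "indicator {a<..b} r = (\<Sum>k<L. indicator {a<..b} (p (Suc k)) * (indicator {p k<..p (Suc k)} r :: real))"
          using tel[of "indicator {r..}"] ind[OF piece(2)] by simp
        show ?thesis by (subst *) (simp only: sum_distrib_left sum_distrib_right mult_ac)
      qed
      show "c \<omega> * (B b \<omega> - B a \<omega>) =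
          (\<Sum>k<L. indicator {a<..b} (p (Suc k)) * c \<omega> * (B (p (Suc k)) \<omega> - B (p k) \<omega>))" for \<omega>
        by (subst tel[of "\<lambda>s. B s \<omega>"]) (simp only: sum_distrib_left sum_distrib_right mult_ac)
    qed
  qed auto
next
  case (add \<psi> I \<psi>' I')
  from add.IH(1) obtain P where P: "finite P" "P \<subseteq> {0..}"
    and R: "\<And>p L. grid p L \<Longrightarrow> P \<subseteq> p ` {..L} \<Longrightarrow> steps_on p L \<psi> I" by blast
  from add.IH(2) obtain P' where P': "finite P'" "P' \<subseteq> {0..}"
    and R': "\<And>p L. grid p L \<Longrightarrow> P' \<subseteq> p ` {..L} \<Longrightarrow> steps_on p L \<psi>' I'" by blast
  show ?case
  proof (intro exI[of _ "P \<union> P'"] conjI allI impI)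
    fix p L assume g: "grid p L" and "P \<union> P' \<subseteq> p ` {..L}"
    then have r: "steps_on p L \<psi> I" and r': "steps_on p L \<psi>' I'" using R[OF g] R'[OF g] by auto
    show "steps_on p L (\<lambda>r \<omega>. \<psi> r \<omega> + \<psi>' r \<omega>) (\<lambda>\<omega>. I \<omega> + I' \<omega>)"
      unfolding steps_on_def
    proof (intro conjI allI impI)
      show "(\<lambda>\<omega>. \<psi> (p (Suc k)) \<omega> + \<psi>' (p (Suc k)) \<omega>) \<in> borel_measurable (F (p k))" if k: "k < L" for k
        using r r' k unfolding steps_on_def by (intro borel_measurable_add) blast+
      fix \<omega>
      show "\<psi> r \<omega> + \<psi>' r \<omega> = (\<Sum>k<L. indicator {p k<..p (Suc k)} r * (\<psi> (p (Suc k)) \<omega> + \<psi>' (p (Suc k)) \<omega>))" for r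
      proof -
        have "\<psi> r \<omega> = (\<Sum>k<L. indicator {p k<..p (Suc k)} r * \<psi> (p (Suc k)) \<omega>)"
          using r unfolding steps_on_def by blast
        moreover have "\<psi>' r \<omega> = (\<Sum>k<L. indicator {p k<..p (Suc k)} r * \<psi>' (p (Suc k)) \<omega>)"
          using r' unfolding steps_on_def by blast
        ultimately show ?thesis by (simp only: distrib_left sum.distrib)
      qed
      have "I \<omega> = (\<Sum>k<L. \<psi> (p (Suc k)) \<omega> * (B (p (Suc k)) \<omega> - B (p k) \<omega>))"
        using r unfolding steps_on_def by blast
      moreover have "I' \<omega> = (\<Sum>k<L. \<psi>' (p (Suc k)) \<omega> * (B (p (Suc k)) \<omega> - B (p k) \<omega>))"
        using r' unfolding steps_on_def by blast
      ultimately show "I \<omega> + I' \<omega> = (\<Sum>k<L. (\<psi> (p (Suc k)) \<omega> + \<psi>' (p (Suc k)) \<omega>) * (B (p (Suc k)) \<omega> - B (p k) \<omega>))"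
        by (simp only: distrib_right sum.distrib)
    qed
  qed (use P P' in auto)
qed

text \<open>Each step multiplies the exponential by a factor whose conditional expectation is one, by
  \<open>integral_iexp_increment\<close>.  The uniform bound on the quadratic variation provides integrability.\<close>
lemma discrete_exponential_martingale:
  assumes g: "grid p L" and c: "\<And>k. k < L \<Longrightarrow> c k \<in> borel_measurable (F (p k))"
    and K: "\<And>\<omega>. (\<Sum>k<L. (c k \<omega>)\<^sup>2 * (p (Suc k) - p k)) \<le> K"
  shows "(CLINT \<omega>|M. iexp (\<Sum>k<L. c k \<omega> * (B (p (Suc k)) \<omega> - B (p k) \<omega>)) *
      exp ((\<Sum>k<L. (c k \<omega>)\<^sup>2 * (p (Suc k) - p k)) / 2)) = 1"
proof -
  define d where "d k = p (Suc k) - p k" for k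
  have d: "0 \<le> d k" if "k < L" for k using grid_le_iff[OF g, of k "Suc k"] that by (simp add: d_def)
  define I where "I m \<omega> = (\<Sum>k<m. c k \<omega> * (B (p (Suc k)) \<omega> - B (p k) \<omega>))" for m \<omega>
  define Q where "Q m \<omega> = (\<Sum>k<m. (c k \<omega>)\<^sup>2 * d k)" for m \<omega>
  have QK: "Q m \<omega> \<le> K" if "m \<le> L" for m \<omega>
  proof -
    have "Q m \<omega> \<le> Q L \<omega>" unfolding Q_def using that d by (intro sum_mono2) auto
    then show ?thesis using K[of \<omega>] by (simp add: Q_def d_def)
  qed
  have cm: "c k \<in> borel_measurable (F (p m))" if "k \<le> m" "k < L" "m \<le> L" for k m
    using grid_le_iff[OF g, of k m] that by (intro measurable_later[OF c]) auto
  have "(CLINT \<omega>|M. iexp (I m \<omega>) * exp (Q m \<omega> / 2)) = 1" if "m \<le> L" for m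
    using that
  proof (induction m)
    case 0
    show ?case by (simp add: I_def Q_def prob_space)
  next
    case (Suc m)
    have Im: "I m \<in> borel_measurable (F (p m))"
      unfolding I_def
    proof (intro borel_measurable_sum borel_measurable_times borel_measurable_diff)
      fix k assume "k \<in> {..<m}"
      then have k: "k < m" by simp
      show "c k \<in> borel_measurable (F (p m))" using k Suc.prems by (intro cm) auto
      show "B (p (Suc k)) \<in> borel_measurable (F (p m))" "B (p k) \<in> borel_measurable (F (p m))"
        using k Suc.prems grid_le_iff[OF g] g by (auto intro!: B_measurable simp: grid_def)
    qed
    have Qm: "Q (Suc m) \<in> borel_measurable (F (p m))"
      unfolding Q_def
      by (intro borel_measurable_sum borel_measurable_times borel_measurable_power cm) (use Suc.prems in auto)
    have "(CLINT \<omega>|M. iexp (I (Suc m) \<omega>) * exp (Q (Suc m) \<omega> / 2))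
        = (CLINT \<omega>|M. (iexp (I m \<omega>) * exp (Q (Suc m) \<omega> / 2)) * iexp (c m \<omega> * (B (p (Suc m)) \<omega> - B (p m) \<omega>)))"
      by (simp add: I_def distrib_left exp_add mult_ac)
    also have "\<dots> = (CLINT \<omega>|M. (iexp (I m \<omega>) * exp (Q (Suc m) \<omega> / 2)) * exp (- ((c m \<omega>)\<^sup>2 * (p (Suc m) - p m)) / 2))"
    proof (rule integral_iexp_increment)
      show "0 \<le> p m" "p m \<le> p (Suc m)"
        using g Suc.prems d[of m] by (auto simp: grid_def d_def)
      show "c m \<in> borel_measurable (F (p m))" using Suc.prems by (intro cm) auto
      show "norm (iexp (I m \<omega>) * complex_of_real (exp (Q (Suc m) \<omega> / 2))) \<le> exp (K / 2)" for \<omega>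
        using QK[OF Suc.prems, of \<omega>] by (simp add: norm_mult)
      show "(\<lambda>\<omega>. iexp (I m \<omega>) * complex_of_real (exp (Q (Suc m) \<omega> / 2))) \<in> borel_measurable (F (p m))"
        using Im Qm by measurable
    qed
    also have "\<dots> = (CLINT \<omega>|M. iexp (I m \<omega>) * exp (Q m \<omega> / 2))"
    proof (rule Bochner_Integration.integral_cong[OF refl])
      fix \<omega>
      have "exp (Q (Suc m) \<omega> / 2) * exp (- ((c m \<omega>)\<^sup>2 * (p (Suc m) - p m)) / 2) = exp (Q m \<omega> / 2)"
        by (simp add: exp_add[symmetric] Q_def d_def add_divide_distrib diff_divide_distrib)
      then show "iexp (I m \<omega>) * complex_of_real (exp (Q (Suc m) \<omega> / 2)) * complex_of_real (exp (- ((c m \<omega>)\<^sup>2 * (p (Suc m) - p m)) / 2))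
          = iexp (I m \<omega>) * complex_of_real (exp (Q m \<omega> / 2))"
        by (metis mult.assoc of_real_mult)
    qed
    also have "\<dots> = 1" using Suc by simp
    finally show ?case .
  qed
  from this[of L] show ?thesis by (simp add: I_def Q_def d_def)
qed

text \<open>If the quadratic variation \<open>Q\<close> is close to a constant \<open>q\<close>, then \<open>exp (\<i> I)\<close> is close to
  \<open>exp (- q / 2) * exp (\<i> I + Q / 2)\<close>, the expectation of which is \<open>exp (- q / 2)\<close>.  Since \<open>Q\<close> need not be
  bounded, the steps are switched off before the quadratic variation can exceed \<open>q + 1\<close>; this changes nothing
  where \<open>\<bar>Q - q\<bar> < 1\<close>.\<close>
lemma elementary_char_estimate:
  fixes q \<epsilon> :: real
  assumes el: "elementary \<psi> I"
  defines "Q \<equiv> \<lambda>\<omega>. \<integral>r. (\<psi> r \<omega>)\<^sup>2 \<partial>lborel"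
  shows "I \<in> borel_measurable M" and "Q \<in> borel_measurable M"
    and "integrable lborel (\<lambda>r. (\<psi> r \<omega>)\<^sup>2)" and "(\<lambda>r. \<psi> r \<omega>) \<in> borel_measurable borel"
    and "0 \<le> q \<Longrightarrow> 0 < \<epsilon> \<Longrightarrow> \<epsilon> < 1 \<Longrightarrow>
      norm ((CLINT \<omega>|M. iexp (I \<omega>)) - exp (- q / 2)) \<le> 3 * prob {\<omega> \<in> space M. \<epsilon> \<le> \<bar>Q \<omega> - q\<bar>} + \<epsilon>"
proof -
  from elementary_steps_on_fine_grid[OF el] obtain P where P: "finite P" "P \<subseteq> {0..}"
    and R: "\<And>p L. grid p L \<Longrightarrow> P \<subseteq> p ` {..L} \<Longrightarrow> steps_on p L \<psi> I" by blast
  obtain p L where g: "grid p L" and pL: "P \<subseteq> p ` {..L}" using grid_exists[OF P] by blast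
  define c where "c k = \<psi> (p (Suc k))" for k
  define d where "d k = p (Suc k) - p k" for k
  define J where "J k = {p k<..p (Suc k)}" for k
  from R[OF g pL] have c: "\<And>k. k < L \<Longrightarrow> c k \<in> borel_measurable (F (p k))"
    and \<psi>: "\<And>r \<omega>. \<psi> r \<omega> = (\<Sum>k<L. indicator (J k) r * c k \<omega>)"
    and I: "\<And>\<omega>. I \<omega> = (\<Sum>k<L. c k \<omega> * (B (p (Suc k)) \<omega> - B (p k) \<omega>))"
    unfolding steps_on_def c_def J_def by blast+
  have d: "0 \<le> d k" if "k < L" for k using grid_le_iff[OF g, of k "Suc k"] that by (simp add: d_def)
  have cM: "c k \<in> borel_measurable M" if "k < L" for k using c[OF that] by (rule measurable_ambient)
  have BM: "B (p k) \<in> borel_measurable M" if "k \<le> L" for k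
    using g that by (intro measurable_ambient[OF B_measurable[of "p k" "p k"]]) (auto simp: grid_def)
  show IM: "I \<in> borel_measurable M"
    unfolding I by (intro borel_measurable_sum borel_measurable_times borel_measurable_diff cM BM) auto
  have disj: "indicator (J j) r * (indicator (J k) r :: real) = (if j = k then indicator (J k) r else 0)"
    if "j < L" "k < L" for j k r
  proof (cases j k rule: linorder_cases)
    case less
    then have "p (Suc j) \<le> p k" using that grid_le_iff[OF g] by auto
    then show ?thesis using less by (auto simp: J_def indicator_def)
  next
    case greater
    then have "p (Suc k) \<le> p j" using that grid_le_iff[OF g] by auto
    then show ?thesis using greater by (auto simp: J_def indicator_def)
  qed (auto simp: indicator_def)
  have sq: "(\<psi> r \<omega>)\<^sup>2 = (\<Sum>k<L. indicator (J k) r * (c k \<omega>)\<^sup>2)" for r \<omega>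
  proof -
    have "(\<psi> r \<omega>)\<^sup>2 = (\<Sum>j<L. \<Sum>k<L. (indicator (J j) r * indicator (J k) r) * (c j \<omega> * c k \<omega>))"
      unfolding \<psi> power2_eq_square sum_product by (simp only: mult_ac)
    also have "\<dots> = (\<Sum>j<L. \<Sum>k<L. if j = k then indicator (J k) r * (c k \<omega>)\<^sup>2 else 0)"
      by (intro sum.cong refl) (auto simp: disj power2_eq_square)
    also have "\<dots> = (\<Sum>k<L. indicator (J k) r * (c k \<omega>)\<^sup>2)"
      by (intro sum.cong refl) (simp add: sum.delta)
    finally show ?thesis .
  qed
  have Jint: "integrable lborel (\<lambda>r. indicator (J k) r * x)" "(\<integral>r. indicator (J k) r * x \<partial>lborel) = d k * x"
    if "k < L" for k and x :: real
    using d[OF that] by (auto simp: J_def d_def intro!: integrable_real_mult_indicator)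
  show "integrable lborel (\<lambda>r. (\<psi> r \<omega>)\<^sup>2)"
    unfolding sq using Jint by (intro Bochner_Integration.integrable_sum) auto
  show "(\<lambda>r. \<psi> r \<omega>) \<in> borel_measurable borel"
    unfolding \<psi> J_def by measurable
  have Q: "Q \<omega> = (\<Sum>k<L. (c k \<omega>)\<^sup>2 * d k)" for \<omega>
  proof -
    have "Q \<omega> = (\<Sum>k<L. \<integral>r. indicator (J k) r * (c k \<omega>)\<^sup>2 \<partial>lborel)"
      unfolding Q_def sq by (rule Bochner_Integration.integral_sum) (rule Jint(1), simp)
    also have "\<dots> = (\<Sum>k<L. (c k \<omega>)\<^sup>2 * d k)"
      by (intro sum.cong refl) (simp only: Jint(2) lessThan_iff mult.commute)
    finally show ?thesis .
  qed
  show QM[measurable]: "Q \<in> borel_measurable M"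
    unfolding Q by (intro borel_measurable_sum borel_measurable_times borel_measurable_power cM) auto
  assume q: "0 \<le> q" and \<epsilon>: "0 < \<epsilon>" "\<epsilon> < 1"
  \<comment> \<open>The switch of step \<open>k\<close> looks at the variation up to the end of that step.  This is known at time \<open>p k\<close>,
    so that the stopped process is still adapted.\<close>
  define c' where "c' k \<omega> = (if (\<Sum>j<Suc k. (c j \<omega>)\<^sup>2 * d j) \<le> q + 1 then c k \<omega> else 0)" for k \<omega>
  define I' where "I' \<omega> = (\<Sum>k<L. c' k \<omega> * (B (p (Suc k)) \<omega> - B (p k) \<omega>))" for \<omega>
  define Q' where "Q' \<omega> = (\<Sum>k<L. (c' k \<omega>)\<^sup>2 * d k)" for \<omega>
  have c': "c' k \<in> borel_measurable (F (p k))" if k: "k < L" for k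
  proof -
    have [measurable]: "c j \<in> borel_measurable (F (p k))" if "j < Suc k" for j
      using that k grid_le_iff[OF g, of j k] by (intro measurable_later[OF c]) auto
    have [measurable]: "(\<lambda>\<omega>. \<Sum>j<Suc k. (c j \<omega>)\<^sup>2 * d j) \<in> borel_measurable (F (p k))"
      by (intro borel_measurable_sum borel_measurable_times borel_measurable_power) auto
    show ?thesis unfolding c'_def
      by (intro measurable_If c[OF k] borel_measurable_const) measurable
  qed
  have Q'K: "Q' \<omega> \<le> q + 1" for \<omega>
  proof -
    have "(\<Sum>k<m. (c' k \<omega>)\<^sup>2 * d k) \<le> q + 1 \<and> (\<Sum>k<m. (c' k \<omega>)\<^sup>2 * d k) \<le> (\<Sum>k<m. (c k \<omega>)\<^sup>2 * d k)"
      if "m \<le> L" for m using that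
    proof (induction m)
      case (Suc m)
      then show ?case using d[of m]
        by (cases "(\<Sum>j<Suc m. (c j \<omega>)\<^sup>2 * d j) \<le> q + 1") (auto simp: c'_def)
    qed (use q in simp)
    then show ?thesis by (simp add: Q'_def)
  qed
  have Q'0: "0 \<le> Q' \<omega>" for \<omega> unfolding Q'_def by (intro sum_nonneg mult_nonneg_nonneg d) auto
  have same: "I' \<omega> = I \<omega> \<and> Q' \<omega> = Q \<omega>" if "Q \<omega> \<le> q + 1" for \<omega>
  proof -
    have "c' k \<omega> = c k \<omega>" if k: "k < L" for k
    proof -
      have "(\<Sum>j<Suc k. (c j \<omega>)\<^sup>2 * d j) \<le> (\<Sum>j<L. (c j \<omega>)\<^sup>2 * d j)"
        using d k by (intro sum_mono2) auto
      with \<open>Q \<omega> \<le> q + 1\<close> show ?thesis by (simp add: c'_def Q)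
    qed
    then show ?thesis unfolding I'_def I Q'_def Q by auto
  qed
  have c'M: "c' k \<in> borel_measurable M" if "k < L" for k using c'[OF that] by (rule measurable_ambient)
  have [measurable]: "I' \<in> borel_measurable M"
    unfolding I'_def by (intro borel_measurable_sum borel_measurable_times borel_measurable_diff c'M BM) auto
  have [measurable]: "Q' \<in> borel_measurable M"
    unfolding Q'_def by (intro borel_measurable_sum borel_measurable_times borel_measurable_power c'M) auto
  have mart: "(CLINT \<omega>|M. iexp (I' \<omega>) * exp (Q' \<omega> / 2)) = 1"
    using discrete_exponential_martingale[OF g c', of "q + 1"] Q'K by (simp add: I'_def Q'_def d_def)
  define D where "D = {\<omega> \<in> space M. \<epsilon> \<le> \<bar>Q \<omega> - q\<bar>}"
  have [measurable]: "D \<in> sets M" unfolding D_def by measurable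
  let ?Y = "\<lambda>\<omega>. exp (- q / 2) * (iexp (I' \<omega>) * exp (Q' \<omega> / 2))"
  have bound: "norm (iexp (I \<omega>) - ?Y \<omega>) \<le> 3 * indicator D \<omega> + \<epsilon>" if "\<omega> \<in> space M" for \<omega>
  proof (cases "\<omega> \<in> D")
    case True
    have Y: "norm (?Y \<omega>) = exp ((Q' \<omega> - q) / 2)"
      by (simp add: norm_mult exp_add[symmetric] diff_divide_distrib)
    have "exp ((Q' \<omega> - q) / 2) \<le> exp (1 / 2)" using Q'K[of \<omega>] by simp
    also have "exp (1 / 2 :: real) \<le> 2" using exp_bound_half[of "1 / 2 :: real"] by simp
    finally have "norm (?Y \<omega>) \<le> 2" using Y by simp
    then show ?thesis using True \<epsilon> norm_triangle_ineq4[of "iexp (I \<omega>)" "?Y \<omega>"] by simp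
  next
    case False
    define x where "x = (Q \<omega> - q) / 2"
    have x: "\<bar>x\<bar> < \<epsilon> / 2" using False that by (simp add: D_def x_def)
    then have e: "Q \<omega> \<le> q + 1" using \<epsilon> by (simp add: x_def abs_less_iff)
    have "iexp (I \<omega>) - ?Y \<omega> = iexp (I \<omega>) * (1 - exp x)"
    proof -
      have "complex_of_real (exp (- q / 2)) * complex_of_real (exp (Q \<omega> / 2)) = complex_of_real (exp x)"
        unfolding of_real_mult[symmetric] exp_add[symmetric] x_def by (simp add: diff_divide_distrib)
      then show ?thesis using same[OF e] by (simp add: algebra_simps del: of_real_exp)
    qed
    then have "norm (iexp (I \<omega>) - ?Y \<omega>) = \<bar>1 - exp x\<bar>"
      using norm_of_real[of "1 - exp x", where 'a=complex] by (simp add: norm_mult)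
    also have "\<dots> \<le> 2 * \<bar>x\<bar>"
    proof -
      have "1 + x \<le> exp x" by (rule exp_ge_add_one_self)
      moreover have "exp x \<le> 1 + 2 * \<bar>x\<bar>" using exp_bound_lemma[of x] x \<epsilon> by simp
      ultimately show ?thesis by linarith
    qed
    finally show ?thesis using x False by simp
  qed
  have iI: "complex_integrable M (\<lambda>\<omega>. iexp (I \<omega>))"
    using IM by (intro integrable_const_bound[where B=1]) auto
  have iY: "complex_integrable M ?Y"
  proof (rule integrable_const_bound[where B="exp (1 / 2)"])
    have "norm (?Y \<omega>) \<le> exp (1 / 2)" for \<omega>
      using Q'K[of \<omega>] by (simp add: norm_mult exp_add[symmetric])
    then show "AE \<omega> in M. norm (?Y \<omega>) \<le> exp (1 / 2)" by simp
  qed measurable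
  have "integrable M (indicat_real D)"
    by (rule integrable_real_indicator) (use \<open>D \<in> sets M\<close> in \<open>auto simp: emeasure_eq_measure\<close>)
  then have iD: "integrable M (\<lambda>\<omega>. 3 * indicator D \<omega> + \<epsilon> :: real)"
    by (intro Bochner_Integration.integrable_add integrable_mult_right) simp_all
  have "norm ((CLINT \<omega>|M. iexp (I \<omega>)) - exp (- q / 2)) = norm (CLINT \<omega>|M. iexp (I \<omega>) - ?Y \<omega>)"
    using mart by (subst Bochner_Integration.integral_diff[OF iI iY]) simp
  also have "\<dots> \<le> (\<integral>\<omega>. norm (iexp (I \<omega>) - ?Y \<omega>) \<partial>M)" by (rule integral_norm_bound)
  also have "\<dots> \<le> (\<integral>\<omega>. 3 * indicator D \<omega> + \<epsilon> \<partial>M)"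
    using iI iY iD bound by (intro integral_mono integrable_norm Bochner_Integration.integrable_diff) auto
  also have "\<dots> = 3 * prob D + \<epsilon>"
    using \<open>integrable M (indicat_real D)\<close> \<open>D \<in> sets M\<close>
    by (subst Bochner_Integration.integral_add) (auto simp: prob_space)
  finally show "norm ((CLINT \<omega>|M. iexp (I \<omega>)) - exp (- q / 2)) \<le> 3 * prob {\<omega> \<in> space M. \<epsilon> \<le> \<bar>Q \<omega> - q\<bar>} + \<epsilon>"
    by (simp add: D_def)
qed

end

lemma L2_close_norms_tendsto:
  fixes f g :: "nat \<Rightarrow> real \<Rightarrow> real"
  assumes m[measurable]: "\<And>n. f n \<in> borel_measurable borel" "\<And>n. g n \<in> borel_measurable borel"
    and fi: "\<And>n. integrable lborel (\<lambda>r. (f n r)\<^sup>2)"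
    and gi: "\<forall>\<^sub>F n in sequentially. integrable lborel (\<lambda>r. (g n r)\<^sup>2)"
    and q: "(\<lambda>n. \<integral>r. (g n r)\<^sup>2 \<partial>lborel) \<longlonglongrightarrow> q"
    and d: "(\<lambda>n. \<integral>\<^sup>+r. ennreal ((f n r - g n r)\<^sup>2) \<partial>lborel) \<longlonglongrightarrow> 0"
  shows "(\<lambda>n. \<integral>r. (f n r)\<^sup>2 \<partial>lborel) \<longlonglongrightarrow> q"
proof -
  define D where "D n = (\<integral>r. (f n r - g n r)\<^sup>2 \<partial>lborel)" for n
  \<comment> \<open>The parameter in \<open>\<bar>a\<^sup>2 - b\<^sup>2\<bar> \<le> (1 + 1 / \<kappa>) * (a - b)\<^sup>2 + \<kappa> * b\<^sup>2\<close>.  It tends to \<open>0\<close>, but \<open>D n / \<kappa> n\<close> does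
    so too; the second summand keeps it positive where \<open>D n = 0\<close>.\<close>
  define \<kappa> where "\<kappa> n = sqrt (D n) + 1 / real (Suc n)" for n
  have D: "D \<longlonglongrightarrow> 0"
  proof -
    have "(\<lambda>n. enn2real (\<integral>\<^sup>+r. ennreal ((f n r - g n r)\<^sup>2) \<partial>lborel)) \<longlonglongrightarrow> 0"
      using d by (intro tendsto_enn2real) auto
    then show ?thesis unfolding D_def by (subst integral_eq_nn_integral) auto
  qed
  have D0: "0 \<le> D n" for n by (simp add: D_def)
  have "\<kappa> \<longlonglongrightarrow> sqrt 0 + 0" unfolding \<kappa>_def
    using D LIMSEQ_inverse_real_of_nat
    by (intro tendsto_add tendsto_real_sqrt) (simp_all add: inverse_eq_divide)
  then have \<kappa>: "\<kappa> \<longlonglongrightarrow> 0" by simp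
  have bound: "\<bar>(\<integral>r. (f n r)\<^sup>2 \<partial>lborel) - (\<integral>r. (g n r)\<^sup>2 \<partial>lborel)\<bar>
      \<le> D n + sqrt (D n) + \<kappa> n * (\<integral>r. (g n r)\<^sup>2 \<partial>lborel)"
    if gi: "integrable lborel (\<lambda>r. (g n r)\<^sup>2)" for n
  proof -
    have \<kappa>0: "0 < \<kappa> n" unfolding \<kappa>_def using D0[of n] by (intro add_nonneg_pos) auto
    have di: "integrable lborel (\<lambda>r. (f n r - g n r)\<^sup>2)"
    proof (rule Bochner_Integration.integrable_bound)
      show "integrable lborel (\<lambda>r. 2 * (f n r)\<^sup>2 + 2 * (g n r)\<^sup>2)"
        using fi gi by (intro Bochner_Integration.integrable_add integrable_mult_right)
      have "(a - b)\<^sup>2 \<le> 2 * a\<^sup>2 + 2 * b\<^sup>2" for a b :: real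
        using zero_le_power2[of "a + b"] by (simp add: power2_eq_square algebra_simps)
      then show "AE r in lborel. norm ((f n r - g n r)\<^sup>2) \<le> norm (2 * (f n r)\<^sup>2 + 2 * (g n r)\<^sup>2)" by simp
    qed simp
    have pt: "\<bar>a\<^sup>2 - b\<^sup>2\<bar> \<le> (1 + 1 / k) * (a - b)\<^sup>2 + k * b\<^sup>2" if "0 < k" for a b k :: real
    proof -
      have "2 * \<bar>a - b\<bar> * \<bar>b\<bar> \<le> (a - b)\<^sup>2 / k + k * b\<^sup>2"
      proof -
        have "0 \<le> (\<bar>a - b\<bar> - k * \<bar>b\<bar>)\<^sup>2 / k" using that by simp
        also have "\<dots> = (a - b)\<^sup>2 / k + k * b\<^sup>2 - 2 * \<bar>a - b\<bar> * \<bar>b\<bar>"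
          using that unfolding power2_diff power_mult_distrib power2_abs
          by (simp add: field_simps power2_eq_square)
        finally show ?thesis by simp
      qed
      moreover have "\<bar>a\<^sup>2 - b\<^sup>2\<bar> \<le> (a - b)\<^sup>2 + 2 * \<bar>a - b\<bar> * \<bar>b\<bar>"
      proof -
        have "a\<^sup>2 - b\<^sup>2 = (a - b)\<^sup>2 + 2 * (a - b) * b" by (simp add: power2_eq_square algebra_simps)
        moreover have "\<bar>2 * (a - b) * b\<bar> = 2 * \<bar>a - b\<bar> * \<bar>b\<bar>" by (simp only: abs_mult abs_numeral)
        ultimately show ?thesis using abs_triangle_ineq[of "(a - b)\<^sup>2" "2 * (a - b) * b"] by simp
      qed
      moreover have "(1 + 1 / k) * (a - b)\<^sup>2 = (a - b)\<^sup>2 + (a - b)\<^sup>2 / k" by (simp add: distrib_right)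
      ultimately show ?thesis by linarith
    qed
    have "\<bar>(\<integral>r. (f n r)\<^sup>2 \<partial>lborel) - (\<integral>r. (g n r)\<^sup>2 \<partial>lborel)\<bar> = \<bar>\<integral>r. (f n r)\<^sup>2 - (g n r)\<^sup>2 \<partial>lborel\<bar>"
      by (simp add: Bochner_Integration.integral_diff[OF fi gi])
    also have "\<dots> \<le> (\<integral>r. \<bar>(f n r)\<^sup>2 - (g n r)\<^sup>2\<bar> \<partial>lborel)" by (rule integral_abs_bound)
    also have "\<dots> \<le> (\<integral>r. (1 + 1 / \<kappa> n) * (f n r - g n r)\<^sup>2 + \<kappa> n * (g n r)\<^sup>2 \<partial>lborel)"
      by (intro integral_mono pt \<kappa>0 integrable_abs Bochner_Integration.integrable_diff
          Bochner_Integration.integrable_add integrable_mult_right fi gi di)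
    also have "\<dots> = (1 + 1 / \<kappa> n) * D n + \<kappa> n * (\<integral>r. (g n r)\<^sup>2 \<partial>lborel)"
      unfolding D_def using di gi by (subst Bochner_Integration.integral_add) auto
    also have "(1 + 1 / \<kappa> n) * D n \<le> D n + sqrt (D n)"
    proof -
      have "D n = sqrt (D n) * sqrt (D n)" using D0 by simp
      also have "\<dots> \<le> \<kappa> n * sqrt (D n)" using D0 by (intro mult_right_mono) (auto simp: \<kappa>_def)
      finally have "D n / \<kappa> n \<le> sqrt (D n)" using \<kappa>0 by (simp add: field_simps)
      then show ?thesis by (simp add: algebra_simps)
    qed
    finally show ?thesis by simp
  qed
  have lim0: "(\<lambda>n. D n + sqrt (D n) + \<kappa> n * (\<integral>r. (g n r)\<^sup>2 \<partial>lborel)) \<longlonglongrightarrow> 0 + sqrt 0 + 0 * q"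
    by (intro tendsto_add tendsto_mult tendsto_real_sqrt D \<kappa> q)
  have "(\<lambda>n. (\<integral>r. (f n r)\<^sup>2 \<partial>lborel) - (\<integral>r. (g n r)\<^sup>2 \<partial>lborel)) \<longlonglongrightarrow> 0"
    by (rule Lim_null_comparison[OF _ lim0[simplified]]) (use gi bound in \<open>auto elim!: eventually_mono\<close>)
  from tendsto_add[OF this q] show ?thesis by simp
qed

lemma (in prob_space) AE_tendsto_imp_tendsto_in_prob:
  fixes Q :: "nat \<Rightarrow> 'a \<Rightarrow> real"
  assumes [measurable]: "\<And>n. Q n \<in> borel_measurable M" and lim: "AE \<omega> in M. (\<lambda>n. Q n \<omega>) \<longlonglongrightarrow> q" and "0 < \<epsilon>"
  shows "(\<lambda>n. prob {\<omega> \<in> space M. \<epsilon> \<le> \<bar>Q n \<omega> - q\<bar>}) \<longlonglongrightarrow> 0"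
proof -
  let ?D = "\<lambda>n. {\<omega> \<in> space M. \<epsilon> \<le> \<bar>Q n \<omega> - q\<bar>}"
  have "AE \<omega> in M. (\<lambda>n. indicator (?D n) \<omega> :: real) \<longlonglongrightarrow> 0"
    using lim
  proof eventually_elim
    fix \<omega> assume "(\<lambda>n. Q n \<omega>) \<longlonglongrightarrow> q"
    then have "\<forall>\<^sub>F n in sequentially. \<bar>Q n \<omega> - q\<bar> < \<epsilon>"
      using \<open>0 < \<epsilon>\<close> by (auto simp: tendsto_iff dist_real_def)
    then show "(\<lambda>n. indicator (?D n) \<omega> :: real) \<longlonglongrightarrow> 0"
      by (intro tendsto_eventually) (auto elim!: eventually_mono simp: indicator_def)
  qed
  then have "(\<lambda>n. integral\<^sup>L M (indicator (?D n))) \<longlonglongrightarrow> (\<integral>\<omega>. (0::real) \<partial>M)"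
    by (intro integral_dominated_convergence[where w="\<lambda>_. 1"]) (auto simp: indicator_def)
  moreover have "{\<omega> \<in> space M. \<epsilon> \<le> \<bar>Q n \<omega> - q\<bar>} \<inter> space M = {\<omega> \<in> space M. \<epsilon> \<le> \<bar>Q n \<omega> - q\<bar>}" for n by auto
  ultimately show ?thesis by simp
qed

text \<open>A central limit theorem for stochastic integrals with asymptotically deterministic integrands: these have
  asymptotically deterministic quadratic variations.\<close>
lemma (in brownian) elementary_char_limit:
  assumes el: "\<And>n. elementary (\<psi> n) (I n)"
    and k: "\<And>n. k n \<in> borel_measurable borel"
    and ki: "\<forall>\<^sub>F n in sequentially. integrable lborel (\<lambda>r. (k n r)\<^sup>2)"
    and q: "(\<lambda>n. \<integral>r. (k n r)\<^sup>2 \<partial>lborel) \<longlonglongrightarrow> q"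
    and d: "AE \<omega> in M. (\<lambda>n. \<integral>\<^sup>+r. ennreal ((\<psi> n r \<omega> - k n r)\<^sup>2) \<partial>lborel) \<longlonglongrightarrow> 0"
  shows "(\<lambda>n. CLINT \<omega>|M. iexp (I n \<omega>)) \<longlonglongrightarrow> complex_of_real (exp (- q / 2))"
proof (rule LIMSEQ_I)
  fix r :: real assume "0 < r"
  have q0: "0 \<le> q" by (rule LIMSEQ_le_const[OF q]) auto
  define Q where "Q n \<omega> = (\<integral>r. (\<psi> n r \<omega>)\<^sup>2 \<partial>lborel)" for n \<omega>
  note est = elementary_char_estimate[OF el, folded Q_def]
  define \<epsilon> where "\<epsilon> = min (r / 2) (1 / 2)"
  have \<epsilon>: "0 < \<epsilon>" "\<epsilon> < 1" "\<epsilon> \<le> r / 2" using \<open>0 < r\<close> by (auto simp: \<epsilon>_def)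
  have "AE \<omega> in M. (\<lambda>n. Q n \<omega>) \<longlonglongrightarrow> q"
    using d
  proof eventually_elim
    fix \<omega> assume "(\<lambda>n. \<integral>\<^sup>+r. ennreal ((\<psi> n r \<omega> - k n r)\<^sup>2) \<partial>lborel) \<longlonglongrightarrow> 0"
    then show "(\<lambda>n. Q n \<omega>) \<longlonglongrightarrow> q"
      unfolding Q_def by (intro L2_close_norms_tendsto[of "\<lambda>n r. \<psi> n r \<omega>" k] est k ki q)
  qed
  then have "(\<lambda>n. prob {\<omega> \<in> space M. \<epsilon> \<le> \<bar>Q n \<omega> - q\<bar>}) \<longlonglongrightarrow> 0"
    using est(2) \<epsilon> by (intro AE_tendsto_imp_tendsto_in_prob) auto
  then have "\<forall>\<^sub>F n in sequentially. prob {\<omega> \<in> space M. \<epsilon> \<le> \<bar>Q n \<omega> - q\<bar>} < r / 6"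
    using \<open>0 < r\<close> by (intro order_tendstoD(2)) auto
  then obtain N where N: "\<And>n. n \<ge> N \<Longrightarrow> prob {\<omega> \<in> space M. \<epsilon> \<le> \<bar>Q n \<omega> - q\<bar>} < r / 6"
    by (auto simp: eventually_sequentially)
  show "\<exists>no. \<forall>n\<ge>no. norm ((CLINT \<omega>|M. iexp (I n \<omega>)) - complex_of_real (exp (- q / 2))) < r"
  proof (intro exI[of _ N] allI impI)
    fix n assume "N \<le> n"
    then show "norm ((CLINT \<omega>|M. iexp (I n \<omega>)) - complex_of_real (exp (- q / 2))) < r"
      using est(5)[of q \<epsilon> n] q0 \<epsilon> N[of n] by simp
  qed
qed

section \<open>Bounded functionals on the weighted spaces\<close>

locale half_line_measure =
  fixes \<mu> :: "real measure"
  assumes sets_mu: "sets \<mu> = sets borel" and null: "emeasure \<mu> {..0} = 0"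
begin

lemma measurable_mu: "borel_measurable \<mu> = borel_measurable borel"
  using sets_mu by (rule measurable_cong_sets) simp

lemma AE_pos: "AE x in \<mu>. 0 < x"
  by (rule AE_I[where N="{..0}"]) (use null sets_mu in auto)

lemma HspD: "y \<in> Hsp \<mu> \<eta> \<Longrightarrow> y \<in> borel_measurable borel"
  "y \<in> Hsp \<mu> \<eta> \<Longrightarrow> integrable \<mu> (\<lambda>x. (y x)\<^sup>2 * (1 + x) powr \<eta>)"
  by (auto simp: Hsp_def)

lemma integrable_product:
  assumes "y \<in> Hsp \<mu> \<eta>" "z \<in> Hsp \<mu> \<eta>"
  shows "integrable \<mu> (\<lambda>x. y x * z x * (1 + x) powr \<eta>)"
proof (rule Bochner_Integration.integrable_bound)
  show "integrable \<mu> (\<lambda>x. (y x)\<^sup>2 * (1 + x) powr \<eta> + (z x)\<^sup>2 * (1 + x) powr \<eta>)"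
    using assms by (intro Bochner_Integration.integrable_add HspD)
  have [measurable]: "y \<in> borel_measurable borel" "z \<in> borel_measurable borel" using assms HspD by auto
  show "(\<lambda>x. y x * z x * (1 + x) powr \<eta>) \<in> borel_measurable \<mu>" unfolding measurable_mu by measurable
  have "\<bar>y x * z x\<bar> \<le> (y x)\<^sup>2 + (z x)\<^sup>2" for x
  proof -
    have "2 * \<bar>y x * z x\<bar> \<le> (y x)\<^sup>2 + (z x)\<^sup>2"
      using sum_squares_bound[of "\<bar>y x\<bar>" "\<bar>z x\<bar>"] by (simp add: abs_mult)
    then show ?thesis using abs_ge_zero[of "y x * z x"] by linarith
  qed
  then have "\<bar>y x * z x\<bar> * (1 + x) powr \<eta> \<le> ((y x)\<^sup>2 + (z x)\<^sup>2) * (1 + x) powr \<eta>" for x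
    by (intro mult_right_mono) auto
  then show "AE x in \<mu>. norm (y x * z x * (1 + x) powr \<eta>) \<le> norm ((y x)\<^sup>2 * (1 + x) powr \<eta> + (z x)\<^sup>2 * (1 + x) powr \<eta>)"
    by (simp add: abs_mult distrib_right)
qed

lemma Hsp_lincomb:
  assumes "y \<in> Hsp \<mu> \<eta>" "z \<in> Hsp \<mu> \<eta>"
  shows "(\<lambda>x. a * y x + b * z x) \<in> Hsp \<mu> \<eta>"
proof -
  have [measurable]: "y \<in> borel_measurable borel" "z \<in> borel_measurable borel" using assms HspD by auto
  have "integrable \<mu> (\<lambda>x. a\<^sup>2 * ((y x)\<^sup>2 * (1 + x) powr \<eta>) + (2 * a * b) * (y x * z x * (1 + x) powr \<eta>)
      + b\<^sup>2 * ((z x)\<^sup>2 * (1 + x) powr \<eta>))"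
    using assms by (intro Bochner_Integration.integrable_add integrable_mult_right HspD integrable_product)
  then have "integrable \<mu> (\<lambda>x. (a * y x + b * z x)\<^sup>2 * (1 + x) powr \<eta>)"
    by (rule Bochner_Integration.integrable_cong[THEN iffD1, rotated 2]) (auto simp: power2_eq_square algebra_simps)
  then show ?thesis by (simp add: Hsp_def)
qed

lemma Hsp_zero: "(\<lambda>x. 0) \<in> Hsp \<mu> \<eta>" by (simp add: Hsp_def)

lemma Hsp_diff: "y \<in> Hsp \<mu> \<eta> \<Longrightarrow> z \<in> Hsp \<mu> \<eta> \<Longrightarrow> (\<lambda>x. y x - z x) \<in> Hsp \<mu> \<eta>"
  using Hsp_lincomb[of y \<eta> z 1 "-1"] by simp

lemma Hsp_add: "y \<in> Hsp \<mu> \<eta> \<Longrightarrow> z \<in> Hsp \<mu> \<eta> \<Longrightarrow> (\<lambda>x. y x + z x) \<in> Hsp \<mu> \<eta>"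
  using Hsp_lincomb[of y \<eta> z 1 "1"] by simp

lemma Hsp_sum:
  fixes m :: nat
  assumes "\<And>k. k < m \<Longrightarrow> \<phi> k \<in> Hsp \<mu> \<eta>"
  shows "(\<lambda>x. \<Sum>k<m. a k * \<phi> k x) \<in> Hsp \<mu> \<eta>"
  using assms
proof (induction m)
  case (Suc m)
  have "(\<lambda>x. 1 * (\<Sum>k<m. a k * \<phi> k x) + a m * \<phi> m x) \<in> Hsp \<mu> \<eta>"
    using Suc by (intro Hsp_lincomb) auto
  then show ?case by simp
qed (simp add: Hsp_zero)

lemma Hinner_lincomb_left:
  assumes "y \<in> Hsp \<mu> \<eta>" "z \<in> Hsp \<mu> \<eta>" "w \<in> Hsp \<mu> \<eta>"
  shows "Hinner \<mu> \<eta> (\<lambda>x. a * y x + b * z x) w = a * Hinner \<mu> \<eta> y w + b * Hinner \<mu> \<eta> z w"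
proof -
  have "(\<integral>x. (a * y x + b * z x) * w x * (1 + x) powr \<eta> \<partial>\<mu>)
      = (\<integral>x. a * (y x * w x * (1 + x) powr \<eta>) + b * (z x * w x * (1 + x) powr \<eta>) \<partial>\<mu>)"
    by (rule Bochner_Integration.integral_cong) (auto simp: algebra_simps)
  also have "\<dots> = a * (\<integral>x. y x * w x * (1 + x) powr \<eta> \<partial>\<mu>) + b * (\<integral>x. z x * w x * (1 + x) powr \<eta> \<partial>\<mu>)"
    using assms integrable_product by (subst Bochner_Integration.integral_add) auto
  finally show ?thesis by (simp add: Hinner_def algebra_simps)
qed

lemma Hinner_commute: "Hinner \<mu> \<eta> y z = Hinner \<mu> \<eta> z y"
  by (simp add: Hinner_def mult.commute)

lemma Hinner_self_nonneg: "0 \<le> Hinner \<mu> \<eta> y y"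
  unfolding Hinner_def by (intro add_nonneg_nonneg integral_nonneg_AE) auto

lemma Hnorm_nonneg: "0 \<le> Hnorm \<mu> \<eta> y"
  using Hinner_self_nonneg by (simp add: Hnorm_def)

lemma Cauchy_Schwarz_Hinner:
  assumes y: "y \<in> Hsp \<mu> \<eta>" and z: "z \<in> Hsp \<mu> \<eta>"
  shows "\<bar>Hinner \<mu> \<eta> y z\<bar> \<le> Hnorm \<mu> \<eta> y * Hnorm \<mu> \<eta> z"
proof -
  define a b c where "a = Hinner \<mu> \<eta> y y" and "b = Hinner \<mu> \<eta> y z" and "c = Hinner \<mu> \<eta> z z"
  have quad: "0 \<le> a * s\<^sup>2 + 2 * s * t * b + t\<^sup>2 * c" for s t
  proof -
    let ?w = "\<lambda>x. s * y x + t * z x"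
    have w: "?w \<in> Hsp \<mu> \<eta>" using y z by (rule Hsp_lincomb)
    have "Hinner \<mu> \<eta> ?w ?w = s * Hinner \<mu> \<eta> y ?w + t * Hinner \<mu> \<eta> z ?w"
      by (rule Hinner_lincomb_left[OF y z w])
    also have "Hinner \<mu> \<eta> y ?w = s * a + t * b"
      using Hinner_lincomb_left[OF y z y, of s t] Hinner_commute[of \<eta> y ?w] Hinner_commute[of \<eta> y z]
      by (simp add: a_def b_def)
    also have "Hinner \<mu> \<eta> z ?w = s * b + t * c"
      using Hinner_lincomb_left[OF y z z, of s t] Hinner_commute[of \<eta> z ?w]
      by (simp add: b_def c_def)
    finally show ?thesis using Hinner_self_nonneg[of \<eta> ?w] by (simp add: algebra_simps power2_eq_square)
  qed
  have a0: "0 \<le> a" and c0: "0 \<le> c" using Hinner_self_nonneg by (auto simp: a_def c_def)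
  have "b\<^sup>2 \<le> a * c"
  proof (cases "c = 0")
    case True
    have "b = 0"
    proof (rule ccontr)
      assume "b \<noteq> 0"
      then show False using quad[of 1 "- (a + 1) / (2 * b)"] True by (simp add: field_simps)
    qed
    then show ?thesis using True by simp
  next
    case False
    with c0 have "c > 0" by simp
    have "0 \<le> a * c\<^sup>2 - b\<^sup>2 * c" using quad[of c "- b"] by (simp add: power2_eq_square algebra_simps)
    then have "0 \<le> c * (a * c - b\<^sup>2)" by (simp add: power2_eq_square algebra_simps)
    then show ?thesis using \<open>c > 0\<close> by (simp add: zero_le_mult_iff)
  qed
  then have "sqrt (b\<^sup>2) \<le> sqrt (a * c)" by (rule real_sqrt_le_mono)
  then show ?thesis by (simp add: real_sqrt_mult Hnorm_def a_def b_def c_def)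
qed

lemma weight_mono:
  assumes "\<eta> \<le> \<eta>'" and y: "y \<in> Hsp \<mu> \<eta>'"
  shows "y \<in> Hsp \<mu> \<eta>" "Hnorm \<mu> \<eta> y \<le> Hnorm \<mu> \<eta>' y"
proof -
  have [measurable]: "y \<in> borel_measurable borel" using y HspD by auto
  have le: "AE x in \<mu>. (y x)\<^sup>2 * (1 + x) powr \<eta> \<le> (y x)\<^sup>2 * (1 + x) powr \<eta>'"
    using AE_pos by eventually_elim (use assms in \<open>auto intro!: mult_left_mono powr_mono\<close>)
  have i: "integrable \<mu> (\<lambda>x. (y x)\<^sup>2 * (1 + x) powr \<eta>)"
  proof (rule Bochner_Integration.integrable_bound[OF HspD(2)[OF y]])
    show "(\<lambda>x. (y x)\<^sup>2 * (1 + x) powr \<eta>) \<in> borel_measurable \<mu>" unfolding measurable_mu by measurable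
  qed (use le in auto)
  then show "y \<in> Hsp \<mu> \<eta>" by (simp add: Hsp_def)
  show "Hnorm \<mu> \<eta> y \<le> Hnorm \<mu> \<eta>' y"
    unfolding Hnorm_def Hinner_def power2_eq_square[symmetric]
    using integral_mono_AE[OF i HspD(2)[OF y] le] by simp
qed

lemma space_Hborel: "space (Hborel \<mu> \<eta>) = Hsp \<mu> \<eta>"
  unfolding Hborel_def by (rule space_measure_of) auto

end

text \<open>A bounded linear functional given on representatives.  The state space enters the probabilistic
  argument through such functionals: \<open>Xi \<mu>\<close> and the pairings with the \<open>y i\<close>.\<close>
locale H_functional = half_line_measure \<mu> for \<mu> :: "real measure" +
  fixes \<eta> :: real and \<l> :: "(real \<Rightarrow> real) \<Rightarrow> real" and c :: real
  assumes lincomb: "\<And>y z a b. y \<in> Hsp \<mu> \<eta> \<Longrightarrow> z \<in> Hsp \<mu> \<eta> \<Longrightarrow>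
      \<l> (\<lambda>x. a * y x + b * z x) = a * \<l> y + b * \<l> z"
    and bound: "\<And>y. y \<in> Hsp \<mu> \<eta> \<Longrightarrow> \<bar>\<l> y\<bar> \<le> c * Hnorm \<mu> \<eta> y"
    and c_pos: "0 < c"
begin

lemma functional_diff: "y \<in> Hsp \<mu> \<eta> \<Longrightarrow> z \<in> Hsp \<mu> \<eta> \<Longrightarrow> \<l> (\<lambda>x. y x - z x) = \<l> y - \<l> z"
  using lincomb[of y z 1 "-1"] by simp

lemma functional_add: "y \<in> Hsp \<mu> \<eta> \<Longrightarrow> z \<in> Hsp \<mu> \<eta> \<Longrightarrow> \<l> (\<lambda>x. y x + z x) = \<l> y + \<l> z"
  using lincomb[of y z 1 1] by simp

lemma functional_sum:
  fixes m :: nat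
  assumes "\<And>k. k < m \<Longrightarrow> \<phi> k \<in> Hsp \<mu> \<eta>"
  shows "\<l> (\<lambda>x. \<Sum>k<m. a k * \<phi> k x) = (\<Sum>k<m. a k * \<l> (\<phi> k))"
  using assms
proof (induction m)
  case 0
  show ?case using lincomb[OF Hsp_zero Hsp_zero, of 0 0] by simp
next
  case (Suc m)
  have "\<l> (\<lambda>x. 1 * (\<Sum>k<m. a k * \<phi> k x) + a m * \<phi> m x) = 1 * \<l> (\<lambda>x. \<Sum>k<m. a k * \<phi> k x) + a m * \<l> (\<phi> m)"
    using Suc.prems by (intro lincomb Hsp_sum) auto
  then show ?case using Suc by simp
qed

lemma dist_bound: "y \<in> Hsp \<mu> \<eta> \<Longrightarrow> z \<in> Hsp \<mu> \<eta> \<Longrightarrow> \<bar>\<l> y - \<l> z\<bar> \<le> c * Hdist \<mu> \<eta> y z"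
  using functional_diff[of y z] bound[OF Hsp_diff, of y z] by (simp add: Hdist_def)

lemma functional_measurable: "\<l> \<in> borel_measurable (Hborel \<mu> \<eta>)"
proof (rule borel_measurableI)
  fix S :: "real set" assume "open S"
  have "\<exists>e>0. \<forall>z\<in>Hsp \<mu> \<eta>. Hdist \<mu> \<eta> z y < e \<longrightarrow> z \<in> \<l> -` S \<inter> Hsp \<mu> \<eta>"
    if "y \<in> \<l> -` S \<inter> Hsp \<mu> \<eta>" for y
  proof -
    from \<open>open S\<close> that obtain d where d: "d > 0" "\<And>s. \<bar>s - \<l> y\<bar> < d \<Longrightarrow> s \<in> S"
      unfolding open_dist by (auto simp: dist_real_def)
    show ?thesis
    proof (intro exI[of _ "d / c"] conjI ballI impI IntI vimageI2 d(2))
      fix z assume z: "z \<in> Hsp \<mu> \<eta>" "Hdist \<mu> \<eta> z y < d / c"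
      then have "c * Hdist \<mu> \<eta> z y < d" using c_pos by (simp add: field_simps)
      then show "\<bar>\<l> z - \<l> y\<bar> < d" using dist_bound[of z y] z that by auto
    qed (use d c_pos in auto)
  qed
  then show "\<l> -` S \<inter> space (Hborel \<mu> \<eta>) \<in> sets (Hborel \<mu> \<eta>)"
    unfolding space_Hborel unfolding Hborel_def by (subst sets_measure_of) (auto intro!: sigma_sets.Basic)
qed

text \<open>The functional maps the simple functions that approximate \<open>f\<close> to real simple functions that approximate
  \<open>\<l> \<circ> f\<close> in \<open>L\<^sup>1\<close>, and their integrals converge to \<open>\<l> I\<close>.\<close>
lemma H_integral_bound:
  fixes N :: "'b measure"
  assumes "has_H_integral \<mu> \<eta> N f I"
  shows "ennreal \<bar>\<l> I\<bar> \<le> (\<integral>\<^sup>+r. ennreal \<bar>\<l> (f r)\<bar> \<partial>N)"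
proof -
  from assms obtain m :: "nat \<Rightarrow> nat" and A :: "nat \<Rightarrow> nat \<Rightarrow> 'b set" and \<phi> :: "nat \<Rightarrow> nat \<Rightarrow> real \<Rightarrow> real"
    where f: "f \<in> measurable N (Hborel \<mu> \<eta>)" and I: "I \<in> Hsp \<mu> \<eta>"
      and A: "\<And>n k. k < m n \<Longrightarrow> A n k \<in> sets N \<and> emeasure N (A n k) < \<infinity> \<and> \<phi> n k \<in> Hsp \<mu> \<eta>"
      and lim1: "(\<lambda>n. \<integral>\<^sup>+r. ennreal (Hdist \<mu> \<eta> (f r) (\<lambda>x. \<Sum>k<m n. indicator (A n k) r * \<phi> n k x)) \<partial>N) \<longlonglongrightarrow> 0"
      and lim2: "(\<lambda>n. Hdist \<mu> \<eta> I (\<lambda>x. \<Sum>k<m n. measure N (A n k) * \<phi> n k x)) \<longlonglongrightarrow> 0"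
    unfolding has_H_integral_def by blast
  have fH: "f r \<in> Hsp \<mu> \<eta>" if "r \<in> space N" for r using measurable_space[OF f that] by (simp add: space_Hborel)
  have lf[measurable]: "(\<lambda>r. \<l> (f r)) \<in> borel_measurable N" using f functional_measurable by (rule measurable_compose)
  define g where "g n r = (\<Sum>k<m n. indicator (A n k) r * \<l> (\<phi> n k))" for n r
  have gm[measurable]: "g n \<in> borel_measurable N" for n
    unfolding g_def using A by (intro borel_measurable_sum borel_measurable_times borel_measurable_indicator) auto
  have gi: "integrable N (g n)" "integral\<^sup>L N (g n) = (\<Sum>k<m n. measure N (A n k) * \<l> (\<phi> n k))" for n
  proof -
    have *: "integrable N (\<lambda>r. indicator (A n k) r * \<l> (\<phi> n k))" if "k < m n" for k
      using A[OF that] by (intro integrable_mult_left) (auto simp: integrable_indicator_iff)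
    show "integrable N (g n)" unfolding g_def using * by (intro Bochner_Integration.integrable_sum) auto
    have "integral\<^sup>L N (g n) = (\<Sum>k<m n. \<integral>r. indicator (A n k) r * \<l> (\<phi> n k) \<partial>N)"
      unfolding g_def by (rule Bochner_Integration.integral_sum) (use * in auto)
    also have "\<dots> = (\<Sum>k<m n. measure N (A n k) * \<l> (\<phi> n k))"
    proof (intro sum.cong refl)
      fix k assume "k \<in> {..<m n}"
      then have "A n k \<inter> space N = A n k" using A[of k n] sets.sets_into_space by auto
      then show "(\<integral>r. indicator (A n k) r * \<l> (\<phi> n k) \<partial>N) = measure N (A n k) * \<l> (\<phi> n k)" by simp
    qed
    finally show "integral\<^sup>L N (g n) = (\<Sum>k<m n. measure N (A n k) * \<l> (\<phi> n k))" .
  qed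
  define h where "h n = Hdist \<mu> \<eta> I (\<lambda>x. \<Sum>k<m n. measure N (A n k) * \<phi> n k x)" for n
  define H where "H n = (\<integral>\<^sup>+r. ennreal (Hdist \<mu> \<eta> (f r) (\<lambda>x. \<Sum>k<m n. indicator (A n k) r * \<phi> n k x)) \<partial>N)" for n
  have 1: "(\<integral>\<^sup>+r. ennreal \<bar>g n r - \<l> (f r)\<bar> \<partial>N) \<le> ennreal c * H n" for n
  proof -
    \<comment> \<open>The factor \<open>c\<close> is pulled out of an integrand known to be measurable, which the distance \<open>Hdist\<close> is not.\<close>
    have "(\<integral>\<^sup>+r. ennreal \<bar>g n r - \<l> (f r)\<bar> \<partial>N) = (\<integral>\<^sup>+r. ennreal c * ennreal (\<bar>g n r - \<l> (f r)\<bar> / c) \<partial>N)"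
      using c_pos by (intro nn_integral_cong) (simp add: ennreal_mult'[symmetric])
    also have "\<dots> = ennreal c * (\<integral>\<^sup>+r. ennreal (\<bar>g n r - \<l> (f r)\<bar> / c) \<partial>N)"
      by (rule nn_integral_cmult) measurable
    also have "\<dots> \<le> ennreal c * H n"
      unfolding H_def
    proof (intro mult_left_mono nn_integral_mono ennreal_leI)
      fix r assume "r \<in> space N"
      have "\<bar>\<l> (f r) - \<l> (\<lambda>x. \<Sum>k<m n. indicator (A n k) r * \<phi> n k x)\<bar>
          \<le> c * Hdist \<mu> \<eta> (f r) (\<lambda>x. \<Sum>k<m n. indicator (A n k) r * \<phi> n k x)"
        using A by (intro dist_bound fH Hsp_sum) (auto simp: \<open>r \<in> space N\<close>)
      also have "\<l> (\<lambda>x. \<Sum>k<m n. indicator (A n k) r * \<phi> n k x) = g n r"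
        unfolding g_def using A by (intro functional_sum) auto
      finally show "\<bar>g n r - \<l> (f r)\<bar> / c \<le> Hdist \<mu> \<eta> (f r) (\<lambda>x. \<Sum>k<m n. indicator (A n k) r * \<phi> n k x)"
        using c_pos by (simp add: field_simps abs_minus_commute)
    qed simp
    finally show ?thesis .
  qed
  have 2: "ennreal \<bar>\<l> I\<bar> \<le> (\<integral>\<^sup>+r. ennreal \<bar>\<l> (f r)\<bar> \<partial>N) + ennreal c * H n + ennreal (c * h n)" for n
  proof -
    have "\<bar>\<l> I - integral\<^sup>L N (g n)\<bar> \<le> c * h n"
      unfolding gi h_def using A dist_bound[OF I Hsp_sum[of "m n" "\<phi> n" \<eta> "\<lambda>k. measure N (A n k)"]]
      by (subst functional_sum[symmetric]) auto
    then have "ennreal \<bar>\<l> I\<bar> \<le> ennreal (\<bar>integral\<^sup>L N (g n)\<bar> + c * h n)" by (intro ennreal_leI) linarith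
    also have "\<dots> = ennreal \<bar>integral\<^sup>L N (g n)\<bar> + ennreal (c * h n)"
      using c_pos Hnorm_nonneg by (intro ennreal_plus) (auto simp: h_def Hdist_def)
    also have "ennreal \<bar>integral\<^sup>L N (g n)\<bar> \<le> (\<integral>\<^sup>+r. ennreal \<bar>g n r\<bar> \<partial>N)"
      using integral_norm_bound_ennreal[OF gi(1), of n] by simp
    also have "\<dots> \<le> (\<integral>\<^sup>+r. ennreal \<bar>\<l> (f r)\<bar> + ennreal \<bar>g n r - \<l> (f r)\<bar> \<partial>N)"
      by (intro nn_integral_mono) (auto simp: ennreal_plus[symmetric] simp del: ennreal_plus intro!: ennreal_leI)
    also have "\<dots> = (\<integral>\<^sup>+r. ennreal \<bar>\<l> (f r)\<bar> \<partial>N) + (\<integral>\<^sup>+r. ennreal \<bar>g n r - \<l> (f r)\<bar> \<partial>N)"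
      by (rule nn_integral_add) auto
    also have "\<dots> \<le> (\<integral>\<^sup>+r. ennreal \<bar>\<l> (f r)\<bar> \<partial>N) + ennreal c * H n"
      using 1 by (intro add_left_mono)
    finally show ?thesis by (simp add: add_right_mono)
  qed
  have "(\<lambda>n. (\<integral>\<^sup>+r. ennreal \<bar>\<l> (f r)\<bar> \<partial>N) + ennreal c * H n + ennreal (c * h n))
      \<longlonglongrightarrow> (\<integral>\<^sup>+r. ennreal \<bar>\<l> (f r)\<bar> \<partial>N) + ennreal c * 0 + ennreal (c * 0)"
    using lim1 lim2 by (intro tendsto_add tendsto_const ennreal_tendsto_cmult tendsto_ennrealI tendsto_mult_left)
      (auto simp: h_def H_def)
  then show ?thesis using 2 by (intro LIMSEQ_le_const) auto
qed

end

lemma (in H_functional) functional_Heq: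
  assumes "y \<in> Hsp \<mu> \<eta>" "z \<in> Hsp \<mu> \<eta>" "Heq \<mu> y z"
  shows "\<l> y = \<l> z"
proof -
  have "AE x in \<mu>. (y x - z x) * (y x - z x) * (1 + x) powr \<eta> = 0"
    using assms(3) by (auto simp: Heq_def)
  then have "(\<integral>x. (y x - z x) * (y x - z x) * (1 + x) powr \<eta> \<partial>\<mu>) = 0" by (rule integral_eq_zero_AE)
  then have "Hdist \<mu> \<eta> y z = 0"
    using assms(3) by (simp add: Hdist_def Hnorm_def Hinner_def Heq_def)
  then show ?thesis using dist_bound[OF assms(1,2)] by simp
qed

context half_line_measure begin

lemma Hsp_AE_cong:
  assumes "y \<in> Hsp \<mu> \<eta>" "z \<in> borel_measurable borel" "AE x in \<mu>. y x = z x"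
  shows "z \<in> Hsp \<mu> \<eta>"
proof -
  have [measurable]: "y \<in> borel_measurable borel" "z \<in> borel_measurable borel" using assms HspD by auto
  have "integrable \<mu> (\<lambda>x. (z x)\<^sup>2 * (1 + x) powr \<eta>) \<longleftrightarrow> integrable \<mu> (\<lambda>x. (y x)\<^sup>2 * (1 + x) powr \<eta>)"
    by (rule integrable_cong_AE) (use assms(3) in \<open>auto simp: measurable_mu\<close>)
  then show ?thesis using HspD(2)[OF assms(1)] assms(2) by (simp add: Hsp_def)
qed

lemma H_functional_Hinner:
  assumes "\<eta> \<le> \<eta>'" and z: "z \<in> Hsp \<mu> \<eta>"
  shows "H_functional \<mu> \<eta>' (\<lambda>y. a * Hinner \<mu> \<eta> y z) (\<bar>a\<bar> * Hnorm \<mu> \<eta> z + 1)"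
proof
  fix y assume y: "y \<in> Hsp \<mu> \<eta>'"
  have "\<bar>Hinner \<mu> \<eta> y z\<bar> \<le> Hnorm \<mu> \<eta> y * Hnorm \<mu> \<eta> z"
    using weight_mono[OF assms(1) y] z by (intro Cauchy_Schwarz_Hinner)
  also have "\<dots> \<le> Hnorm \<mu> \<eta>' y * Hnorm \<mu> \<eta> z"
    using weight_mono[OF assms(1) y] Hnorm_nonneg by (intro mult_right_mono)
  finally have "\<bar>a\<bar> * \<bar>Hinner \<mu> \<eta> y z\<bar> \<le> \<bar>a\<bar> * (Hnorm \<mu> \<eta>' y * Hnorm \<mu> \<eta> z)"
    by (intro mult_left_mono) auto
  then show "\<bar>a * Hinner \<mu> \<eta> y z\<bar> \<le> (\<bar>a\<bar> * Hnorm \<mu> \<eta> z + 1) * Hnorm \<mu> \<eta>' y"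
    using Hnorm_nonneg[of \<eta>' y] by (simp add: abs_mult algebra_simps)
next
  fix y y' b b' assume "y \<in> Hsp \<mu> \<eta>'" "y' \<in> Hsp \<mu> \<eta>'"
  then show "a * Hinner \<mu> \<eta> (\<lambda>x. b * y x + b' * y' x) z = b * (a * Hinner \<mu> \<eta> y z) + b' * (a * Hinner \<mu> \<eta> y' z)"
    using weight_mono[OF assms(1)] z by (subst Hinner_lincomb_left) (auto simp: algebra_simps)
next
  show "0 < \<bar>a\<bar> * Hnorm \<mu> \<eta> z + 1" using Hnorm_nonneg[of \<eta> z] by (simp add: add_nonneg_pos)
qed

text \<open>On the space of weight \<open>\<eta>\<close>, \<open>\<Xi>\<close> is the inner product with \<open>z x = (1 + x) powr (- \<eta>)\<close>, which has the
  value one at \<open>0\<close>.  The squared norm of \<open>z\<close> is \<open>1\<close> plus the integral of \<open>(1 + x) powr (- \<eta>)\<close>, which is finite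
  for \<open>\<eta>\<close> above \<open>eta_star \<mu>\<close>.\<close>
lemma H_functional_Xi:
  assumes "eta_star \<mu> < ereal \<eta>"
  shows "\<exists>c. H_functional \<mu> \<eta> (Xi \<mu>) c"
proof -
  from assms obtain \<eta>0 where e0: "(\<integral>\<^sup>+x. ennreal ((1 + x) powr (- \<eta>0)) \<partial>\<mu>) < \<infinity>" "\<eta>0 < \<eta>"
    unfolding eta_star_def Inf_less_iff by auto
  have m: "(\<lambda>x. (1 + x) powr a) \<in> borel_measurable \<mu>" for a :: real unfolding measurable_mu by measurable
  have "integrable \<mu> (\<lambda>x. (1 + x) powr (- \<eta>0))"
    using e0 m by (intro integrableI_bounded) auto
  then have i: "integrable \<mu> (\<lambda>x. (1 + x) powr (- \<eta>))"
  proof (rule Bochner_Integration.integrable_bound)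
    show "AE x in \<mu>. norm ((1 + x) powr (- \<eta>)) \<le> norm ((1 + x) powr (- \<eta>0))"
      using AE_pos by eventually_elim (use e0 in \<open>auto intro!: powr_mono\<close>)
  qed (rule m)
  define z :: "real \<Rightarrow> real" where "z x = (1 + x) powr (- \<eta>)" for x
  have [measurable]: "z \<in> borel_measurable borel" unfolding z_def by measurable
  have "integrable \<mu> (\<lambda>x. (z x)\<^sup>2 * (1 + x) powr \<eta>) \<longleftrightarrow> integrable \<mu> (\<lambda>x. (1 + x) powr (- \<eta>))"
  proof (rule integrable_cong_AE)
    show "AE x in \<mu>. (z x)\<^sup>2 * (1 + x) powr \<eta> = (1 + x) powr (- \<eta>)"
      using AE_pos by eventually_elim (simp add: z_def power2_eq_square powr_add[symmetric])
  qed (simp_all add: measurable_mu)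
  with i have z: "z \<in> Hsp \<mu> \<eta>" by (simp add: Hsp_def)
  have eq: "Xi \<mu> y = Hinner \<mu> \<eta> y z" if y: "y \<in> Hsp \<mu> \<eta>" for y
  proof -
    have [measurable]: "y \<in> borel_measurable borel" using y HspD by auto
    have "(\<integral>x. y x \<partial>\<mu>) = (\<integral>x. y x * z x * (1 + x) powr \<eta> \<partial>\<mu>)"
    proof (rule integral_cong_AE)
      show "AE x in \<mu>. y x = y x * z x * (1 + x) powr \<eta>"
        using AE_pos by eventually_elim (simp add: z_def powr_add[symmetric])
    qed (simp_all add: measurable_mu)
    then show ?thesis by (simp add: Xi_def Hinner_def z_def)
  qed
  interpret H: H_functional \<mu> \<eta> "\<lambda>y. 1 * Hinner \<mu> \<eta> y z" "\<bar>1\<bar> * Hnorm \<mu> \<eta> z + 1"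
    using z by (intro H_functional_Hinner) auto
  have "H_functional \<mu> \<eta> (Xi \<mu>) (\<bar>1\<bar> * Hnorm \<mu> \<eta> z + 1)"
  proof
    fix y y' a b assume y: "y \<in> Hsp \<mu> \<eta>" "y' \<in> Hsp \<mu> \<eta>"
    show "Xi \<mu> (\<lambda>x. a * y x + b * y' x) = a * Xi \<mu> y + b * Xi \<mu> y'"
      using H.lincomb[OF y, of a b] y by (simp add: eq Hsp_lincomb)
  next
    fix y assume "y \<in> Hsp \<mu> \<eta>"
    then show "\<bar>Xi \<mu> y\<bar> \<le> (\<bar>1\<bar> * Hnorm \<mu> \<eta> z + 1) * Hnorm \<mu> \<eta> y" using H.bound[of y] by (simp add: eq)
  qed (rule H.c_pos)
  then show ?thesis by blast
qed

end

section \<open>Pairing the evolution equation with a functional\<close>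

text \<open>The scalar form of the Ito integral: outside of a set of small probability, \<open>\<l> J\<close> is close to an elementary
  integral whose integrand is close in \<open>L\<^sup>2\<close> to \<open>\<l> \<circ> \<Phi>\<close>.  The approximation is the image under \<open>\<l>\<close> of a simple
  process from the definition of the integral.  For \<open>T = 0\<close> all partition points are \<open>0\<close>, so \<open>I\<close> vanishes.\<close>
lemma (in brownian) ito_integral_approx:
  assumes "H_functional \<mu> \<eta> \<l> c" and ito: "has_ito_integral M F B \<mu> \<eta> T \<Phi> J" and "0 < \<epsilon>"
  shows "\<exists>\<psi> I A. elementary \<psi> I \<and> A \<in> sets M \<and> prob A \<le> \<epsilon> \<and> (T = 0 \<longrightarrow> I = (\<lambda>_. 0)) \<and>
    (\<forall>\<omega>\<in>space M - A. \<bar>\<l> (J \<omega>) - I \<omega>\<bar> \<le> \<epsilon> \<and>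
       (\<lambda>r. indicator {0..<T} r * \<l> (\<Phi> r \<omega>)) \<in> borel_measurable borel \<and>
       (\<integral>\<^sup>+r. ennreal ((indicator {0..<T} r * \<l> (\<Phi> r \<omega>) - \<psi> r \<omega>)\<^sup>2) \<partial>lborel) \<le> ennreal \<epsilon>)"
proof -
  interpret H_functional \<mu> \<eta> \<l> c by fact
  from ito obtain m :: "nat \<Rightarrow> nat" and s :: "nat \<Rightarrow> nat \<Rightarrow> real" and \<phi> :: "nat \<Rightarrow> nat \<Rightarrow> 'a \<Rightarrow> real \<Rightarrow> real"
    where \<Phi>: "(\<lambda>(r, \<omega>). \<Phi> r \<omega>) \<in> measurable (restrict_space borel {0..<T} \<Otimes>\<^sub>M M) (Hborel \<mu> \<eta>)"
      and J: "J \<in> measurable M (Hborel \<mu> \<eta>)"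
      and sp: "\<And>n. simple_process M F \<mu> \<eta> T (m n) (s n) (\<phi> n)"
      and p1: "tends_to_0_in_prob M (\<lambda>n \<omega>. \<integral>\<^sup>+r\<in>{0..<T}.
           ennreal ((Hdist \<mu> \<eta> (\<Phi> r \<omega>) (simple_value (m n) (s n) (\<phi> n) r \<omega>))\<^sup>2) \<partial>lborel)"
      and p2: "tends_to_0_in_prob M
          (\<lambda>n \<omega>. ennreal (Hdist \<mu> \<eta> (J \<omega>) (simple_ito B (m n) (s n) (\<phi> n) \<omega>)))"
    unfolding has_ito_integral_def by blast
  define Z1 where "Z1 n \<omega> = (\<integral>\<^sup>+r\<in>{0..<T}.
      ennreal ((Hdist \<mu> \<eta> (\<Phi> r \<omega>) (simple_value (m n) (s n) (\<phi> n) r \<omega>))\<^sup>2) \<partial>lborel)" for n \<omega>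
  define Z2 where "Z2 n \<omega> = ennreal (Hdist \<mu> \<eta> (J \<omega>) (simple_ito B (m n) (s n) (\<phi> n) \<omega>))" for n \<omega>
  define e1 where "e1 = \<epsilon> / c\<^sup>2"
  define e2 where "e2 = \<epsilon> / c"
  have e: "0 < e1" "0 < e2" using \<open>0 < \<epsilon>\<close> c_pos by (auto simp: e1_def e2_def)
  have [measurable]: "Z1 n \<in> borel_measurable M" "Z2 n \<in> borel_measurable M" for n
    using p1 p2 unfolding tends_to_0_in_prob_def Z1_def Z2_def by auto
  have "(\<lambda>n. prob {\<omega> \<in> space M. ennreal e1 \<le> Z1 n \<omega>}) \<longlonglongrightarrow> 0"
    "(\<lambda>n. prob {\<omega> \<in> space M. ennreal e2 \<le> Z2 n \<omega>}) \<longlonglongrightarrow> 0"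
    using p1 p2 e unfolding tends_to_0_in_prob_def Z1_def Z2_def by auto
  then have "\<forall>\<^sub>F n in sequentially. prob {\<omega> \<in> space M. ennreal e1 \<le> Z1 n \<omega>} < \<epsilon> / 2 \<and>
      prob {\<omega> \<in> space M. ennreal e2 \<le> Z2 n \<omega>} < \<epsilon> / 2"
    using \<open>0 < \<epsilon>\<close> by (intro eventually_conj order_tendstoD(2)) auto
  then obtain n where n: "prob {\<omega> \<in> space M. ennreal e1 \<le> Z1 n \<omega>} < \<epsilon> / 2"
      "prob {\<omega> \<in> space M. ennreal e2 \<le> Z2 n \<omega>} < \<epsilon> / 2"
    by (auto simp: eventually_sequentially)
  define A where "A = {\<omega> \<in> space M. ennreal e1 \<le> Z1 n \<omega>} \<union> {\<omega> \<in> space M. ennreal e2 \<le> Z2 n \<omega>}"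
  have A: "A \<in> sets M" "prob A \<le> \<epsilon>"
  proof -
    show "A \<in> sets M" unfolding A_def by measurable
    have "prob A \<le> prob {\<omega> \<in> space M. ennreal e1 \<le> Z1 n \<omega>} + prob {\<omega> \<in> space M. ennreal e2 \<le> Z2 n \<omega>}"
      unfolding A_def by (rule measure_Un_le) measurable
    then show "prob A \<le> \<epsilon>" using n by simp
  qed
  define \<psi> where "\<psi> r \<omega> = (\<Sum>k<m n. indicator {s n k<..s n (Suc k)} r * \<l> (\<phi> n k \<omega>))" for r \<omega>
  define I where "I \<omega> = (\<Sum>k<m n. \<l> (\<phi> n k \<omega>) * (B (s n (Suc k)) \<omega> - B (s n k) \<omega>))" for \<omega>
  have s: "0 \<le> s n k" "s n k \<le> T" if "k \<le> m n" for k using sp[of n] that by (auto simp: simple_process_def)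
  have s_mono: "s n k \<le> s n (Suc k)" if "k < m n" for k using sp[of n] that by (auto simp: simple_process_def)
  have \<phi>: "\<phi> n k \<in> measurable (F (s n k)) (Hborel \<mu> \<eta>)" if "k < m n" for k
    using sp[of n] that by (auto simp: simple_process_def)
  have \<phi>H: "\<phi> n k \<omega> \<in> Hsp \<mu> \<eta>" if "k < m n" "\<omega> \<in> space M" for k \<omega>
    using measurable_space[OF \<phi>[OF that(1)]] that(2) by (simp add: space_Hborel filtration.space_F[OF filt])
  have "elementary \<psi> I"
    unfolding \<psi>_def I_def
    using s s_mono by (intro elementary_sum elementary.piece measurable_compose[OF \<phi> functional_measurable]) auto
  moreover have "T = 0 \<longrightarrow> I = (\<lambda>_. 0)"
  proof
    assume "T = 0"
    then have "s n k = 0" if "k \<le> m n" for k using s[OF that] by simp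
    then show "I = (\<lambda>_. 0)" unfolding I_def by (intro ext sum.neutral) auto
  qed
  moreover have "\<bar>\<l> (J \<omega>) - I \<omega>\<bar> \<le> \<epsilon> \<and>
       (\<lambda>r. indicator {0..<T} r * \<l> (\<Phi> r \<omega>)) \<in> borel_measurable borel \<and>
       (\<integral>\<^sup>+r. ennreal ((indicator {0..<T} r * \<l> (\<Phi> r \<omega>) - \<psi> r \<omega>)\<^sup>2) \<partial>lborel) \<le> ennreal \<epsilon>"
    if \<omega>: "\<omega> \<in> space M - A" for \<omega>
  proof (intro conjI)
    have JH: "J \<omega> \<in> Hsp \<mu> \<eta>" using measurable_space[OF J] \<omega> by (simp add: space_Hborel)
    have "Z2 n \<omega> < ennreal e2" using \<omega> by (auto simp: A_def)
    then have "Hdist \<mu> \<eta> (J \<omega>) (simple_ito B (m n) (s n) (\<phi> n) \<omega>) < e2"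
      using Hnorm_nonneg by (simp add: Z2_def ennreal_less_iff Hdist_def)
    moreover have "\<l> (simple_ito B (m n) (s n) (\<phi> n) \<omega>) = I \<omega>"
      unfolding simple_ito_def I_def using \<phi>H \<omega> by (subst functional_sum) (auto simp: mult.commute)
    moreover have "simple_ito B (m n) (s n) (\<phi> n) \<omega> \<in> Hsp \<mu> \<eta>"
      unfolding simple_ito_def using \<phi>H \<omega> by (intro Hsp_sum) auto
    ultimately have "\<bar>\<l> (J \<omega>) - I \<omega>\<bar> \<le> c * e2"
      using dist_bound[OF JH, of "simple_ito B (m n) (s n) (\<phi> n) \<omega>"] c_pos
      by (smt (verit) mult_left_mono)
    then show "\<bar>\<l> (J \<omega>) - I \<omega>\<bar> \<le> \<epsilon>" using c_pos by (simp add: e2_def)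
    have "(\<lambda>r. (r, \<omega>)) \<in> measurable (restrict_space borel {0..<T}) (restrict_space borel {0..<T} \<Otimes>\<^sub>M M)"
      using \<omega> by (intro measurable_Pair2') auto
    from measurable_compose[OF this measurable_compose[OF \<Phi> functional_measurable]]
    have "(\<lambda>r. \<l> (\<Phi> r \<omega>)) \<in> borel_measurable (restrict_space borel {0..<T})" by simp
    then show [measurable]: "(\<lambda>r. indicator {0..<T} r * \<l> (\<Phi> r \<omega>)) \<in> borel_measurable borel"
      using borel_measurable_restrict_space_iff[of "{0..<T}" borel "\<lambda>r. \<l> (\<Phi> r \<omega>)"] by simp
    have [measurable]: "(\<lambda>r. \<psi> r \<omega>) \<in> borel_measurable borel" unfolding \<psi>_def by measurable
    have "Z1 n \<omega> < ennreal e1" using \<omega> by (auto simp: A_def)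
    let ?f = "\<lambda>r. (indicator {0..<T} r * \<l> (\<Phi> r \<omega>) - \<psi> r \<omega>)\<^sup>2"
    have "(\<integral>\<^sup>+r. ennreal (?f r) \<partial>lborel) = (\<integral>\<^sup>+r. ennreal (c\<^sup>2) * ennreal (?f r / c\<^sup>2) \<partial>lborel)"
      using c_pos by (intro nn_integral_cong) (simp add: ennreal_mult'[symmetric])
    also have "\<dots> = ennreal (c\<^sup>2) * (\<integral>\<^sup>+r. ennreal (?f r / c\<^sup>2) \<partial>lborel)"
      by (rule nn_integral_cmult) measurable
    also have "(\<integral>\<^sup>+r. ennreal (?f r / c\<^sup>2) \<partial>lborel) \<le> Z1 n \<omega>"
      unfolding Z1_def
    proof (rule nn_integral_mono_AE)
      \<comment> \<open>The step process may be nonzero at \<open>r = T\<close>, where \<open>\<Phi>\<close> is ignored.\<close>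
      have "AE r in lborel. r \<noteq> T" by (rule AE_lborel_singleton)
      then show "AE r in lborel. ennreal (?f r / c\<^sup>2) \<le>
          ennreal ((Hdist \<mu> \<eta> (\<Phi> r \<omega>) (simple_value (m n) (s n) (\<phi> n) r \<omega>))\<^sup>2) * indicator {0..<T} r"
      proof eventually_elim
        fix r assume "r \<noteq> T"
        show "ennreal (?f r / c\<^sup>2) \<le>
          ennreal ((Hdist \<mu> \<eta> (\<Phi> r \<omega>) (simple_value (m n) (s n) (\<phi> n) r \<omega>))\<^sup>2) * indicator {0..<T} r"
        proof (cases "r \<in> {0..<T}")
          case True
          have "(r, \<omega>) \<in> space (restrict_space borel {0..<T} \<Otimes>\<^sub>M M)"
            using \<omega> True by (auto simp: space_pair_measure space_restrict_space)
          from measurable_space[OF \<Phi> this] have \<Phi>H: "\<Phi> r \<omega> \<in> Hsp \<mu> \<eta>" by (simp add: space_Hborel)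
          have v: "simple_value (m n) (s n) (\<phi> n) r \<omega> \<in> Hsp \<mu> \<eta>"
            unfolding simple_value_def using \<phi>H \<omega> by (intro Hsp_sum) auto
          have "\<l> (simple_value (m n) (s n) (\<phi> n) r \<omega>) = \<psi> r \<omega>"
            unfolding simple_value_def \<psi>_def using \<phi>H \<omega> by (subst functional_sum) auto
          then have "\<bar>\<l> (\<Phi> r \<omega>) - \<psi> r \<omega>\<bar> \<le> c * Hdist \<mu> \<eta> (\<Phi> r \<omega>) (simple_value (m n) (s n) (\<phi> n) r \<omega>)"
            using dist_bound[OF \<Phi>H v] by simp
          then have "\<bar>\<l> (\<Phi> r \<omega>) - \<psi> r \<omega>\<bar>\<^sup>2 \<le> (c * Hdist \<mu> \<eta> (\<Phi> r \<omega>) (simple_value (m n) (s n) (\<phi> n) r \<omega>))\<^sup>2"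
            by (intro power_mono) auto
          then have "?f r / c\<^sup>2 \<le> (Hdist \<mu> \<eta> (\<Phi> r \<omega>) (simple_value (m n) (s n) (\<phi> n) r \<omega>))\<^sup>2"
            using True c_pos by (simp add: power_mult_distrib field_simps)
          then show ?thesis using True by (simp add: ennreal_leI)
        next
          case False
          have "indicator {s n k<..s n (Suc k)} r = (0::real)" if "k < m n" for k
            using s[of k] s[of "Suc k"] that False \<open>r \<noteq> T\<close> by (auto simp: indicator_def)
          then have "\<psi> r \<omega> = 0" unfolding \<psi>_def by (intro sum.neutral) auto
          then show ?thesis using False by simp
        qed
      qed
    qed
    also have "Z1 n \<omega> \<le> ennreal e1" using \<omega> by (auto simp: A_def)
    finally have "(\<integral>\<^sup>+r. ennreal (?f r) \<partial>lborel) \<le> ennreal (c\<^sup>2) * ennreal e1"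
      by (simp add: mult_left_mono)
    also have "\<dots> = ennreal \<epsilon>"
      using c_pos \<open>0 < \<epsilon>\<close> by (simp add: ennreal_mult'[symmetric] e1_def)
    finally show "(\<integral>\<^sup>+r. ennreal (?f r) \<partial>lborel) \<le> ennreal \<epsilon>" .
  qed
  ultimately show ?thesis using A by blast
qed

lemma condition_A_measure:
  assumes "condition_A K Kinf \<mu>"
  shows "half_line_measure \<mu>" and "sigma_finite_measure \<mu>"
proof -
  have sets: "sets \<mu> = sets borel" and null: "emeasure \<mu> {..0} = 0"
    and ex: "integrable \<mu> (\<lambda>x. exp (- x * 1))"
    using assms unfolding condition_A_def by (auto dest: spec[of _ 1])
  show "half_line_measure \<mu>" by unfold_locales (fact sets, fact null)
  have fin: "emeasure \<mu> {..real n} < \<infinity>" for n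
  proof -
    have "emeasure \<mu> {..real n} = (\<integral>\<^sup>+x. indicator {..real n} x \<partial>\<mu>)" using sets by simp
    also have "\<dots> \<le> (\<integral>\<^sup>+x. ennreal (exp (real n)) * ennreal (exp (- x * 1)) \<partial>\<mu>)"
      by (intro nn_integral_mono) (auto simp: indicator_def ennreal_mult'[symmetric] exp_add[symmetric]
          ennreal_1[symmetric] simp del: ennreal_1 intro!: ennreal_leI)
    also have "\<dots> = ennreal (exp (real n)) * (\<integral>\<^sup>+x. ennreal (exp (- x * 1)) \<partial>\<mu>)"
      using borel_measurable_integrable[OF ex] by (intro nn_integral_cmult) auto
    also have "\<dots> < \<infinity>"
      using ex by (auto simp: integrable_iff_bounded ennreal_mult_less_top)
    finally show ?thesis .
  qed
  show "sigma_finite_measure \<mu>"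
  proof
    show "\<exists>A. countable A \<and> A \<subseteq> sets \<mu> \<and> \<Union>A = space \<mu> \<and> (\<forall>a\<in>A. emeasure \<mu> a \<noteq> \<infinity>)"
    proof (intro exI[of _ "range (\<lambda>n. {..real n})"] conjI)
      have "\<exists>n. x \<le> real n" for x by (rule real_arch_simple)
      then show "\<Union>(range (\<lambda>n. {..real n})) = space \<mu>" using sets_eq_imp_space_eq[OF sets] by auto
    qed (use sets fin in \<open>auto simp: less_top[symmetric]\<close>)
  qed
qed

lemma Hinner_Sg_xiK_measurable:
  assumes "sigma_finite_measure \<mu>" "half_line_measure \<mu>" "z \<in> borel_measurable borel"
  shows "(\<lambda>r. Hinner \<mu> \<eta> (Sg r (xiK Kinf)) z) \<in> borel_measurable borel"
proof -
  interpret sigma_finite_measure \<mu> by fact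
  interpret half_line_measure \<mu> by fact
  note [measurable] = assms(3)
  have [measurable_cong]: "sets \<mu> = sets borel" by (rule sets_mu)
  have [measurable]: "(\<lambda>r. \<integral>x. exp (- r * x) * (indicator {0<..} x + Kinf * indicator {0} x) * z x * (1 + x) powr \<eta> \<partial>\<mu>)
      \<in> borel_measurable borel"
    by (rule borel_measurable_lebesgue_integral) measurable
  show ?thesis unfolding Hinner_def Sg_def xiK_def by measurable
qed

lemma Hinner_scale_left: "Hinner \<mu> \<eta> (\<lambda>x. y x * s) z = Hinner \<mu> \<eta> y z * s"
proof -
  have "(\<integral>x. y x * s * z x * (1 + x) powr \<eta> \<partial>\<mu>) = (\<integral>x. s * (y x * z x * (1 + x) powr \<eta>) \<partial>\<mu>)"
    by (rule Bochner_Integration.integral_cong) auto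
  then show ?thesis by (simp add: Hinner_def algebra_simps)
qed

lemma weak_solution_brownian:
  "weak_solution \<mu> Kinf b \<sigma> \<xi> \<eta> M F B X \<Longrightarrow> brownian M F B"
  unfolding weak_solution_def filtered_prob_space_def brownian_def brownian_axioms_def by blast

text \<open>The scalar equation satisfied by a functional of the solution.  Subtracting the initial term inside of \<open>\<l>\<close>
  needs it to lie in the state space; it does, being the difference of elements of that space.\<close>
lemma weak_solution_functional:
  assumes ws: "weak_solution \<mu> Kinf b \<sigma> \<xi> \<eta> M F B X" and "half_line_measure \<mu>"
    and \<xi>: "\<xi> \<in> borel_measurable borel" and t: "0 \<le> t"
  obtains D J where "Sg t \<xi> \<in> Hsp \<mu> \<eta>"
    "AE \<omega> in M. has_H_integral \<mu> \<eta> (restrict_space lborel {0..<t})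
       (\<lambda>s x. Sg (t - s) (xiK Kinf) x * b (Xi \<mu> (X s \<omega>))) (D \<omega>)"
    "has_ito_integral M F B \<mu> \<eta> t (\<lambda>s \<omega> x. Sg (t - s) (xiK Kinf) x * \<sigma> (Xi \<mu> (X s \<omega>))) J"
    "\<And>\<l> c. H_functional \<mu> \<eta> \<l> c \<Longrightarrow>
       AE \<omega> in M. \<l> (\<lambda>x. X t \<omega> x - Sg t \<xi> x) = \<l> (D \<omega>) + \<l> (J \<omega>)"
proof -
  interpret half_line_measure \<mu> by fact
  interpret brownian M F B using ws by (rule weak_solution_brownian)
  from ws t obtain D J :: "'a \<Rightarrow> real \<Rightarrow> real" where
    D: "AE \<omega> in M. has_H_integral \<mu> \<eta> (restrict_space lborel {0..<t})
       (\<lambda>s x. Sg (t - s) (xiK Kinf) x * b (Xi \<mu> (X s \<omega>))) (D \<omega>)"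
    and J: "has_ito_integral M F B \<mu> \<eta> t (\<lambda>s \<omega> x. Sg (t - s) (xiK Kinf) x * \<sigma> (Xi \<mu> (X s \<omega>))) J"
    and eq: "AE \<omega> in M. Heq \<mu> (X t \<omega>) (\<lambda>x. Sg t \<xi> x + D \<omega> x + J \<omega> x)"
    unfolding weak_solution_def by blast
  have Xm: "X t \<in> measurable M (Hborel \<mu> \<eta>)"
    using ws t measurable_ambient unfolding weak_solution_def by blast
  have XH: "X t \<omega> \<in> Hsp \<mu> \<eta>" if "\<omega> \<in> space M" for \<omega>
    using measurable_space[OF Xm that] by (simp add: space_Hborel)
  have Jm: "J \<in> measurable M (Hborel \<mu> \<eta>)" using J by (simp add: has_ito_integral_def)
  have JH: "J \<omega> \<in> Hsp \<mu> \<eta>" if "\<omega> \<in> space M" for \<omega>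
    using measurable_space[OF Jm that] by (simp add: space_Hborel)
  have DH: "AE \<omega> in M. D \<omega> \<in> Hsp \<mu> \<eta>"
    using D by eventually_elim (simp add: has_H_integral_def)
  have "AE \<omega> in M. Sg t \<xi> \<in> Hsp \<mu> \<eta>"
    using eq DH AE_space
  proof eventually_elim
    fix \<omega> assume h: "Heq \<mu> (X t \<omega>) (\<lambda>x. Sg t \<xi> x + D \<omega> x + J \<omega> x)" "D \<omega> \<in> Hsp \<mu> \<eta>" "\<omega> \<in> space M"
    have "(\<lambda>x. X t \<omega> x - D \<omega> x - J \<omega> x) \<in> Hsp \<mu> \<eta>"
      using h XH JH by (intro Hsp_diff) auto
    moreover have "Sg t \<xi> \<in> borel_measurable borel" unfolding Sg_def using \<xi> by measurable
    moreover have "AE x in \<mu>. X t \<omega> x - D \<omega> x - J \<omega> x = Sg t \<xi> x"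
      using h(1) by (auto simp: Heq_def)
    ultimately show "Sg t \<xi> \<in> Hsp \<mu> \<eta>" by (rule Hsp_AE_cong)
  qed
  then have S: "Sg t \<xi> \<in> Hsp \<mu> \<eta>" by simp
  show thesis
  proof (rule that[OF S D J])
    fix \<l> c assume "H_functional \<mu> \<eta> \<l> c"
    then interpret H_functional \<mu> \<eta> \<l> c .
    show "AE \<omega> in M. \<l> (\<lambda>x. X t \<omega> x - Sg t \<xi> x) = \<l> (D \<omega>) + \<l> (J \<omega>)"
      using eq DH AE_space
    proof eventually_elim
      fix \<omega> assume h: "Heq \<mu> (X t \<omega>) (\<lambda>x. Sg t \<xi> x + D \<omega> x + J \<omega> x)" "D \<omega> \<in> Hsp \<mu> \<eta>" "\<omega> \<in> space M"
      have "\<l> (\<lambda>x. X t \<omega> x - Sg t \<xi> x) = \<l> (\<lambda>x. D \<omega> x + J \<omega> x)"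
        using h XH JH S by (intro functional_Heq Hsp_diff Hsp_add) (auto simp: Heq_def)
      then show "\<l> (\<lambda>x. X t \<omega> x - Sg t \<xi> x) = \<l> (D \<omega>) + \<l> (J \<omega>)"
        using functional_add h JH by simp
    qed
  qed
qed

text \<open>Over an empty time interval the approximating elementary integrals vanish.\<close>
lemma (in brownian) ito_integral_zero_time:
  assumes "H_functional \<mu> \<eta> \<l> c" "has_ito_integral M F B \<mu> \<eta> 0 \<Phi> J"
  shows "AE \<omega> in M. \<l> (J \<omega>) = 0"
proof -
  have "AE \<omega> in M. \<bar>\<l> (J \<omega>)\<bar> \<le> 1 / real (Suc k)" for k
  proof -
    interpret H_functional \<mu> \<eta> \<l> c by fact
    have [measurable]: "(\<lambda>\<omega>. \<l> (J \<omega>)) \<in> borel_measurable M"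
      using assms(2) functional_measurable measurable_compose unfolding has_ito_integral_def by blast
    define p where "p = prob {\<omega> \<in> space M. \<not> \<bar>\<l> (J \<omega>)\<bar> \<le> 1 / real (Suc k)}"
    have small: "p \<le> \<epsilon>" if "0 < \<epsilon>" for \<epsilon>
    proof -
      define \<epsilon>' where "\<epsilon>' = min \<epsilon> (1 / real (Suc k))"
      have "0 < \<epsilon>'" using that by (simp add: \<epsilon>'_def)
      from ito_integral_approx[OF assms this] obtain A where A: "A \<in> sets M" "prob A \<le> \<epsilon>'"
        "\<And>\<omega>. \<omega> \<in> space M - A \<Longrightarrow> \<bar>\<l> (J \<omega>)\<bar> \<le> \<epsilon>'" by auto
      have "p \<le> prob A"
        unfolding p_def using A(1) A(3) by (intro finite_measure_mono) (force simp: \<epsilon>'_def)+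
      also have "\<dots> \<le> \<epsilon>" using A(2) by (simp add: \<epsilon>'_def)
      finally show ?thesis .
    qed
    have "p = 0"
    proof (rule ccontr)
      assume "p \<noteq> 0"
      then have "0 < p / 2" unfolding p_def by (simp add: zero_less_measure_iff)
      from small[OF this] this show False by linarith
    qed
    then show ?thesis
      by (intro AE_I'[of "{\<omega> \<in> space M. \<not> \<bar>\<l> (J \<omega>)\<bar> \<le> 1 / real (Suc k)}"])
         (auto simp: null_sets_def emeasure_eq_measure p_def)
  qed
  then have "AE \<omega> in M. \<forall>k. \<bar>\<l> (J \<omega>)\<bar> \<le> 1 / real (Suc k)" by (simp add: AE_all_countable)
  then show ?thesis
  proof eventually_elim
    fix \<omega> assume h: "\<forall>k. \<bar>\<l> (J \<omega>)\<bar> \<le> 1 / real (Suc k)"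
    have "(\<lambda>k. 1 / real (Suc k)) \<longlonglongrightarrow> 0"
      using LIMSEQ_inverse_real_of_nat by (simp add: inverse_eq_divide)
    from LIMSEQ_le_const[OF this] h have "\<bar>\<l> (J \<omega>)\<bar> \<le> 0" by blast
    then show "\<l> (J \<omega>) = 0" by simp
  qed
qed

text \<open>At time \<open>0\<close> both integrals range over an empty interval, so the equation forces the solution to start
  at \<open>\<xi>\<close>; the rest is continuity of the paths and of \<open>\<Xi>\<close>.\<close>
lemma weak_solution_initial_Xi:
  assumes ws: "weak_solution \<mu> Kinf b \<sigma> \<xi> \<eta> M F B X" and "half_line_measure \<mu>"
    and \<xi>: "\<xi> \<in> borel_measurable borel" and \<eta>: "eta_star \<mu> < ereal \<eta>"
  shows "AE \<omega> in M. ((\<lambda>s. Xi \<mu> (X s \<omega>)) \<longlongrightarrow> Xi \<mu> \<xi>) (at 0 within {0..}) \<and> Xi \<mu> (X 0 \<omega>) = Xi \<mu> \<xi>"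
proof -
  interpret half_line_measure \<mu> by fact
  interpret brownian M F B using ws by (rule weak_solution_brownian)
  from H_functional_Xi[OF \<eta>] obtain c where c: "H_functional \<mu> \<eta> (Xi \<mu>) c" by blast
  then interpret H_functional \<mu> \<eta> "Xi \<mu>" c .
  have Xm: "X t \<in> measurable M (Hborel \<mu> \<eta>)" if "0 \<le> t" for t
    using ws that measurable_ambient unfolding weak_solution_def by blast
  have XH: "X t \<omega> \<in> Hsp \<mu> \<eta>" if "\<omega> \<in> space M" "0 \<le> t" for t \<omega>
    using measurable_space[OF Xm that(1)] that by (simp add: space_Hborel)
  obtain D J where DJ: "Sg 0 \<xi> \<in> Hsp \<mu> \<eta>"
    "AE \<omega> in M. has_H_integral \<mu> \<eta> (restrict_space lborel {0..<0})
       (\<lambda>s x. Sg (0 - s) (xiK Kinf) x * b (Xi \<mu> (X s \<omega>))) (D \<omega>)"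
    "has_ito_integral M F B \<mu> \<eta> 0 (\<lambda>s \<omega> x. Sg (0 - s) (xiK Kinf) x * \<sigma> (Xi \<mu> (X s \<omega>))) J"
    "\<And>\<l> c. H_functional \<mu> \<eta> \<l> c \<Longrightarrow> AE \<omega> in M. \<l> (\<lambda>x. X 0 \<omega> x - Sg 0 \<xi> x) = \<l> (D \<omega>) + \<l> (J \<omega>)"
    by (rule weak_solution_functional[OF ws assms(2) \<xi> order_refl]) (rule that)
  have D0: "AE \<omega> in M. Xi \<mu> (D \<omega>) = 0"
    using DJ(2)
  proof eventually_elim
    fix \<omega> assume "has_H_integral \<mu> \<eta> (restrict_space lborel {0..<0})
       (\<lambda>s x. Sg (0 - s) (xiK Kinf) x * b (Xi \<mu> (X s \<omega>))) (D \<omega>)"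
    from H_integral_bound[OF this] show "Xi \<mu> (D \<omega>) = 0"
      by (simp add: nn_integral_restrict_space)
  qed
  show ?thesis
    using DJ(4)[OF c] D0 ito_integral_zero_time[OF c DJ(3)] AE_space
  proof eventually_elim
    fix \<omega> assume h: "Xi \<mu> (\<lambda>x. X 0 \<omega> x - Sg 0 \<xi> x) = Xi \<mu> (D \<omega>) + Xi \<mu> (J \<omega>)"
      "Xi \<mu> (D \<omega>) = 0" "Xi \<mu> (J \<omega>) = 0" "\<omega> \<in> space M"
    have "Sg 0 \<xi> = \<xi>" by (simp add: Sg_def)
    then have eq: "Xi \<mu> (X 0 \<omega>) = Xi \<mu> \<xi>"
      using h functional_diff[OF XH DJ(1), of \<omega> 0] by simp
    have "((\<lambda>s. Hdist \<mu> \<eta> (X s \<omega>) (X 0 \<omega>)) \<longlongrightarrow> 0) (at 0 within {0..})"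
      using ws h(4) unfolding weak_solution_def by auto
    from tendsto_mult_left[OF this, of c]
    have lim: "((\<lambda>s. c * Hdist \<mu> \<eta> (X s \<omega>) (X 0 \<omega>)) \<longlongrightarrow> 0) (at 0 within {0..})" by simp
    have "\<forall>\<^sub>F s in at 0 within {0..}. norm (Xi \<mu> (X s \<omega>) - Xi \<mu> (X 0 \<omega>)) \<le> c * Hdist \<mu> \<eta> (X s \<omega>) (X 0 \<omega>)"
      unfolding eventually_at_filter
      using dist_bound[OF XH XH, of \<omega> _ \<omega> 0] h(4) by (intro always_eventually) auto
    from Lim_null_comparison[OF this lim]
    have "((\<lambda>s. Xi \<mu> (X s \<omega>)) \<longlongrightarrow> Xi \<mu> (X 0 \<omega>)) (at 0 within {0..})"
      by (simp add: LIM_zero_iff)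
    then show "((\<lambda>s. Xi \<mu> (X s \<omega>)) \<longlongrightarrow> Xi \<mu> \<xi>) (at 0 within {0..}) \<and> Xi \<mu> (X 0 \<omega>) = Xi \<mu> \<xi>"
      using eq by simp
  qed
qed

section \<open>Small times\<close>

lemma holder_isCont:
  assumes "holder a f" "0 < a"
  shows "isCont f x"
proof -
  from assms(1) obtain C where C: "\<And>x y. \<bar>f x - f y\<bar> \<le> C * \<bar>x - y\<bar> powr a" by (auto simp: holder_def)
  have "((\<lambda>y. C * \<bar>y - x\<bar> powr a) \<longlongrightarrow> C * 0 powr a) (at x)"
    by (rule tendsto_eq_intros tendsto_powr2 | use assms in \<open>auto intro!: tendsto_eq_intros\<close>)+
  then have "((\<lambda>y. C * \<bar>y - x\<bar> powr a) \<longlongrightarrow> 0) (at x)" using assms by simp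
  then have "((\<lambda>y. f y - f x) \<longlongrightarrow> 0) (at x)"
    by (rule Lim_null_comparison[rotated]) (use C in auto)
  then show ?thesis using LIM_zero_iff isCont_def by blast
qed

lemma ennreal_tendsto_0I:
  fixes f :: "nat \<Rightarrow> ennreal"
  assumes "\<And>e::real. 0 < e \<Longrightarrow> \<forall>\<^sub>F n in sequentially. f n \<le> ennreal e"
  shows "f \<longlonglongrightarrow> 0"
proof (rule order_tendstoI)
  fix a :: ennreal assume "0 < a"
  then obtain e where e: "0 < e" "e < a" using dense by blast
  then have "e < \<top>" by (metis less_top order_less_le_trans top_greatest)
  then obtain r where r: "e = ennreal r" "0 \<le> r" by (metis ennreal_cases less_irrefl infinity_ennreal_def)
  with e have "0 < r" by (auto simp: less_le)
  from assms[OF this] show "\<forall>\<^sub>F n in sequentially. f n < a"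
    by eventually_elim (use e r in auto)
qed simp

text \<open>Over shrinking time windows the normalised increment is asymptotically an elementary integral with the
  deterministic integrand \<open>\<sigma> (\<Xi> \<xi>) * k n\<close>.  Freezing \<open>\<sigma> (\<Xi> X)\<close> at its initial value costs, in \<open>L\<^sup>2\<close>, at
  most the supremum of its deviation from that value over the window times the norm of \<open>k n\<close>.  The norms are
  bounded, and the suprema vanish because \<open>\<Xi> X\<close> is continuous at time \<open>0\<close>.\<close>
lemma small_time_approximation:
  fixes a T :: "nat \<Rightarrow> real" and \<eta> R Kinf :: real and z :: "real \<Rightarrow> real" and \<mu> :: "real measure"
  assumes ws: "weak_solution \<mu> Kinf b \<sigma> \<xi> \<eta>' M F B X" and hl: "half_line_measure \<mu>"
    and \<xi>: "\<xi> \<in> borel_measurable borel" and \<eta>': "eta_star \<mu> < ereal \<eta>'"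
    and "\<eta> \<le> \<eta>'" and z: "z \<in> Hsp \<mu> \<eta>"
    and b: "isCont b (Xi \<mu> \<xi>)" and \<sigma>: "isCont \<sigma> (Xi \<mu> \<xi>)"
    and T: "\<And>n. 0 \<le> T n" "T \<longlonglongrightarrow> 0"
  defines "k \<equiv> \<lambda>n r. a n * Hinner \<mu> \<eta> (Sg (T n - r) (xiK Kinf)) z * indicator {0..<T n} r"
  assumes k: "\<And>n. k n \<in> borel_measurable borel"
    and ki: "\<forall>\<^sub>F n in sequentially. integrable lborel (\<lambda>r. (k n r)\<^sup>2)"
    and kR: "(\<lambda>n. \<integral>r. (k n r)\<^sup>2 \<partial>lborel) \<longlonglongrightarrow> R"
  shows "\<exists>\<psi> I. (\<forall>n. brownian.elementary F B (\<psi> n) (I n)) \<and>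
     (AE \<omega> in M. (\<lambda>n. \<integral>\<^sup>+r. ennreal ((\<psi> n r \<omega> - \<sigma> (Xi \<mu> \<xi>) * k n r)\<^sup>2) \<partial>lborel) \<longlonglongrightarrow> 0 \<and>
        (\<lambda>n. a n * Hinner \<mu> \<eta> (\<lambda>x. X (T n) \<omega> x - Sg (T n) \<xi> x) z - I n \<omega>) \<longlonglongrightarrow> 0)"
proof -
  interpret half_line_measure \<mu> by fact
  interpret brownian M F B using ws by (rule weak_solution_brownian)
  define s0 where "s0 = \<sigma> (Xi \<mu> \<xi>)"
  define \<l> where "\<l> n y = a n * Hinner \<mu> \<eta> y z" for n y
  define c where "c n = \<bar>a n\<bar> * Hnorm \<mu> \<eta> z + 1" for n
  have H: "H_functional \<mu> \<eta>' (\<l> n) (c n)" for n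
    unfolding \<l>_def c_def using \<open>\<eta> \<le> \<eta>'\<close> z by (rule H_functional_Hinner)
  define PD where "PD n D J \<longleftrightarrow> (AE \<omega> in M. has_H_integral \<mu> \<eta>' (restrict_space lborel {0..<T n})
       (\<lambda>s x. Sg (T n - s) (xiK Kinf) x * b (Xi \<mu> (X s \<omega>))) (D \<omega>)) \<and>
    has_ito_integral M F B \<mu> \<eta>' (T n) (\<lambda>s \<omega> x. Sg (T n - s) (xiK Kinf) x * \<sigma> (Xi \<mu> (X s \<omega>))) J \<and>
    (AE \<omega> in M. \<l> n (\<lambda>x. X (T n) \<omega> x - Sg (T n) \<xi> x) = \<l> n (D \<omega>) + \<l> n (J \<omega>))" for n D J
  have "\<exists>D J. PD n D J" for n
    unfolding PD_def by (rule weak_solution_functional[OF ws hl \<xi> T(1)]) (use H in blast)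
  then obtain D J where PD: "\<And>n. PD n (D n) (J n)" by metis
  have D: "AE \<omega> in M. has_H_integral \<mu> \<eta>' (restrict_space lborel {0..<T n})
       (\<lambda>s x. Sg (T n - s) (xiK Kinf) x * b (Xi \<mu> (X s \<omega>))) (D n \<omega>)"
    and J: "has_ito_integral M F B \<mu> \<eta>' (T n) (\<lambda>s \<omega> x. Sg (T n - s) (xiK Kinf) x * \<sigma> (Xi \<mu> (X s \<omega>))) (J n)"
    and DJ: "AE \<omega> in M. \<l> n (\<lambda>x. X (T n) \<omega> x - Sg (T n) \<xi> x) = \<l> n (D n \<omega>) + \<l> n (J n \<omega>)" for n
    using PD[of n] unfolding PD_def by blast+
  have lk: "indicator {0..<T n} r * \<l> n (\<lambda>x. Sg (T n - r) (xiK Kinf) x * s) = k n r * s" for n r s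
    by (simp add: \<l>_def k_def Hinner_scale_left)
  define P where "P n \<psi> I A \<longleftrightarrow> elementary \<psi> I \<and> A \<in> sets M \<and> prob A \<le> (1 / 2) ^ n \<and>
    (\<forall>\<omega>\<in>space M - A. \<bar>\<l> n (J n \<omega>) - I \<omega>\<bar> \<le> (1 / 2) ^ n \<and>
       (\<lambda>r. k n r * \<sigma> (Xi \<mu> (X r \<omega>))) \<in> borel_measurable borel \<and>
       (\<integral>\<^sup>+r. ennreal ((k n r * \<sigma> (Xi \<mu> (X r \<omega>)) - \<psi> r \<omega>)\<^sup>2) \<partial>lborel) \<le> ennreal ((1 / 2) ^ n))" for n \<psi> I A
  have "\<exists>\<psi> I A. P n \<psi> I A" for n
  proof -
    have "0 < (1 / 2 :: real) ^ n" by simp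
    from ito_integral_approx[OF H[of n] J[of n] this, unfolded lk] show ?thesis
      unfolding P_def by blast
  qed
  then obtain \<psi> I A where PA: "\<And>n. P n (\<psi> n) (I n) (A n)" by metis
  have el: "elementary (\<psi> n) (I n)" for n using PA by (simp add: P_def)
  have "AE \<omega> in M. \<forall>\<^sub>F n in sequentially. \<omega> \<in> space M - A n"
  proof (rule borel_cantelli_AE1)
    show "A n \<in> sets M" "emeasure M (A n) < \<infinity>" for n using PA by (auto simp: P_def emeasure_eq_measure)
    have "summable (\<lambda>n. (1 / 2 :: real) ^ n)" by (rule summable_geometric) simp
    then show "summable (\<lambda>n. prob (A n))"
      by (rule summable_comparison_test'[where N=0]) (use PA in \<open>simp add: P_def\<close>)
  qed
  moreover have "AE \<omega> in M. \<forall>n. has_H_integral \<mu> \<eta>' (restrict_space lborel {0..<T n})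
       (\<lambda>s x. Sg (T n - s) (xiK Kinf) x * b (Xi \<mu> (X s \<omega>))) (D n \<omega>)"
    using D by (simp add: AE_all_countable)
  moreover have "AE \<omega> in M. \<forall>n. \<l> n (\<lambda>x. X (T n) \<omega> x - Sg (T n) \<xi> x) = \<l> n (D n \<omega>) + \<l> n (J n \<omega>)"
    using DJ by (simp add: AE_all_countable)
  ultimately have "AE \<omega> in M. (\<lambda>n. \<integral>\<^sup>+r. ennreal ((\<psi> n r \<omega> - s0 * k n r)\<^sup>2) \<partial>lborel) \<longlonglongrightarrow> 0 \<and>
      (\<lambda>n. \<l> n (\<lambda>x. X (T n) \<omega> x - Sg (T n) \<xi> x) - I n \<omega>) \<longlonglongrightarrow> 0"
    using weak_solution_initial_Xi[OF ws hl \<xi> \<eta>'] AE_space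
  proof eventually_elim
    fix \<omega>
    assume ev: "\<forall>\<^sub>F n in sequentially. \<omega> \<in> space M - A n"
      and D: "\<forall>n. has_H_integral \<mu> \<eta>' (restrict_space lborel {0..<T n})
       (\<lambda>s x. Sg (T n - s) (xiK Kinf) x * b (Xi \<mu> (X s \<omega>))) (D n \<omega>)"
      and DJ: "\<forall>n. \<l> n (\<lambda>x. X (T n) \<omega> x - Sg (T n) \<xi> x) = \<l> n (D n \<omega>) + \<l> n (J n \<omega>)"
      and Xi0: "((\<lambda>s. Xi \<mu> (X s \<omega>)) \<longlongrightarrow> Xi \<mu> \<xi>) (at 0 within {0..}) \<and> Xi \<mu> (X 0 \<omega>) = Xi \<mu> \<xi>"
      and \<omega>: "\<omega> \<in> space M"
    have near: "\<forall>\<^sub>F n in sequentially. \<forall>r\<in>{0..<T n}. \<bar>f (Xi \<mu> (X r \<omega>)) - f (Xi \<mu> \<xi>)\<bar> \<le> \<delta>"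
      if f: "isCont f (Xi \<mu> \<xi>)" and "0 < \<delta>" for f :: "real \<Rightarrow> real" and \<delta>
    proof -
      have "((\<lambda>s. f (Xi \<mu> (X s \<omega>))) \<longlongrightarrow> f (Xi \<mu> \<xi>)) (at 0 within {0..})"
        using f Xi0 by (intro isCont_tendsto_compose[OF f]) auto
      then have "\<forall>\<^sub>F s in at 0 within {0..}. \<bar>f (Xi \<mu> (X s \<omega>)) - f (Xi \<mu> \<xi>)\<bar> < \<delta>"
        using \<open>0 < \<delta>\<close> by (auto simp: tendsto_iff dist_real_def)
      then obtain h where h: "0 < h" "\<And>s. 0 < s \<Longrightarrow> s < h \<Longrightarrow> \<bar>f (Xi \<mu> (X s \<omega>)) - f (Xi \<mu> \<xi>)\<bar> < \<delta>"
        unfolding eventually_at by (auto simp: dist_real_def)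
      have "\<forall>\<^sub>F n in sequentially. T n < h" using T(2) h(1) by (rule order_tendstoD(2))
      then show ?thesis
      proof eventually_elim
        fix n assume "T n < h"
        show "\<forall>r\<in>{0..<T n}. \<bar>f (Xi \<mu> (X r \<omega>)) - f (Xi \<mu> \<xi>)\<bar> \<le> \<delta>"
        proof
          fix r assume r: "r \<in> {0..<T n}"
          show "\<bar>f (Xi \<mu> (X r \<omega>)) - f (Xi \<mu> \<xi>)\<bar> \<le> \<delta>"
          proof (cases "r = 0")
            case True then show ?thesis using Xi0 \<open>0 < \<delta>\<close> by simp
          next
            case False
            with r \<open>T n < h\<close> have "\<bar>f (Xi \<mu> (X r \<omega>)) - f (Xi \<mu> \<xi>)\<bar> < \<delta>" by (intro h(2)) auto
            then show ?thesis by simp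
          qed
        qed
      qed
    qed
    have R0: "0 \<le> R" by (rule LIMSEQ_le_const[OF kR]) auto
    have evR: "\<forall>\<^sub>F n in sequentially. (\<integral>r. (k n r)\<^sup>2 \<partial>lborel) < R + 1"
      using kR by (rule order_tendstoD(2)) simp
    have half: "\<forall>\<^sub>F n in sequentially. (1 / 2 :: real) ^ n < e" if "0 < e" for e
      using that by (intro order_tendstoD(2)[OF LIMSEQ_realpow_zero]) auto
    have k0: "k n r = 0" if "r \<notin> {0..<T n}" for n r using that by (simp add: k_def)
    have c1: "(\<lambda>n. \<integral>\<^sup>+r. ennreal ((\<psi> n r \<omega> - s0 * k n r)\<^sup>2) \<partial>lborel) \<longlonglongrightarrow> 0"
    proof (rule ennreal_tendsto_0I)
      fix e :: real assume e: "0 < e"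
      \<comment> \<open>The tolerance for which \<open>2 * \<delta>\<^sup>2 * (R + 1) = e / 2\<close>.\<close>
      define \<delta> where "\<delta> = sqrt (e / (4 * (R + 1)))"
      have \<delta>: "0 < \<delta>" "\<delta>\<^sup>2 = e / (4 * (R + 1))" using e R0 by (auto simp: \<delta>_def)
      have "0 < e / 4" using e by simp
      from ev near[OF \<sigma> \<delta>(1)] evR half[OF this] ki
      show "\<forall>\<^sub>F n in sequentially. (\<integral>\<^sup>+r. ennreal ((\<psi> n r \<omega> - s0 * k n r)\<^sup>2) \<partial>lborel) \<le> ennreal e"
      proof eventually_elim
        fix n assume A: "\<omega> \<in> space M - A n"
          and n: "\<forall>r\<in>{0..<T n}. \<bar>\<sigma> (Xi \<mu> (X r \<omega>)) - \<sigma> (Xi \<mu> \<xi>)\<bar> \<le> \<delta>"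
          and R: "(\<integral>r. (k n r)\<^sup>2 \<partial>lborel) < R + 1" and h: "(1 / 2) ^ n < e / 4"
          and i: "integrable lborel (\<lambda>r. (k n r)\<^sup>2)"
        note [measurable] = k[of n] elementary_char_estimate(4)[OF el, of n \<omega>]
        define f where "f r = k n r * \<sigma> (Xi \<mu> (X r \<omega>))" for r
        have f[measurable]: "f \<in> borel_measurable borel"
          and fb: "(\<integral>\<^sup>+r. ennreal ((f r - \<psi> n r \<omega>)\<^sup>2) \<partial>lborel) \<le> ennreal ((1 / 2) ^ n)"
          using PA[of n] A unfolding P_def f_def by blast+
        have pt: "(\<psi> n r \<omega> - s0 * k n r)\<^sup>2 \<le> 2 * (f r - \<psi> n r \<omega>)\<^sup>2 + 2 * \<delta>\<^sup>2 * (k n r)\<^sup>2" for r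
        proof -
          have "(x - y)\<^sup>2 \<le> 2 * (w - x)\<^sup>2 + 2 * (w - y)\<^sup>2" for x y w :: real
            using zero_le_power2[of "2 * w - x - y"] by (simp add: power2_eq_square algebra_simps)
          then have "(\<psi> n r \<omega> - s0 * k n r)\<^sup>2 \<le> 2 * (f r - \<psi> n r \<omega>)\<^sup>2 + 2 * (f r - s0 * k n r)\<^sup>2" .
          moreover have "(f r - s0 * k n r)\<^sup>2 \<le> \<delta>\<^sup>2 * (k n r)\<^sup>2"
          proof (cases "r \<in> {0..<T n}")
            case True
            have "f r - s0 * k n r = (\<sigma> (Xi \<mu> (X r \<omega>)) - \<sigma> (Xi \<mu> \<xi>)) * k n r"
              by (simp add: f_def s0_def algebra_simps)
            moreover have "(\<sigma> (Xi \<mu> (X r \<omega>)) - \<sigma> (Xi \<mu> \<xi>))\<^sup>2 \<le> \<delta>\<^sup>2"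
              using n True \<delta>(1) power_mono[of "\<bar>\<sigma> (Xi \<mu> (X r \<omega>)) - \<sigma> (Xi \<mu> \<xi>)\<bar>" \<delta> 2] by simp
            ultimately show ?thesis by (simp add: power_mult_distrib mult_right_mono)
          qed (simp add: k0 f_def)
          ultimately show ?thesis by simp
        qed
        have "(\<integral>\<^sup>+r. ennreal ((\<psi> n r \<omega> - s0 * k n r)\<^sup>2) \<partial>lborel)
            \<le> (\<integral>\<^sup>+r. 2 * ennreal ((f r - \<psi> n r \<omega>)\<^sup>2) + ennreal (2 * \<delta>\<^sup>2) * ennreal ((k n r)\<^sup>2) \<partial>lborel)"
        proof (rule nn_integral_mono)
          fix r
          have "ennreal ((\<psi> n r \<omega> - s0 * k n r)\<^sup>2) \<le> ennreal (2 * (f r - \<psi> n r \<omega>)\<^sup>2 + 2 * \<delta>\<^sup>2 * (k n r)\<^sup>2)"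
            using pt by (rule ennreal_leI)
          also have "\<dots> = 2 * ennreal ((f r - \<psi> n r \<omega>)\<^sup>2) + ennreal (2 * \<delta>\<^sup>2) * ennreal ((k n r)\<^sup>2)"
            by (simp add: ennreal_mult'')
          finally show "ennreal ((\<psi> n r \<omega> - s0 * k n r)\<^sup>2) \<le> 2 * ennreal ((f r - \<psi> n r \<omega>)\<^sup>2) + ennreal (2 * \<delta>\<^sup>2) * ennreal ((k n r)\<^sup>2)" .
        qed
        also have "\<dots> = 2 * (\<integral>\<^sup>+r. ennreal ((f r - \<psi> n r \<omega>)\<^sup>2) \<partial>lborel)
            + ennreal (2 * \<delta>\<^sup>2) * (\<integral>\<^sup>+r. ennreal ((k n r)\<^sup>2) \<partial>lborel)"
          by (subst nn_integral_add) (auto simp: nn_integral_cmult)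
        also have "(\<integral>\<^sup>+r. ennreal ((k n r)\<^sup>2) \<partial>lborel) = ennreal (\<integral>r. (k n r)\<^sup>2 \<partial>lborel)"
          using i by (intro nn_integral_eq_integral) auto
        also have "2 * (\<integral>\<^sup>+r. ennreal ((f r - \<psi> n r \<omega>)\<^sup>2) \<partial>lborel) + ennreal (2 * \<delta>\<^sup>2) * ennreal (\<integral>r. (k n r)\<^sup>2 \<partial>lborel)
            \<le> 2 * ennreal (e / 4) + ennreal (2 * \<delta>\<^sup>2) * ennreal (R + 1)"
          using fb h R by (intro add_mono mult_left_mono ennreal_leI order_trans[OF fb]) auto
        also have "\<dots> = ennreal (2 * (e / 4) + 2 * \<delta>\<^sup>2 * (R + 1))"
        proof -
          have "ennreal (2 * (e / 4)) = ennreal 2 * ennreal (e / 4)" using e by (intro ennreal_mult) auto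
          moreover have "ennreal (2 * \<delta>\<^sup>2 * (R + 1)) = ennreal (2 * \<delta>\<^sup>2) * ennreal (R + 1)"
            using R0 by (intro ennreal_mult) auto
          moreover have "ennreal (2 * (e / 4) + 2 * \<delta>\<^sup>2 * (R + 1)) = ennreal (2 * (e / 4)) + ennreal (2 * \<delta>\<^sup>2 * (R + 1))"
            using e R0 by (intro ennreal_plus) auto
          ultimately show ?thesis by (simp only: ennreal_numeral)
        qed
        also have "2 * (e / 4) + 2 * \<delta>\<^sup>2 * (R + 1) = e" unfolding \<delta>(2) using R0 by (simp add: field_simps)
        finally show "(\<integral>\<^sup>+r. ennreal ((\<psi> n r \<omega> - s0 * k n r)\<^sup>2) \<partial>lborel) \<le> ennreal e" .
      qed
    qed
    have drift: "\<forall>\<^sub>F n in sequentially. \<bar>\<l> n (D n \<omega>)\<bar> \<le> e" if e: "0 < e" for e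
    proof -
      define m where "m = \<bar>b (Xi \<mu> \<xi>)\<bar> + 1"
      have m: "0 < m" by (simp add: m_def)
      \<comment> \<open>By \<open>\<bar>k\<bar> \<le> \<kappa> * k\<^sup>2 + 1 / \<kappa>\<close> on the window, the drift is at most \<open>m * (\<kappa> * (R + 1) + T n / \<kappa>)\<close>, and
        this choice of \<open>\<kappa>\<close> makes the first term \<open>e / 2\<close>.\<close>
      define \<kappa> where "\<kappa> = e / (2 * m * (R + 1))"
      have \<kappa>: "0 < \<kappa>" using e m R0 by (auto simp: \<kappa>_def intro!: divide_pos_pos mult_pos_pos)
      have "(\<lambda>n. m / \<kappa> * T n) \<longlonglongrightarrow> m / \<kappa> * 0" by (intro tendsto_mult_left T(2))
      then have "\<forall>\<^sub>F n in sequentially. m / \<kappa> * T n < e / 2" using e by (intro order_tendstoD(2)) auto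
      with near[OF b zero_less_one] evR ki show ?thesis
      proof eventually_elim
        fix n assume n: "\<forall>r\<in>{0..<T n}. \<bar>b (Xi \<mu> (X r \<omega>)) - b (Xi \<mu> \<xi>)\<bar> \<le> 1"
          and R: "(\<integral>r. (k n r)\<^sup>2 \<partial>lborel) < R + 1"
          and i: "integrable lborel (\<lambda>r. (k n r)\<^sup>2)" and Tn: "m / \<kappa> * T n < e / 2"
        note [measurable] = k[of n]
        have pt: "\<bar>k n r * b (Xi \<mu> (X r \<omega>))\<bar> \<le> m * \<kappa> * (k n r)\<^sup>2 + m / \<kappa> * indicator {0..<T n} r" for r
        proof (cases "r \<in> {0..<T n}")
          case True
          have bm: "\<bar>b (Xi \<mu> (X r \<omega>))\<bar> \<le> m" using n True by (fastforce simp: m_def)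
          have "\<bar>k n r\<bar> \<le> \<kappa> * (k n r)\<^sup>2 + 1 / \<kappa>"
          proof (cases "\<kappa> * \<bar>k n r\<bar> \<le> 1")
            case True
            then have "\<bar>k n r\<bar> \<le> 1 / \<kappa>" using \<kappa> by (simp add: field_simps)
            moreover have "0 \<le> \<kappa> * (k n r)\<^sup>2" using \<kappa> by simp
            ultimately show ?thesis by linarith
          next
            case False
            then have "1 * \<bar>k n r\<bar> \<le> (\<kappa> * \<bar>k n r\<bar>) * \<bar>k n r\<bar>" by (intro mult_right_mono) auto
            then have "\<bar>k n r\<bar> \<le> \<kappa> * (k n r)\<^sup>2" by (simp add: power2_eq_square mult.assoc)
            moreover have "0 \<le> 1 / \<kappa>" using \<kappa> by simp
            ultimately show ?thesis by linarith
          qed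
          then have "\<bar>k n r\<bar> * \<bar>b (Xi \<mu> (X r \<omega>))\<bar> \<le> (\<kappa> * (k n r)\<^sup>2 + 1 / \<kappa>) * m"
            using bm \<kappa> by (intro mult_mono) auto
          then show ?thesis using True by (simp add: abs_mult algebra_simps)
        qed (simp add: k0)
        interpret H_functional \<mu> \<eta>' "\<l> n" "c n" by (rule H)
        have "ennreal \<bar>\<l> n (D n \<omega>)\<bar>
            \<le> (\<integral>\<^sup>+r. ennreal \<bar>\<l> n (\<lambda>x. Sg (T n - r) (xiK Kinf) x * b (Xi \<mu> (X r \<omega>)))\<bar> \<partial>restrict_space lborel {0..<T n})"
          using D by (intro H_integral_bound) blast
        also have "\<dots> = (\<integral>\<^sup>+r. ennreal \<bar>\<l> n (\<lambda>x. Sg (T n - r) (xiK Kinf) x * b (Xi \<mu> (X r \<omega>)))\<bar> * indicator {0..<T n} r \<partial>lborel)"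
          by (subst nn_integral_restrict_space) auto
        also have "\<dots> \<le> (\<integral>\<^sup>+r. ennreal (m * \<kappa>) * ennreal ((k n r)\<^sup>2) + ennreal (m / \<kappa>) * indicator {0..<T n} r \<partial>lborel)"
        proof (rule nn_integral_mono)
          fix r
          have "ennreal \<bar>\<l> n (\<lambda>x. Sg (T n - r) (xiK Kinf) x * b (Xi \<mu> (X r \<omega>)))\<bar> * indicator {0..<T n} r
              = ennreal \<bar>k n r * b (Xi \<mu> (X r \<omega>))\<bar>"
            using lk[of n r "b (Xi \<mu> (X r \<omega>))"] by (cases "r \<in> {0..<T n}") auto
          also have "\<dots> \<le> ennreal (m * \<kappa> * (k n r)\<^sup>2 + m / \<kappa> * indicator {0..<T n} r)"
            using pt by (rule ennreal_leI)
          also have "\<dots> = ennreal (m * \<kappa>) * ennreal ((k n r)\<^sup>2) + ennreal (m / \<kappa>) * indicator {0..<T n} r"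
            using m \<kappa> by (cases "r \<in> {0..<T n}") (simp_all add: ennreal_mult'')
          finally show "ennreal \<bar>\<l> n (\<lambda>x. Sg (T n - r) (xiK Kinf) x * b (Xi \<mu> (X r \<omega>)))\<bar> * indicator {0..<T n} r
              \<le> ennreal (m * \<kappa>) * ennreal ((k n r)\<^sup>2) + ennreal (m / \<kappa>) * indicator {0..<T n} r" .
        qed
        also have "\<dots> = ennreal (m * \<kappa>) * (\<integral>\<^sup>+r. ennreal ((k n r)\<^sup>2) \<partial>lborel) + ennreal (m / \<kappa>) * emeasure lborel {0..<T n}"
          by (subst nn_integral_add) (auto simp: nn_integral_cmult nn_integral_cmult_indicator)
        also have "(\<integral>\<^sup>+r. ennreal ((k n r)\<^sup>2) \<partial>lborel) = ennreal (\<integral>r. (k n r)\<^sup>2 \<partial>lborel)"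
          using i by (intro nn_integral_eq_integral) auto
        also have "ennreal (m * \<kappa>) * ennreal (\<integral>r. (k n r)\<^sup>2 \<partial>lborel) + ennreal (m / \<kappa>) * emeasure lborel {0..<T n}
            = ennreal (m * \<kappa> * (\<integral>r. (k n r)\<^sup>2 \<partial>lborel) + m / \<kappa> * T n)"
        proof -
          have "emeasure lborel {0..<T n} = ennreal (T n)" using T(1) by simp
          moreover have "ennreal (m / \<kappa> * T n) = ennreal (m / \<kappa>) * ennreal (T n)"
            using T(1) m \<kappa> by (intro ennreal_mult) auto
          moreover have "ennreal (m * \<kappa> * (\<integral>r. (k n r)\<^sup>2 \<partial>lborel)) = ennreal (m * \<kappa>) * ennreal (\<integral>r. (k n r)\<^sup>2 \<partial>lborel)"
            using m \<kappa> by (intro ennreal_mult) auto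
          moreover have "ennreal (m * \<kappa> * (\<integral>r. (k n r)\<^sup>2 \<partial>lborel) + m / \<kappa> * T n)
              = ennreal (m * \<kappa> * (\<integral>r. (k n r)\<^sup>2 \<partial>lborel)) + ennreal (m / \<kappa> * T n)"
            using T(1) m \<kappa> by (intro ennreal_plus) auto
          ultimately show ?thesis by (simp only:)
        qed
        also have "\<dots> \<le> ennreal (m * \<kappa> * (R + 1) + e / 2)"
          using R Tn m \<kappa> by (intro ennreal_leI add_mono mult_left_mono) auto
        also have "m * \<kappa> * (R + 1) + e / 2 = e"
        proof -
          define w where "w = 2 * m * (R + 1)"
          have "w \<noteq> 0" using m R0 by (simp add: w_def)
          then have "\<kappa> * w = e" by (simp add: \<kappa>_def w_def[symmetric])
          then have "\<kappa> * (2 * m * (R + 1)) = e" by (simp only: w_def)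
          then show ?thesis by (simp add: algebra_simps)
        qed
        finally show "\<bar>\<l> n (D n \<omega>)\<bar> \<le> e" using e by (simp add: ennreal_le_iff)
      qed
    qed
    have c2: "(\<lambda>n. \<l> n (\<lambda>x. X (T n) \<omega> x - Sg (T n) \<xi> x) - I n \<omega>) \<longlonglongrightarrow> 0"
    proof (rule tendstoI)
      fix e :: real assume "0 < e"
      then have e3: "0 < e / 3" by simp
      from ev drift[OF e3] half[OF e3]
      show "\<forall>\<^sub>F n in sequentially. dist (\<l> n (\<lambda>x. X (T n) \<omega> x - Sg (T n) \<xi> x) - I n \<omega>) 0 < e"
      proof eventually_elim
        fix n assume A: "\<omega> \<in> space M - A n" and d: "\<bar>\<l> n (D n \<omega>)\<bar> \<le> e / 3" and h: "(1 / 2) ^ n < e / 3"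
        have "\<bar>\<l> n (J n \<omega>) - I n \<omega>\<bar> \<le> (1 / 2) ^ n" using PA[of n] A unfolding P_def by blast
        moreover have "\<l> n (\<lambda>x. X (T n) \<omega> x - Sg (T n) \<xi> x) = \<l> n (D n \<omega>) + \<l> n (J n \<omega>)" using DJ by blast
        ultimately show "dist (\<l> n (\<lambda>x. X (T n) \<omega> x - Sg (T n) \<xi> x) - I n \<omega>) 0 < e"
          using d h \<open>0 < e\<close> by (simp add: dist_real_def)
      qed
    qed
    show "(\<lambda>n. \<integral>\<^sup>+r. ennreal ((\<psi> n r \<omega> - s0 * k n r)\<^sup>2) \<partial>lborel) \<longlonglongrightarrow> 0 \<and>
      (\<lambda>n. \<l> n (\<lambda>x. X (T n) \<omega> x - Sg (T n) \<xi> x) - I n \<omega>) \<longlonglongrightarrow> 0"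
      using c1 c2 by blast
  qed
  then show ?thesis using el unfolding s0_def \<l>_def by blast
qed

text \<open>The reflection \<open>r \<mapsto> S - r\<close>.  It maps the half-open interval to \<open>(0, S]\<close>, which differs from
  \<open>[0, S]\<close> by a null set.\<close>
lemma kernel_covariance:
  fixes u v :: "real \<Rightarrow> real"
  assumes [measurable]: "u \<in> borel_measurable borel" "v \<in> borel_measurable borel"
    and "S \<le> T"
  shows "(\<integral>r. (u (S - r) * indicator {0..<S} r) * (v (T - r) * indicator {0..<T} r) \<partial>lborel)
    = (LINT r:{0..S}|lborel. v ((T - S) + r) * u r)"
proof -
  have "(\<integral>r. (u (S - r) * indicator {0..<S} r) * (v (T - r) * indicator {0..<T} r) \<partial>lborel)
      = (\<integral>r. (u (S - (S + (- 1) * r)) * indicator {0..<S} (S + (- 1) * r)) *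
          (v (T - (S + (- 1) * r)) * indicator {0..<T} (S + (- 1) * r)) \<partial>lborel)"
    by (subst lborel_integral_real_affine[where c="- 1" and t=S]) simp_all
  also have "\<dots> = (\<integral>r. indicator {0..S} r *\<^sub>R (v ((T - S) + r) * u r) \<partial>lborel)"
  proof (rule integral_cong_AE)
    have "AE r in lborel. r \<noteq> (0::real)" by (rule AE_lborel_singleton)
    then show "AE r in lborel. (u (S - (S + (- 1) * r)) * indicator {0..<S} (S + (- 1) * r)) *
          (v (T - (S + (- 1) * r)) * indicator {0..<T} (S + (- 1) * r)) = indicator {0..S} r *\<^sub>R (v ((T - S) + r) * u r)"
      by eventually_elim (use \<open>S \<le> T\<close> in \<open>auto simp: indicator_def algebra_simps\<close>)
  qed measurable
  finally show ?thesis by (simp add: set_lebesgue_integral_def)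
qed

section \<open>Convergence in distribution of the normalised increments\<close>

lemma borel_measurable_vec_lambda:
  fixes f :: "'n::finite \<Rightarrow> 'a \<Rightarrow> real"
  assumes [measurable]: "\<And>i. f i \<in> borel_measurable M"
  shows "(\<lambda>\<omega>. \<chi> i. f i \<omega>) \<in> borel_measurable M"
proof -
  have *: "(\<chi> i. f i \<omega>) = (\<Sum>i\<in>UNIV. f i \<omega> *\<^sub>R axis i 1)" for \<omega>
    by (simp add: vec_eq_iff axis_def if_distrib[of "\<lambda>x. _ * x"] cong: if_cong)
  show ?thesis unfolding * by measurable
qed

lemma square_integrable_kernel:
  fixes u :: "real \<Rightarrow> real"
  assumes [measurable]: "u \<in> borel_measurable borel"
    and u: "0 < (LINT r:{0..1}|lborel. (u r)\<^sup>2)" and T: "T \<le> 1"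
  shows "integrable lborel (\<lambda>r. (a * u (T - r) * indicator {0..<T} r)\<^sup>2)"
proof -
  have i: "integrable lborel (\<lambda>r. indicator {0..1} r *\<^sub>R (u r)\<^sup>2)"
    using u not_integrable_integral_eq by (fastforce simp: set_lebesgue_integral_def)
  have "integrable lborel (\<lambda>r. indicator {0..1} (T + (- 1) * r) *\<^sub>R (u (T + (- 1) * r))\<^sup>2)"
    by (rule lborel_integrable_real_affine[OF i]) simp
  then have "integrable lborel (\<lambda>r. a\<^sup>2 * (indicator {0..1} (T - r) * (u (T - r))\<^sup>2))"
    by (intro integrable_mult_right) simp
  then show ?thesis
  proof (rule Bochner_Integration.integrable_bound)
    show "AE r in lborel. norm ((a * u (T - r) * indicator {0..<T} r)\<^sup>2) \<le> norm (a\<^sup>2 * (indicator {0..1} (T - r) * (u (T - r))\<^sup>2))"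
      using T by (intro AE_I2) (auto simp: power_mult_distrib indicator_def)
  qed measurable
qed

lemma integrable_square_product:
  fixes f g :: "real \<Rightarrow> real"
  assumes [measurable]: "f \<in> borel_measurable borel" "g \<in> borel_measurable borel"
    and "integrable lborel (\<lambda>r. (f r)\<^sup>2)" "integrable lborel (\<lambda>r. (g r)\<^sup>2)"
  shows "integrable lborel (\<lambda>r. f r * g r)"
proof (rule Bochner_Integration.integrable_bound)
  show "integrable lborel (\<lambda>r. (f r)\<^sup>2 + (g r)\<^sup>2)" using assms by simp
  have "\<bar>x * y\<bar> \<le> x\<^sup>2 + y\<^sup>2" for x y :: real
  proof -
    have "2 * \<bar>x * y\<bar> \<le> x\<^sup>2 + y\<^sup>2"
      using sum_squares_bound[of "\<bar>x\<bar>" "\<bar>y\<bar>"] by (simp add: abs_mult)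
    then show ?thesis using abs_ge_zero[of "x * y"] by linarith
  qed
  then show "AE r in lborel. norm (f r * g r) \<le> norm ((f r)\<^sup>2 + (g r)\<^sup>2)" by simp
qed simp

theorem theorem4p2:
  fixes K b \<sigma> g \<xi>\<^sub>g :: "real \<Rightarrow> real"
    and Kinf \<chi>\<^sub>b \<chi>\<^sub>\<sigma> \<eta>\<^sub>g \<eta>\<^sub>X \<eta> C \<gamma> :: real
    and \<mu> :: "real measure"
    and \<chi>\<^sub>g :: ereal
    and M :: "'a measure" and F :: "real \<Rightarrow> 'a measure" and B :: "real \<Rightarrow> 'a \<Rightarrow> real"
    and X :: "real \<Rightarrow> 'a \<Rightarrow> real \<Rightarrow> real"
    and y :: "'n::{finite, linorder} \<Rightarrow> real \<Rightarrow> real"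
    and t :: "'n::{finite, linorder} \<Rightarrow> real"
    and \<Sigma> :: "real ^ 'n::{finite, linorder} ^ 'n::{finite, linorder}"
  assumes "condition_A K Kinf \<mu>"
    and "0 < \<chi>\<^sub>b" "\<chi>\<^sub>b \<le> 1" "holder \<chi>\<^sub>b b"
    and "0 < \<chi>\<^sub>\<sigma>" "\<chi>\<^sub>\<sigma> \<le> 1" "holder \<chi>\<^sub>\<sigma> \<sigma>"
    and "eta_star \<mu> < ereal \<eta>\<^sub>g" "\<xi>\<^sub>g \<in> Hsp \<mu> \<eta>\<^sub>g"
    and "\<And>s. 0 \<le> s \<Longrightarrow> g s = Xi \<mu> (Sg s \<xi>\<^sub>g)"
    and "\<chi>\<^sub>g = (ereal \<eta>\<^sub>g - eta_star \<mu>) / 2"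
    and "eta_star \<mu> < ereal \<eta>\<^sub>X" "ereal \<eta>\<^sub>X < 1 - eta_star \<mu>"
    and "weak_solution \<mu> Kinf b \<sigma> \<xi>\<^sub>g \<eta>\<^sub>X M F B X"
    and "\<eta> \<le> \<eta>\<^sub>X"
    and "\<And>i. y i \<in> Hsp \<mu> \<eta>" "\<And>i. \<not> Heq \<mu> (y i) (\<lambda>_. 0)"
    and "\<And>i. 0 < t i" "\<And>i j. i \<le> j \<Longrightarrow> t i \<le> t j"
    and "0 < C" "0 < \<gamma>"
    and "\<And>i n. 1 \<le> n \<Longrightarrow> 0 < lam_int \<mu> Kinf \<eta> (y i) n"
    and "\<And>i n. 1 \<le> n \<Longrightarrow> sqrt (lam \<mu> Kinf \<eta> (y i) n) \<le> C * real n powr \<gamma>"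
    and "ereal \<gamma> < min 1 (1 - ereal \<eta> - eta_star \<mu>) / 2
                  + min (1 / 2 - max (eta_star \<mu>) 0) \<chi>\<^sub>g * ereal \<chi>\<^sub>\<sigma>"
    and "psd_matrix \<Sigma>"
    and "\<And>i j. i \<le> j \<Longrightarrow>
           (\<lambda>n. sqrt (lam \<mu> Kinf \<eta> (y i) n * lam \<mu> Kinf \<eta> (y j) n) *
                (LINT r:{0..t i / real n}|lborel.
                   Hinner \<mu> \<eta> (Sg ((t j - t i) / real n + r) (xiK Kinf)) (y j) *
                   Hinner \<mu> \<eta> (Sg r (xiK Kinf)) (y i)))
             \<longlonglongrightarrow> \<Sigma> $ i $ j"
  shows "converges_in_distribution M
           (\<lambda>n \<omega>. \<chi> i. sqrt (lam \<mu> Kinf \<eta> (y i) n) *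
              Hinner \<mu> \<eta> (\<lambda>x. X (t i / real n) \<omega> x - Sg (t i / real n) \<xi>\<^sub>g x) (y i))
           (multivariate_normal 0 ((\<sigma> (Xi \<mu> \<xi>\<^sub>g))\<^sup>2 *\<^sub>R \<Sigma>))"
proof -
  note condA = assms(1) and ws = \<open>weak_solution \<mu> Kinf b \<sigma> \<xi>\<^sub>g \<eta>\<^sub>X M F B X\<close> and \<Sigma> = \<open>psd_matrix \<Sigma>\<close>
    and cov = assms(26) and pos = assms(22)
  note hl = condition_A_measure(1)[OF condA]
  interpret half_line_measure \<mu> by (rule hl)
  interpret brownian M F B using ws by (rule weak_solution_brownian)
  have \<xi>: "\<xi>\<^sub>g \<in> borel_measurable borel" using HspD(1) \<open>\<xi>\<^sub>g \<in> Hsp \<mu> \<eta>\<^sub>g\<close> by blast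
  define s0 where "s0 = \<sigma> (Xi \<mu> \<xi>\<^sub>g)"
  define T where "T i n = t i / real n" for i n
  define a where "a i n = sqrt (lam \<mu> Kinf \<eta> (y i) n)" for i n
  define u where "u i r = Hinner \<mu> \<eta> (Sg r (xiK Kinf)) (y i)" for i r
  define k where "k i n r = a i n * u i (T i n - r) * indicator {0..<T i n} r" for i n r
  define Y where "Y i n \<omega> = a i n * Hinner \<mu> \<eta> (\<lambda>x. X (T i n) \<omega> x - Sg (T i n) \<xi>\<^sub>g x) (y i)" for i n \<omega>
  have T0: "0 \<le> T i n" for i n using \<open>\<And>i. 0 < t i\<close>[of i] by (simp add: T_def)
  have Tlim: "T i \<longlonglongrightarrow> 0" for i unfolding T_def by (rule lim_const_over_n)
  have u[measurable]: "u i \<in> borel_measurable borel" for i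
    unfolding u_def using \<open>\<And>i. y i \<in> Hsp \<mu> \<eta>\<close> HspD(1)
    by (intro Hinner_Sg_xiK_measurable condition_A_measure[OF condA]) blast
  have k[measurable]: "k i n \<in> borel_measurable borel" for i n unfolding k_def by measurable
  \<comment> \<open>Square integrability is available once \<open>t i / n \<le> 1\<close>, that is for all large \<open>n\<close>: it comes from the
      positivity of the integral of \<open>(u i)\<^sup>2\<close> over \<open>[0, 1]\<close>, a divergent integral having the value zero.\<close>
  have ki: "\<forall>\<^sub>F n in sequentially. integrable lborel (\<lambda>r. (k i n r)\<^sup>2)" for i
  proof -
    have "\<forall>\<^sub>F n in sequentially. T i n < 1" using Tlim by (rule order_tendstoD(2)) simp
    moreover have "0 < (LINT r:{0..1}|lborel. (u i r)\<^sup>2)"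
      using pos[of 1 i] by (simp add: lam_int_def u_def)
    ultimately show ?thesis
      unfolding k_def by (elim eventually_mono) (intro square_integrable_kernel, auto)
  qed
  have kk: "(\<lambda>n. \<integral>r. k i n r * k j n r \<partial>lborel) \<longlonglongrightarrow> \<Sigma> $ i $ j" for i j
  proof -
    have le: "(\<lambda>n. \<integral>r. k i n r * k j n r \<partial>lborel) \<longlonglongrightarrow> \<Sigma> $ i $ j" if "i \<le> j" for i j
    proof -
      have "(\<integral>r. k i n r * k j n r \<partial>lborel) = sqrt (lam \<mu> Kinf \<eta> (y i) n * lam \<mu> Kinf \<eta> (y j) n) *
          (LINT r:{0..t i / real n}|lborel. u j ((t j - t i) / real n + r) * u i r)" for n
      proof -
        have "T i n \<le> T j n" using \<open>\<And>i j. i \<le> j \<Longrightarrow> t i \<le> t j\<close>[OF that] by (simp add: T_def divide_right_mono)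
        note kernel_covariance[OF u u this, of i j]
        moreover have "(\<integral>r. k i n r * k j n r \<partial>lborel) = (\<integral>r. (a i n * a j n) *
            ((u i (T i n - r) * indicator {0..<T i n} r) * (u j (T j n - r) * indicator {0..<T j n} r)) \<partial>lborel)"
          unfolding k_def by (rule Bochner_Integration.integral_cong) auto
        ultimately show ?thesis by (simp add: a_def T_def diff_divide_distrib real_sqrt_mult)
      qed
      then show ?thesis using cov[OF that] by (simp add: u_def)
    qed
    have sym: "\<Sigma> $ i $ j = \<Sigma> $ j $ i"
    proof -
      have "transpose \<Sigma> = \<Sigma>" using \<Sigma> by (simp add: psd_matrix_def)
      then have "transpose \<Sigma> $ i $ j = \<Sigma> $ i $ j" by simp
      then show ?thesis by (simp add: transpose_def)
    qed
    show ?thesis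
    proof (cases "i \<le> j")
      case False
      then show ?thesis using le[of j i] sym by (simp add: mult.commute)
    qed (rule le)
  qed
  define P where "P i \<psi> I \<longleftrightarrow> (\<forall>n. elementary (\<psi> n) (I n)) \<and>
     (AE \<omega> in M. (\<lambda>n. \<integral>\<^sup>+r. ennreal ((\<psi> n r \<omega> - s0 * k i n r)\<^sup>2) \<partial>lborel) \<longlonglongrightarrow> 0 \<and>
        (\<lambda>n. Y i n \<omega> - I n \<omega>) \<longlonglongrightarrow> 0)" for i \<psi> I
  have "\<exists>\<psi> I. P i \<psi> I" for i
    unfolding P_def s0_def Y_def k_def u_def
  proof (rule small_time_approximation[OF ws hl \<xi>])
    show "isCont b (Xi \<mu> \<xi>\<^sub>g)" "isCont \<sigma> (Xi \<mu> \<xi>\<^sub>g)" using assms(2,4,5,7) by (auto intro: holder_isCont)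
    show "(\<lambda>n. \<integral>r. (a i n * Hinner \<mu> \<eta> (Sg (T i n - r) (xiK Kinf)) (y i) * indicator {0..<T i n} r)\<^sup>2 \<partial>lborel) \<longlonglongrightarrow> \<Sigma> $ i $ i"
      using kk[of i i] by (simp add: k_def u_def power2_eq_square)
    show "\<forall>\<^sub>F n in sequentially. integrable lborel (\<lambda>r. (a i n * Hinner \<mu> \<eta> (Sg (T i n - r) (xiK Kinf)) (y i) * indicator {0..<T i n} r)\<^sup>2)"
      using ki[of i] by (simp add: k_def u_def)
    show "(\<lambda>r. a i n * Hinner \<mu> \<eta> (Sg (T i n - r) (xiK Kinf)) (y i) * indicator {0..<T i n} r) \<in> borel_measurable borel" for n
      using k[of i n] by (simp add: k_def[abs_def] u_def)
  qed (use assms T0 Tlim in auto)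
  then obtain \<psi> I where P: "\<And>i. P i (\<psi> i) (I i)" by metis
  have el: "elementary (\<psi> i n) (I i n)" for i n using P[of i] unfolding P_def by blast
  have lim: "AE \<omega> in M. (\<lambda>n. \<integral>\<^sup>+r. ennreal ((\<psi> i n r \<omega> - s0 * k i n r)\<^sup>2) \<partial>lborel) \<longlonglongrightarrow> 0 \<and>
        (\<lambda>n. Y i n \<omega> - I i n \<omega>) \<longlonglongrightarrow> 0" for i
    using P[of i] unfolding P_def by blast
  have AE: "AE \<omega> in M. \<forall>i. (\<lambda>n. \<integral>\<^sup>+r. ennreal ((\<psi> i n r \<omega> - s0 * k i n r)\<^sup>2) \<partial>lborel) \<longlonglongrightarrow> 0 \<and>
        (\<lambda>n. Y i n \<omega> - I i n \<omega>) \<longlonglongrightarrow> 0"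
    using lim by (simp add: AE_all_countable)
  have Ym: "Y i n \<in> borel_measurable M" for i n
  proof -
    have "Sg (T i n) \<xi>\<^sub>g \<in> Hsp \<mu> \<eta>\<^sub>X" by (rule weak_solution_functional[OF ws hl \<xi> T0])
    interpret H: H_functional \<mu> \<eta>\<^sub>X "\<lambda>z. a i n * Hinner \<mu> \<eta> z (y i)" "\<bar>a i n\<bar> * Hnorm \<mu> \<eta> (y i) + 1"
      using \<open>\<eta> \<le> \<eta>\<^sub>X\<close> \<open>\<And>i. y i \<in> Hsp \<mu> \<eta>\<close> by (rule H_functional_Hinner)
    have Xm: "X (T i n) \<in> measurable M (Hborel \<mu> \<eta>\<^sub>X)"
      using ws T0 measurable_ambient unfolding weak_solution_def by blast
    have "(\<lambda>\<omega>. a i n * Hinner \<mu> \<eta> (X (T i n) \<omega>) (y i) - a i n * Hinner \<mu> \<eta> (Sg (T i n) \<xi>\<^sub>g) (y i)) \<in> borel_measurable M"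
      by (intro borel_measurable_diff measurable_compose[OF Xm H.functional_measurable]) simp
    then show ?thesis
    proof (rule measurable_cong[THEN iffD1, rotated])
      fix \<omega> assume "\<omega> \<in> space M"
      then have "X (T i n) \<omega> \<in> Hsp \<mu> \<eta>\<^sub>X" using measurable_space[OF Xm] by (simp add: space_Hborel)
      from H.functional_diff[OF this \<open>Sg (T i n) \<xi>\<^sub>g \<in> Hsp \<mu> \<eta>\<^sub>X\<close>]
      show "a i n * Hinner \<mu> \<eta> (X (T i n) \<omega>) (y i) - a i n * Hinner \<mu> \<eta> (Sg (T i n) \<xi>\<^sub>g) (y i) = Y i n \<omega>"
        by (simp add: Y_def)
    qed
  qed
  have Im: "I i n \<in> borel_measurable M" for i n by (rule elementary_char_estimate(1)[OF el])
  have psd: "psd_matrix (s0\<^sup>2 *\<^sub>R \<Sigma>)"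
    using \<Sigma> by (simp add: psd_matrix_def transpose_def vec_eq_iff scaleR_matrix_vector_assoc[symmetric])
  have "converges_in_distribution M (\<lambda>n \<omega>. \<chi> i. Y i n \<omega>) (multivariate_normal 0 (s0\<^sup>2 *\<^sub>R \<Sigma>))"
  proof (rule levy_continuity_euclidean)
    show "prob_space M" by (rule prob_space_axioms)
    show "prob_space (multivariate_normal 0 (s0\<^sup>2 *\<^sub>R \<Sigma>))" by (rule prob_space_multivariate_normal[OF psd])
    show "sets (multivariate_normal 0 (s0\<^sup>2 *\<^sub>R \<Sigma>)) = sets borel" by (rule sets_multivariate_normal[OF psd])
    show "(\<lambda>\<omega>. \<chi> i. Y i n \<omega>) \<in> borel_measurable M" for n by (rule borel_measurable_vec_lambda[OF Ym])
    fix v :: "real ^ 'n::{finite, linorder}"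
    define w where "w n r = s0 * (\<Sum>i\<in>UNIV. v $ i * k i n r)" for n r
    define \<Psi> where "\<Psi> n r \<omega> = (\<Sum>i\<in>UNIV. v $ i * \<psi> i n r \<omega>)" for n r \<omega>
    define L where "L n \<omega> = (\<Sum>i\<in>UNIV. v $ i * I i n \<omega>)" for n \<omega>
    have elL: "elementary (\<Psi> n) (L n)" for n
      unfolding \<Psi>_def L_def by (intro elementary_sum elementary_scale el) simp
    have w2: "(w n r)\<^sup>2 = (\<Sum>i\<in>UNIV. \<Sum>j\<in>UNIV. (s0\<^sup>2 * v $ i * v $ j) * (k i n r * k j n r))" for n r
      unfolding w_def power_mult_distrib power2_eq_square[of "sum _ _"] sum_product
      by (simp add: sum_distrib_left mult_ac)
    have evk: "\<forall>\<^sub>F n in sequentially. \<forall>i. integrable lborel (\<lambda>r. (k i n r)\<^sup>2)"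
      using ki by (simp add: eventually_all_finite)
    have evkk: "\<forall>\<^sub>F n in sequentially. \<forall>i j. integrable lborel (\<lambda>r. k i n r * k j n r)"
      using evk by eventually_elim (auto intro: integrable_square_product)
    have L: "(\<lambda>n. CLINT \<omega>|M. iexp (L n \<omega>)) \<longlonglongrightarrow> complex_of_real (exp (- (s0\<^sup>2 * (v \<bullet> (\<Sigma> *v v))) / 2))"
    proof (rule elementary_char_limit[OF elL])
      show "w n \<in> borel_measurable borel" for n unfolding w_def by measurable
      show "\<forall>\<^sub>F n in sequentially. integrable lborel (\<lambda>r. (w n r)\<^sup>2)"
        using evkk by eventually_elim (auto simp: w2 intro!: Bochner_Integration.integrable_sum integrable_mult_right)
      have "(\<lambda>n. \<Sum>i\<in>UNIV. \<Sum>j\<in>UNIV. (s0\<^sup>2 * v $ i * v $ j) * (\<integral>r. k i n r * k j n r \<partial>lborel))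
          \<longlonglongrightarrow> (\<Sum>i\<in>UNIV. \<Sum>j\<in>UNIV. (s0\<^sup>2 * v $ i * v $ j) * \<Sigma> $ i $ j)"
        by (intro tendsto_sum tendsto_mult_left kk)
      also have "(\<Sum>i\<in>UNIV. \<Sum>j\<in>UNIV. (s0\<^sup>2 * v $ i * v $ j) * \<Sigma> $ i $ j) = s0\<^sup>2 * (v \<bullet> (\<Sigma> *v v))"
        by (simp add: inner_vec_def matrix_vector_mult_def sum_distrib_left mult_ac)
      finally show "(\<lambda>n. \<integral>r. (w n r)\<^sup>2 \<partial>lborel) \<longlonglongrightarrow> s0\<^sup>2 * (v \<bullet> (\<Sigma> *v v))"
      proof (rule Lim_transform_eventually)
        show "\<forall>\<^sub>F n in sequentially. (\<Sum>i\<in>UNIV. \<Sum>j\<in>UNIV. (s0\<^sup>2 * v $ i * v $ j) * (\<integral>r. k i n r * k j n r \<partial>lborel))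
            = (\<integral>r. (w n r)\<^sup>2 \<partial>lborel)"
          using evkk
        proof eventually_elim
          fix n assume i: "\<forall>i j. integrable lborel (\<lambda>r. k i n r * k j n r)"
          have "(\<integral>r. (w n r)\<^sup>2 \<partial>lborel) = (\<Sum>i\<in>UNIV. \<integral>r. (\<Sum>j\<in>UNIV. (s0\<^sup>2 * v $ i * v $ j) * (k i n r * k j n r)) \<partial>lborel)"
            unfolding w2 using i
            by (intro Bochner_Integration.integral_sum Bochner_Integration.integrable_sum integrable_mult_right) auto
          also have "\<dots> = (\<Sum>i\<in>UNIV. \<Sum>j\<in>UNIV. \<integral>r. (s0\<^sup>2 * v $ i * v $ j) * (k i n r * k j n r) \<partial>lborel)"
            using i by (intro sum.cong refl Bochner_Integration.integral_sum integrable_mult_right) auto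
          finally show "(\<Sum>i\<in>UNIV. \<Sum>j\<in>UNIV. (s0\<^sup>2 * v $ i * v $ j) * (\<integral>r. k i n r * k j n r \<partial>lborel))
            = (\<integral>r. (w n r)\<^sup>2 \<partial>lborel)" by simp
        qed
      qed
      show "AE \<omega> in M. (\<lambda>n. \<integral>\<^sup>+r. ennreal ((\<Psi> n r \<omega> - w n r)\<^sup>2) \<partial>lborel) \<longlonglongrightarrow> 0"
        using AE
      proof eventually_elim
        fix \<omega> assume h: "\<forall>i. (\<lambda>n. \<integral>\<^sup>+r. ennreal ((\<psi> i n r \<omega> - s0 * k i n r)\<^sup>2) \<partial>lborel) \<longlonglongrightarrow> 0 \<and>
          (\<lambda>n. Y i n \<omega> - I i n \<omega>) \<longlonglongrightarrow> 0"
        note [measurable] = elementary_char_estimate(4)[OF el]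
        define N where "N = real (CARD('n))"
        have bound: "(\<integral>\<^sup>+r. ennreal ((\<Psi> n r \<omega> - w n r)\<^sup>2) \<partial>lborel)
            \<le> (\<Sum>i\<in>UNIV. ennreal (N * (v $ i)\<^sup>2) * (\<integral>\<^sup>+r. ennreal ((\<psi> i n r \<omega> - s0 * k i n r)\<^sup>2) \<partial>lborel))" for n
        proof -
          have "(\<integral>\<^sup>+r. ennreal ((\<Psi> n r \<omega> - w n r)\<^sup>2) \<partial>lborel)
              \<le> (\<integral>\<^sup>+r. (\<Sum>i\<in>UNIV. ennreal (N * (v $ i)\<^sup>2) * ennreal ((\<psi> i n r \<omega> - s0 * k i n r)\<^sup>2)) \<partial>lborel)"
          proof (rule nn_integral_mono)
            fix r
            have "\<Psi> n r \<omega> - w n r = (\<Sum>i\<in>UNIV. v $ i * (\<psi> i n r \<omega> - s0 * k i n r))"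
              by (simp add: \<Psi>_def w_def sum_subtractf right_diff_distrib sum_distrib_left mult_ac)
            then have "(\<Psi> n r \<omega> - w n r)\<^sup>2 \<le> (\<Sum>i\<in>UNIV. (v $ i * (\<psi> i n r \<omega> - s0 * k i n r))\<^sup>2) * N"
              unfolding N_def by (simp only: sum_squared_le_sum_of_squares)
            also have "\<dots> = (\<Sum>i\<in>UNIV. (N * (v $ i)\<^sup>2) * (\<psi> i n r \<omega> - s0 * k i n r)\<^sup>2)"
              by (simp add: sum_distrib_left power_mult_distrib mult_ac)
            finally have "ennreal ((\<Psi> n r \<omega> - w n r)\<^sup>2) \<le> ennreal (\<Sum>i\<in>UNIV. (N * (v $ i)\<^sup>2) * (\<psi> i n r \<omega> - s0 * k i n r)\<^sup>2)"
              by (rule ennreal_leI)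
            also have "\<dots> = (\<Sum>i\<in>UNIV. ennreal (N * (v $ i)\<^sup>2) * ennreal ((\<psi> i n r \<omega> - s0 * k i n r)\<^sup>2))"
              by (subst sum_ennreal[symmetric]) (auto simp: N_def ennreal_mult'')
            finally show "ennreal ((\<Psi> n r \<omega> - w n r)\<^sup>2)
              \<le> (\<Sum>i\<in>UNIV. ennreal (N * (v $ i)\<^sup>2) * ennreal ((\<psi> i n r \<omega> - s0 * k i n r)\<^sup>2))" .
          qed
          also have "\<dots> = (\<Sum>i\<in>UNIV. ennreal (N * (v $ i)\<^sup>2) * (\<integral>\<^sup>+r. ennreal ((\<psi> i n r \<omega> - s0 * k i n r)\<^sup>2) \<partial>lborel))"
            by (subst nn_integral_sum) (auto simp: nn_integral_cmult)
          finally show ?thesis .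
        qed
        have "(\<lambda>n. \<Sum>i\<in>UNIV. ennreal (N * (v $ i)\<^sup>2) * (\<integral>\<^sup>+r. ennreal ((\<psi> i n r \<omega> - s0 * k i n r)\<^sup>2) \<partial>lborel))
            \<longlonglongrightarrow> (\<Sum>i\<in>UNIV. ennreal (N * (v $ i)\<^sup>2) * 0)"
          using h by (intro tendsto_sum ennreal_tendsto_cmult) auto
        then have z: "(\<lambda>n. \<Sum>i\<in>UNIV. ennreal (N * (v $ i)\<^sup>2) * (\<integral>\<^sup>+r. ennreal ((\<psi> i n r \<omega> - s0 * k i n r)\<^sup>2) \<partial>lborel)) \<longlonglongrightarrow> 0"
          by simp
        show "(\<lambda>n. \<integral>\<^sup>+r. ennreal ((\<Psi> n r \<omega> - w n r)\<^sup>2) \<partial>lborel) \<longlonglongrightarrow> 0"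
          by (rule tendsto_sandwich[OF _ _ tendsto_const z]) (auto simp: bound)
      qed
    qed
    have vY: "v \<bullet> (\<chi> i. Y i n \<omega>) = (\<Sum>i\<in>UNIV. v $ i * Y i n \<omega>)" for n \<omega> by (simp add: inner_vec_def)
    have Lm[measurable]: "L n \<in> borel_measurable M" for n by (rule elementary_char_estimate(1)[OF elL])
    have vYm[measurable]: "(\<lambda>\<omega>. v \<bullet> (\<chi> i. Y i n \<omega>)) \<in> borel_measurable M" for n
      unfolding vY using Ym by measurable
    have "(\<lambda>n. CLINT \<omega>|M. iexp (v \<bullet> (\<chi> i. Y i n \<omega>)) - iexp (L n \<omega>)) \<longlonglongrightarrow> (CLINT \<omega>|M. 0)"
    proof (rule integral_dominated_convergence[where w="\<lambda>_. 2"])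
      show "AE \<omega> in M. (\<lambda>n. iexp (v \<bullet> (\<chi> i. Y i n \<omega>)) - iexp (L n \<omega>)) \<longlonglongrightarrow> 0"
        using AE
      proof eventually_elim
        fix \<omega> assume h: "\<forall>i. (\<lambda>n. \<integral>\<^sup>+r. ennreal ((\<psi> i n r \<omega> - s0 * k i n r)\<^sup>2) \<partial>lborel) \<longlonglongrightarrow> 0 \<and>
          (\<lambda>n. Y i n \<omega> - I i n \<omega>) \<longlonglongrightarrow> 0"
        have "(\<lambda>n. \<Sum>i\<in>UNIV. v $ i * (Y i n \<omega> - I i n \<omega>)) \<longlonglongrightarrow> (\<Sum>i\<in>UNIV. v $ i * 0)"
          using h by (intro tendsto_sum tendsto_mult_left) blast
        then have d: "(\<lambda>n. v \<bullet> (\<chi> i. Y i n \<omega>) - L n \<omega>) \<longlonglongrightarrow> 0"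
          by (simp add: vY L_def right_diff_distrib sum_subtractf)
        have "norm (iexp (v \<bullet> (\<chi> i. Y i n \<omega>)) - iexp (L n \<omega>)) = norm (iexp (v \<bullet> (\<chi> i. Y i n \<omega>) - L n \<omega>) - 1)" for n
        proof -
          have "iexp (v \<bullet> (\<chi> i. Y i n \<omega>)) - iexp (L n \<omega>) = iexp (L n \<omega>) * (iexp (v \<bullet> (\<chi> i. Y i n \<omega>) - L n \<omega>) - 1)"
            by (simp add: right_diff_distrib exp_add[symmetric])
          then show ?thesis by (simp add: norm_mult)
        qed
        moreover have "(\<lambda>n. iexp (v \<bullet> (\<chi> i. Y i n \<omega>) - L n \<omega>) - 1) \<longlonglongrightarrow> exp (\<i> * complex_of_real 0) - 1"
          by (intro tendsto_intros d)
        ultimately show "(\<lambda>n. iexp (v \<bullet> (\<chi> i. Y i n \<omega>)) - iexp (L n \<omega>)) \<longlonglongrightarrow> 0"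
          by (subst tendsto_norm_zero_iff[symmetric]) (auto dest: tendsto_norm_zero)
      qed
      show "AE \<omega> in M. norm (iexp (v \<bullet> (\<chi> i. Y i n \<omega>)) - iexp (L n \<omega>)) \<le> 2" for n
        using norm_triangle_ineq4[of "iexp (v \<bullet> (\<chi> i. Y i n \<omega>))" "iexp (L n \<omega>)" for \<omega>] by (intro AE_I2) (smt (verit) norm_exp_i_times)
    qed auto
    then have "(\<lambda>n. (CLINT \<omega>|M. iexp (v \<bullet> (\<chi> i. Y i n \<omega>)) - iexp (L n \<omega>)) + (CLINT \<omega>|M. iexp (L n \<omega>)))
        \<longlonglongrightarrow> 0 + complex_of_real (exp (- (s0\<^sup>2 * (v \<bullet> (\<Sigma> *v v))) / 2))"
      using L by (intro tendsto_add) auto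
    moreover have "(CLINT \<omega>|M. iexp (v \<bullet> (\<chi> i. Y i n \<omega>)) - iexp (L n \<omega>)) + (CLINT \<omega>|M. iexp (L n \<omega>))
        = (CLINT \<omega>|M. iexp (v \<bullet> (\<chi> i. Y i n \<omega>)))" for n
      by (subst Bochner_Integration.integral_diff) (auto intro!: integrable_const_bound[where B=1])
    moreover have "(CLINT x|multivariate_normal 0 (s0\<^sup>2 *\<^sub>R \<Sigma>). iexp (v \<bullet> x)) = exp (- (s0\<^sup>2 * (v \<bullet> (\<Sigma> *v v))) / 2)"
      by (subst char_multivariate_normal[OF psd]) (simp add: scaleR_matrix_vector_assoc[symmetric])
    ultimately show "(\<lambda>n. CLINT \<omega>|M. iexp (v \<bullet> (\<chi> i. Y i n \<omega>)))
        \<longlonglongrightarrow> (CLINT x|multivariate_normal 0 (s0\<^sup>2 *\<^sub>R \<Sigma>). iexp (v \<bullet> x))"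
      by simp
  qed
  then show ?thesis by (simp add: Y_def a_def T_def s0_def)
qed

end
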